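(* For every $0<\alpha\leq 1$ there exist positive constants $A=O\left(\frac{1}{\alpha}\right)$, $a_{1}=O\left(\frac{1}{\alpha}\right)$ and $a_{2}=2^{-O\left(\frac{\log(1/\alpha)}{\alpha}\right)}$ such that for all sufficiently large $n$, every $\alpha$-expander $G$ on $n$ vertices contains, for every integer $\ell\in\left[a_{1}\log n,\,a_{2}n\right]$, a cycle whose length is between $\ell$ and $\ell+A$.
   Context: All graphs are finite and simple. For a graph $G=(V,E)$ and $U\subseteq V$, $N_G(U)=\{v\in V\setminus U: v \text{ has a neighbor in } U\}$ is the external neighborhood of $U$. For $\alpha>0$, a graph $G$ on $n$ vertices is an $\alpha$-expander if $|N_G(U)|\geq \alpha|U|$ for every $U\subseteq V$ with $|U|\leq\lceil n/2\rceil$. The length of a cycle is its number of edges. Logarithms are base $2$. The asymptotic notation refers to dependence on $\alpha$ with absolute implied constants: $A,a_1\le c/\alpha$ and $a_2\ge 2^{-c\log(1/\alpha)/\alpha}$ for some absolute constant $c>0$. *)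

theory Defs
  imports Complex_Main
begin

definition simple_graph :: "'a set \<Rightarrow> 'a set set \<Rightarrow> bool" where
  "simple_graph V E \<longleftrightarrow> finite V \<and> (\<forall>e\<in>E. e \<subseteq> V \<and> card e = 2)"

definition ext_nbhd :: "'a set \<Rightarrow> 'a set set \<Rightarrow> 'a set \<Rightarrow> 'a set" where
  "ext_nbhd V E U = {v \<in> V - U. \<exists>u\<in>U. {u, v} \<in> E}"

definition expander :: "real \<Rightarrow> 'a set \<Rightarrow> 'a set set \<Rightarrow> bool" where
  "expander \<alpha> V E \<longleftrightarrow> simple_graph V E \<and>
     (\<forall>U. U \<subseteq> V \<and> int (card U) \<le> \<lceil>real (card V) / 2\<rceil> \<longrightarrow>
        real (card (ext_nbhd V E U)) \<ge> \<alpha> * real (card U))"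

text \<open>
  A cycle is given by the list of its vertices in cyclic order; the first vertex is
  not repeated at the end.
\<close>

definition cycle_edges :: "'a list \<Rightarrow> 'a set set" where
  "cycle_edges p = {{p ! i, p ! (Suc i mod length p)} | i. i < length p}"

definition is_cycle :: "'a set \<Rightarrow> 'a set set \<Rightarrow> 'a list \<Rightarrow> bool" where
  "is_cycle V E p \<longleftrightarrow>
     3 \<le> length p \<and> distinct p \<and> set p \<subseteq> V \<and> cycle_edges p \<subseteq> E"

definition cycle_length :: "'a list \<Rightarrow> nat" where
  "cycle_length p = card (cycle_edges p)"

lemma cycle_length_eq_length:
  assumes "is_cycle V E p"
  shows "cycle_length p = length p"
proof -
  let ?n = "length p"
  let ?f = "\<lambda>i. {p ! i, p ! (Suc i mod ?n)}"
  have n: "3 \<le> ?n" and d: "distinct p"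
    using assms by (auto simp: is_cycle_def)
  have S: "Suc i mod ?n = (if Suc i = ?n then 0 else Suc i)" if "i < ?n" for i
    using that by auto
  have "inj_on ?f {..<?n}"
  proof (rule inj_onI)
    fix i j assume i: "i \<in> {..<?n}" and j: "j \<in> {..<?n}" and eq: "?f i = ?f j"
    have pos: "0 < ?n" using n by linarith
    have lt: "Suc i mod ?n < ?n" "Suc j mod ?n < ?n" 
      by (rule mod_less_divisor[OF pos])+
    have "i = j \<or> (i = Suc j mod ?n \<and> Suc i mod ?n = j)"
      using eq i j lt d by (auto simp: doubleton_eq_iff nth_eq_iff_index_eq)
    then show "i = j"
      using i j n by (auto simp: S split: if_splits)
  qed
  moreover have "cycle_edges p = ?f ` {..<?n}"
    by (auto simp: cycle_edges_def)
  ultimately show ?thesis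
    by (simp add: cycle_length_def card_image)
qed

end

theory Submission
  imports Defs "HOL-Library.Sublist"
begin

text \<open>
  The bound on \<open>a2\<close> tends to \<open>1\<close> as \<open>\<alpha>\<close> tends to \<open>1\<close>, so besides a general argument one needs an almost
  spanning one near \<open>\<alpha> = 1\<close> and an exact one at \<open>\<alpha> = 1\<close>.

  \<^item> \<open>\<alpha>\<close> bounded away from \<open>1\<close>: take a window of \<open>O(1/\<alpha>)\<close> levels of a breadth-first tree that carries a constant
  fraction of the vertices and is bounded by two thin levels. Deleting the few vertices with many
  descendants in the window leaves disjoint subtrees of bounded size. If the graph of these subtrees had
  no long path, depth-first search would produce a vertex set of linear size with too few neighbours.
  Let \<open>z\<close> be the deepest common ancestor of the subtrees on a long path. Two consecutive
  subtrees hang below different children of \<open>z\<close>, so for every later subtree one of the two hangs below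
  another child than it. Hence tree path from \<open>z\<close>, a stretch of the subtree path and
  tree path back to \<open>z\<close> close up to a cycle, and the stretch is
  prolonged in steps of \<open>O(1/\<alpha>)\<close>.

  \<^item> \<open>\<alpha> = 1 - \<epsilon>\<close> with small \<open>\<epsilon> > 0\<close>: now \<open>|N(U)| \<ge> |U| - \<epsilon> n\<close> for \<open>|U| \<le> n/2\<close>. After removing \<open>O(\<epsilon> n)\<close> vertices small
  sets expand by a factor of order \<open>1/\<epsilon>\<close>. Two trees of logarithmic depth with adjacent roots
  are grown on \<open>O(\<epsilon> n)\<close> vertices such that the neighbourhoods of their leaves cover together more than
  all of the rest. The rest has a cycle \<open>c\<close> missing only \<open>O(\<epsilon> n)\<close> vertices,
  and on it there are, at any prescribed distance, two vertices attached to
  the first and to the second tree. The cycle \<open>c\<close> comes from a partition into \<open>O(\<epsilon> n)\<close> paths, merged one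
  after the other by Posa rotations that act on all paths at once and may also trim a path by a
  few vertices.

  \<^item> \<open>\<alpha> = 1\<close>: the minimum degree is at least \<open>n/2\<close>, so the graph has a Hamilton cycle, and chords
  from two consecutive vertices of it give every length up to an error of one.
\<close>

section \<open>Paths and cycles\<close>

text \<open>Why trimming is needed near \<open>\<alpha> = 1\<close>: rotations alone give an end set
  \<open>S\<close> with at most \<open>2 |S|\<close> neighbours, which expansion by a factor just
  below one does not contradict once \<open>S\<close> is large, so the ends would stall at a
  constant fraction of the vertices. If paths may be trimmed by up to \<open>m\<close> vertices, a
  neighbour that is still no end has \<open>m\<close> consecutive ends beside it on its path, so
  that apart from about one per path only \<open>2 N / m\<close> such neighbours remain. This drives
  the ends to almost all vertices. The price is affordable. With \<open>k\<close> paths left, the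
  last \<open>M\<close> vertices of each form a target of about \<open>k M\<close> vertices, which
  sees some \<open>k M / (10 \<delta>)\<close> vertices, against roughly \<open>3 N / M\<close>
  non-ends. So \<open>M\<close> of order \<open>sqrt (\<delta> N / k)\<close> suffices, and the sum
  of this over all \<open>k\<close> up to \<open>O(\<delta> N)\<close> is again
  \<open>O(\<delta> N)\<close>. Away from \<open>1\<close> the demanded bound on \<open>a2\<close>
  is much weaker than the \<open>\<alpha> ^ 3 / 16000000\<close> that is obtained.\<close>

locale sgraph =
  fixes adj :: "'a \<Rightarrow> 'a \<Rightarrow> bool"
  assumes adj_sym: "adj u v \<Longrightarrow> adj v u"
    and adj_irrefl: "\<not> adj u u"
begin

text \<open>The ambient set \<open>W\<close> is an argument because vertices are deleted several
  times and expansion is then measured inside what remains.\<close>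

definition nb :: "'a set \<Rightarrow> 'a set \<Rightarrow> 'a set" where
  "nb W U = {v \<in> W - U. \<exists>u\<in>U. adj u v}"

definition pth :: "'a list \<Rightarrow> bool" where
  "pth xs \<longleftrightarrow> xs \<noteq> [] \<and> distinct xs \<and> successively adj xs"

definition cyc :: "'a list \<Rightarrow> bool" where
  "cyc xs \<longleftrightarrow> 3 \<le> length xs \<and> pth xs \<and> adj (last xs) (hd xs)"

lemma adj_commute: "adj u v \<longleftrightarrow> adj v u"
  using adj_sym by blast

lemma nb_subset: "nb W U \<subseteq> W"
  by (auto simp: nb_def)

lemma nb_disjoint: "nb W U \<inter> U = {}"
  by (auto simp: nb_def)

lemma finite_nb: "finite W \<Longrightarrow> finite (nb W U)"
  by (rule finite_subset[OF nb_subset])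

lemma successively_adj_flip [simp]: "successively (\<lambda>x y. adj y x) xs \<longleftrightarrow> successively adj xs"
  by (simp add: adj_commute)

lemma pth_rev [simp]: "pth (rev xs) \<longleftrightarrow> pth xs"
  by (simp add: pth_def)

lemma pth_append:
  "xs \<noteq> [] \<Longrightarrow> ys \<noteq> [] \<Longrightarrow>
    pth (xs @ ys) \<longleftrightarrow> pth xs \<and> pth ys \<and> set xs \<inter> set ys = {} \<and> adj (last xs) (hd ys)"
  by (auto simp: pth_def successively_append_iff)

lemma pth_appendD1: "pth (xs @ ys) \<Longrightarrow> xs \<noteq> [] \<Longrightarrow> pth xs"
  by (auto simp: pth_def successively_append_iff)

lemma pth_appendD2: "pth (xs @ ys) \<Longrightarrow> ys \<noteq> [] \<Longrightarrow> pth ys"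
  by (auto simp: pth_def successively_append_iff)

lemma pth_single [simp]: "pth [x]"
  by (simp add: pth_def)

lemma pth_ne: "pth xs \<Longrightarrow> xs \<noteq> []"
  by (simp add: pth_def)

lemma pth_distinct: "pth xs \<Longrightarrow> distinct xs"
  by (simp add: pth_def)

lemma walk_to_pth:
  assumes "successively adj xs" "xs \<noteq> []"
  shows "\<exists>ys. pth ys \<and> hd ys = hd xs \<and> last ys = last xs \<and> set ys \<subseteq> set xs \<and> length ys \<le> length xs"
  using assms
proof (induction "length xs" arbitrary: xs rule: less_induct)
  case less
  show ?case
  proof (cases "distinct xs")
    case True
    then show ?thesis using less.prems by (intro exI[of _ xs]) (auto simp: pth_def)
  next
    case False
    then obtain as bs cs y where xs: "xs = as @ [y] @ bs @ [y] @ cs"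
      using not_distinct_decomp by blast
    let ?zs = "as @ [y] @ cs"
    have s: "successively adj ?zs"
      using less.prems unfolding xs by (auto simp: successively_append_iff successively_Cons)
    have "length ?zs < length xs" by (simp add: xs)
    from less.hyps[OF this s] obtain ys where ys: "pth ys" "hd ys = hd ?zs" "last ys = last ?zs"
      "set ys \<subseteq> set ?zs" "length ys \<le> length ?zs" by auto
    have "hd ?zs = hd xs" "last ?zs = last xs"
      unfolding xs by (auto simp: hd_append)
    then show ?thesis using ys unfolding xs by (intro exI[of _ ys]) auto
  qed
qed

end

lemma sgraph_of_simple_graph:
  assumes "simple_graph V E"
  shows "sgraph (\<lambda>u v. {u, v} \<in> E)"
proof
  show "{v, u} \<in> E" if "{u, v} \<in> E" for u v using that by (simp add: insert_commute)
  show "{u, u} \<notin> E" for u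
  proof
    assume "{u, u} \<in> E"
    then have "card {u, u} = 2" using assms unfolding simple_graph_def by blast
    then show False by simp
  qed
qed

lemma is_cycle_of_cyc:
  assumes sg: "simple_graph V E" and c: "sgraph.cyc (\<lambda>u v. {u, v} \<in> E) xs"
  shows "is_cycle V E xs" "cycle_length xs = length xs"
proof -
  interpret sgraph "\<lambda>u v. {u, v} \<in> E" by (rule sgraph_of_simple_graph[OF sg])
  have len: "3 \<le> length xs" and d: "distinct xs" and s: "successively (\<lambda>u v. {u, v} \<in> E) xs"
    and lh: "{last xs, hd xs} \<in> E"
    using c by (auto simp: cyc_def pth_def)
  have e: "{xs ! i, xs ! (Suc i mod length xs)} \<in> E" if i: "i < length xs" for i
  proof (cases "Suc i = length xs")
    case True
    then have "i = length xs - 1" by simp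
    then have "xs ! i = last xs" using len by (metis last_conv_nth list.size(3) not_numeral_le_zero)
    moreover have "xs ! (Suc i mod length xs) = hd xs" using True len by (metis hd_conv_nth list.size(3) mod_self not_numeral_le_zero)
    ultimately show ?thesis using lh by simp
  next
    case False
    then have "Suc i < length xs" using i by simp
    then show ?thesis using s by (simp add: successively_conv_nth)
  qed
  have sub: "cycle_edges xs \<subseteq> E" using e by (auto simp: cycle_edges_def)
  have "set xs \<subseteq> V"
  proof
    fix x assume "x \<in> set xs"
    then obtain i where i: "i < length xs" "x = xs ! i" by (metis in_set_conv_nth)
    then show "x \<in> V" using e[OF i(1)] sg unfolding simple_graph_def by blast
  qed
  then show ic: "is_cycle V E xs" using len d sub by (simp add: is_cycle_def)
  then show "cycle_length xs = length xs" by (rule cycle_length_eq_length)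
qed

lemma expanderD:
  assumes "expander \<alpha> V E" "U \<subseteq> V" "int (card U) \<le> \<lceil>real (card V) / 2\<rceil>"
  shows "real (card (sgraph.nb (\<lambda>u v. {u, v} \<in> E) V U)) \<ge> \<alpha> * real (card U)"
proof -
  have sg: "simple_graph V E" using assms(1) by (simp add: expander_def)
  interpret sgraph "\<lambda>u v. {u, v} \<in> E" by (rule sgraph_of_simple_graph[OF sg])
  have "nb V U = ext_nbhd V E U" by (simp add: nb_def ext_nbhd_def)
  then show ?thesis using assms unfolding expander_def by simp
qed

definition cov :: "'a list set \<Rightarrow> 'a set" where
  "cov F = (\<Union>p\<in>F. set p)"

context sgraph
begin

definition forest :: "'a list set \<Rightarrow> bool" where
  "forest F \<longleftrightarrow> finite F \<and> (\<forall>p\<in>F. pth p) \<and> (\<forall>p\<in>F. \<forall>q\<in>F. p \<noteq> q \<longrightarrow> set p \<inter> set q = {})"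

end

section \<open>Consecutive pairs and segments of lists\<close>

lemma pair_append_cases:
  "[a, b] = xs @ ys \<Longrightarrow> (xs = [] \<and> ys = [a, b]) \<or> (xs = [a] \<and> ys = [b]) \<or> (xs = [a, b] \<and> ys = [])"
proof (cases xs)
  case (Cons c cs)
  assume "[a, b] = xs @ ys"
  then show ?thesis using Cons by (cases cs) simp_all
qed simp

lemma sublist_pair_append:
  "sublist [a, b] (xs @ ys) \<longleftrightarrow>
    sublist [a, b] xs \<or> sublist [a, b] ys \<or> (xs \<noteq> [] \<and> ys \<noteq> [] \<and> last xs = a \<and> hd ys = b)"
proof -
  have "(\<exists>xs1 xs2. [a, b] = xs1 @ xs2 \<and> suffix xs1 xs \<and> prefix xs2 ys) \<longleftrightarrow>
    suffix [a, b] xs \<or> prefix [a, b] ys \<or> (xs \<noteq> [] \<and> ys \<noteq> [] \<and> last xs = a \<and> hd ys = b)"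
    (is "?l \<longleftrightarrow> ?r")
  proof
    assume ?l
    then obtain xs1 xs2 where e: "[a, b] = xs1 @ xs2" "suffix xs1 xs" "prefix xs2 ys" by blast
    from pair_append_cases[OF e(1)]
    consider "xs1 = []" "xs2 = [a,b]" | "xs1 = [a]" "xs2 = [b]" | "xs1 = [a,b]" "xs2 = []"
      by blast
    then show ?r
    proof cases
      case 2
      obtain us where "xs = us @ [a]" using e(2) 2 by (auto simp: suffix_def)
      moreover obtain vs where "ys = b # vs" using e(3) 2 by (auto simp: prefix_def)
      ultimately show ?thesis by simp
    qed (use e in simp_all)
  next
    assume ?r
    then consider "suffix [a, b] xs" | "prefix [a, b] ys" | "xs \<noteq> []" "ys \<noteq> []" "last xs = a" "hd ys = b"
      by blast
    then show ?l
    proof cases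
      case 1
      then show ?thesis by (intro exI[of _ "[a,b]"] exI[of _ "[]"]) auto
    next
      case 2
      then show ?thesis by (intro exI[of _ "[]"] exI[of _ "[a,b]"]) auto
    next
      case 3
      then have "suffix [a] xs" "prefix [b] ys"
        by (metis append_butlast_last_id suffix_def, metis append_Cons append_Nil hd_Cons_tl prefix_def)
      then show ?thesis by (intro exI[of _ "[a]"] exI[of _ "[b]"]) auto
    qed
  qed
  then show ?thesis
    unfolding sublist_append using suffix_imp_sublist prefix_imp_sublist by blast
qed

lemma sublist_append_cases:
  assumes "sublist zs (xs @ ys)"
  obtains "sublist zs xs" | "sublist zs ys"
  | z1 z2 where "zs = z1 @ z2" "suffix z1 xs" "prefix z2 ys" "z1 \<noteq> []" "z2 \<noteq> []"
proof -
  from assms consider "sublist zs xs" | "sublist zs ys"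
    | z1 z2 where "zs = z1 @ z2" "suffix z1 xs" "prefix z2 ys"
    unfolding sublist_append by blast
  then show thesis
  proof cases
    case 3
    then show ?thesis using that by (cases "z1 = [] \<or> z2 = []") auto
  qed (use that in blast)+
qed

lemma sublist_trans: "sublist xs ys \<Longrightarrow> sublist ys zs \<Longrightarrow> sublist xs zs"
  by (rule sublist_order.order.trans)

lemma disj_insertI:
  assumes "\<And>z. z \<in> Q \<Longrightarrow> set z \<inter> set p = {}"
    and "\<And>z z'. z \<in> Q \<Longrightarrow> z' \<in> Q \<Longrightarrow> z \<noteq> z' \<Longrightarrow> set z \<inter> set z' = {}"
    and "a \<in> insert p Q" "b \<in> insert p Q" "a \<noteq> b"
  shows "set a \<inter> set b = {}"
proof -
  consider "a = p" "b \<in> Q" | "b = p" "a \<in> Q" | "a \<in> Q" "b \<in> Q" using assms(3-5) by blast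
  then show ?thesis
  proof cases
    case 1
    then show ?thesis using assms(1)[of b] by blast
  next
    case 2
    then show ?thesis using assms(1)[of a] by blast
  next
    case 3
    then show ?thesis using assms(2)[of a b] assms(5) by blast
  qed
qed

lemma sublist_rev_iff: "sublist (rev xs) ys \<longleftrightarrow> sublist xs (rev ys)"
  by (metis rev_rev_ident sublist_rev)

lemma sublist_set: "sublist xs ys \<Longrightarrow> set xs \<subseteq> set ys"
  by (rule set_mono_sublist)

lemma not_sublist_pair_single [simp]: "\<not> sublist [a, b] [c]"
  by (auto dest: sublist_length_le)

lemma distinct_pair_succ:
  assumes "distinct (p @ x # q)" "sublist [x, y] (p @ x # q)"
  shows "q \<noteq> [] \<and> y = hd q"
proof -
  have "sublist [x, y] (p @ [x] @ q)" using assms(2) by simp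
  then show ?thesis
    unfolding sublist_pair_append using assms(1) by (auto dest!: sublist_set)
qed

lemma distinct_pair_pred:
  assumes "distinct (p @ x # q)" "sublist [y, x] (p @ x # q)"
  shows "p \<noteq> [] \<and> y = last p"
proof -
  have "sublist [y, x] (p @ [x] @ q)" using assms(2) by simp
  then show ?thesis
    unfolding sublist_pair_append using assms(1) by (auto dest!: sublist_set)
qed

section \<open>Rotations of a path system\<close>

text \<open>\<open>P0\<close> is the active path and \<open>Q0\<close> the set of the other ones. The moves of \<open>reach\<close> are the rotation of the
  active path at its end \<open>v\<close> (\<open>R1\<close>), the exchange of tails with another path (\<open>R2\<close>), trimming the active end while at most
  \<open>\<tau>\<close> vertices are missing in total (\<open>TR\<close>), and appending an uncovered vertex (\<open>EX\<close>). First vertices of paths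
  never change. Reaching \<open>T0\<close> is the goal of the rotations.\<close>

locale rot = sgraph adj for adj :: "'a \<Rightarrow> 'a \<Rightarrow> bool" +
  fixes W :: "'a set" and P0 :: "'a list" and Q0 :: "'a list set" and T0 :: "'a set"
  assumes finW: "finite W" and F0: "forest (insert P0 Q0)" and P0Q0: "P0 \<notin> Q0"
    and covW: "cov (insert P0 Q0) \<subseteq> W"
begin

abbreviation "F \<equiv> insert P0 Q0"

definition csz :: "'a list \<Rightarrow> 'a list set \<Rightarrow> nat" where
  "csz P Q = length P + (\<Sum>q\<in>Q. length q)"

inductive reach :: "nat \<Rightarrow> 'a list \<Rightarrow> 'a list set \<Rightarrow> bool" for \<tau> where
  base: "reach \<tau> P0 Q0"
| R1: "reach \<tau> (p @ x # q @ [v]) Q \<Longrightarrow> adj v x \<Longrightarrow> q \<noteq> [] \<Longrightarrow> reach \<tau> (p @ x # v # rev q) Q"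
| R2: "reach \<tau> P Q \<Longrightarrow> s @ x # t \<in> Q \<Longrightarrow> s \<noteq> [] \<Longrightarrow> adj (last P) x \<Longrightarrow>
        reach \<tau> s (insert (P @ x # t) (Q - {s @ x # t}))"
| TR: "reach \<tau> (p @ [v]) Q \<Longrightarrow> p \<noteq> [] \<Longrightarrow> csz P0 Q0 \<le> csz p Q + \<tau> \<Longrightarrow> reach \<tau> p Q"
| EX: "reach \<tau> P Q \<Longrightarrow> r \<in> W - cov (insert P Q) \<Longrightarrow> adj (last P) r \<Longrightarrow> reach \<tau> (P @ [r]) Q"

definition S :: "nat \<Rightarrow> 'a set" where
  "S \<tau> = {last P | P Q. reach \<tau> P Q}"

lemma SI: "reach \<tau> P Q \<Longrightarrow> last P \<in> S \<tau>"
  by (auto simp: S_def)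

lemma reach_mono: "reach \<tau> P Q \<Longrightarrow> \<tau> \<le> \<tau>' \<Longrightarrow> reach \<tau>' P Q"
proof (induction rule: reach.induct)
  case base
  show ?case by (rule reach.base)
next
  case (R1 p x q v Q)
  show ?case by (rule reach.R1[OF R1.IH[OF R1.prems] R1.hyps(2,3)])
next
  case (R2 P Q s x t)
  show ?case by (rule reach.R2[OF R2.IH[OF R2.prems] R2.hyps(2-4)])
next
  case (TR p v Q)
  show ?case using TR.hyps(3) TR.prems by (intro reach.TR[OF TR.IH[OF TR.prems] TR.hyps(2)]) simp
next
  case (EX P Q r)
  show ?case by (rule reach.EX[OF EX.IH[OF EX.prems] EX.hyps(2,3)])
qed

lemma S_mono: "\<tau> \<le> \<tau>' \<Longrightarrow> S \<tau> \<subseteq> S \<tau>'"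
  unfolding S_def using reach_mono by blast

definition valid :: "'a list \<Rightarrow> 'a list set \<Rightarrow> bool" where
  "valid P Q \<longleftrightarrow> forest (insert P Q) \<and> P \<notin> Q \<and> cov (insert P Q) \<subseteq> W \<and> card Q = card Q0 \<and>
     hd ` insert P Q = hd ` F"

lemma validI:
  assumes v: "valid P Q" and fin: "finite Q'" and p: "pth P'" "\<And>q. q \<in> Q' \<Longrightarrow> pth q"
    and d: "\<And>q q'. q \<in> insert P' Q' \<Longrightarrow> q' \<in> insert P' Q' \<Longrightarrow> q \<noteq> q' \<Longrightarrow> set q \<inter> set q' = {}"
    and "P' \<notin> Q'" "cov (insert P' Q') \<subseteq> W" "card Q' = card Q" "hd ` insert P' Q' = hd ` insert P Q"
  shows "valid P' Q'"
  using assms unfolding valid_def forest_def by auto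

lemma reach_valid: "reach \<tau> P Q \<Longrightarrow> valid P Q"
proof (induction rule: reach.induct)
  case base
  then show ?case using F0 P0Q0 covW by (auto simp: valid_def)
next
  case (R1 p x q v Q)
  let ?P = "p @ x # q @ [v]" and ?P' = "p @ x # v # rev q"
  have s: "set ?P' = set ?P" by auto
  have f: "forest (insert ?P Q)" and nin: "?P \<notin> Q" using R1.IH by (auto simp: valid_def)
  have "pth ?P" using f by (auto simp: forest_def)
  then have pP': "pth ?P'" using R1.hyps
    by (auto simp: pth_def successively_append_iff successively_Cons adj_commute hd_rev split: if_splits)
  have dq: "set q' \<inter> set ?P = {}" if "q' \<in> Q" for q'
  proof -
    have "q' \<noteq> ?P" using nin that by blast
    then show ?thesis using f that unfolding forest_def by blast
  qed
  show ?case
  proof (rule validI[OF R1.IH])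
    show "finite Q" "\<And>q. q \<in> Q \<Longrightarrow> pth q" using f by (auto simp: forest_def)
    show "pth ?P'" by fact
    show "?P' \<notin> Q" using dq[of ?P'] s by auto
    show "set a \<inter> set b = {}" if "a \<in> insert ?P' Q" "b \<in> insert ?P' Q" "a \<noteq> b" for a b
    proof (rule disj_insertI[OF _ _ that])
      show "set z \<inter> set ?P' = {}" if "z \<in> Q" for z using dq[OF that] s by simp
      show "set z \<inter> set z' = {}" if "z \<in> Q" "z' \<in> Q" "z \<noteq> z'" for z z'
        using f that unfolding forest_def by blast
    qed
    show "cov (insert ?P' Q) \<subseteq> W" using R1.IH s by (auto simp: valid_def cov_def)
    show "hd ` insert ?P' Q = hd ` insert ?P Q" by (auto simp: hd_append)
  qed simp
next
  case (R2 P Q s x t)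
  let ?q = "s @ x # t" and ?q' = "P @ x # t"
  have f: "forest (insert P Q)" and nin: "P \<notin> Q" using R2.IH by (auto simp: valid_def)
  have pP: "pth P" and pq: "pth ?q" using f R2.hyps by (auto simp: forest_def)
  have dPq: "set P \<inter> set ?q = {}"
    using f R2.hyps nin unfolding forest_def by (metis insertCI)
  have d1: "set z \<inter> set P = {}" "z \<noteq> ?q \<Longrightarrow> set z \<inter> set ?q = {}" "pth z" if "z \<in> Q" for z
    using f that nin R2.hyps(2) unfolding forest_def by (metis insertCI)+
  have ps: "pth s" using pq R2.hyps(3) by (rule pth_appendD1)
  have pxt: "pth (x # t)" using pq by (rule pth_appendD2) simp
  have pq': "pth ?q'"
    using pP pxt dPq R2.hyps(4) by (subst pth_append) (auto dest: pth_ne)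
  have sne: "set s \<noteq> {}" "set P \<noteq> {}" using ps pP by (auto dest: pth_ne)
  have dsx: "set s \<inter> set ([x] @ t) = {}" using pq by (auto simp: pth_def)
  show ?case
  proof (rule validI[OF R2.IH])
    show "finite (insert ?q' (Q - {?q}))" using f by (auto simp: forest_def)
    show "pth s" by fact
    show "pth q" if "q \<in> insert ?q' (Q - {?q})" for q using that pq' d1(3) by auto
    show "s \<notin> insert ?q' (Q - {?q})"
    proof
      assume "s \<in> insert ?q' (Q - {?q})"
      then consider "s = ?q'" | "s \<in> Q" "s \<noteq> ?q" by blast
      then show False
      proof cases
        case 1
        then have "set P \<subseteq> set s" by (metis Un_upper1 set_append)
        moreover have "hd P \<in> set P" using pth_ne[OF pP] by simp
        ultimately show False using dPq by auto
      next
        case 2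
        then show False using d1(2)[of s] sne by auto
      qed
    qed
    have nin': "?q' \<notin> Q - {?q}"
    proof
      assume a: "?q' \<in> Q - {?q}"
      then have "set ?q' \<inter> set P = {}" using d1(1) by blast
      then show False using sne by auto
    qed
    show "card (insert ?q' (Q - {?q})) = card Q"
    proof -
      have fQ: "finite Q" using f by (auto simp: forest_def)
      then have "0 < card Q" using R2.hyps(2) by (auto simp: card_gt_0_iff)
      then show ?thesis using nin' fQ R2.hyps(2) by (simp add: card_insert_if)
    qed
    show "cov (insert s (insert ?q' (Q - {?q}))) \<subseteq> W"
    proof -
      have c: "set P \<union> cov Q \<subseteq> W" using R2.IH by (simp add: valid_def cov_def)
      have "set ?q \<subseteq> cov Q" using R2.hyps(2) unfolding cov_def by blast
      moreover have "cov (Q - {?q}) \<subseteq> cov Q" unfolding cov_def by blast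
      ultimately have "set s \<union> (set ?q' \<union> cov (Q - {?q})) \<subseteq> W" using c by auto
      then show ?thesis by (simp add: cov_def)
    qed
    show "hd ` insert s (insert ?q' (Q - {?q})) = hd ` insert P Q"
    proof -
      have "hd s = hd ?q" "hd ?q' = hd P" using R2.hyps(3) pth_ne[OF pP] by auto
      then have "hd ` insert s (insert ?q' (Q - {?q})) = insert (hd P) (hd ` insert ?q (Q - {?q}))"
        by auto
      also have "insert ?q (Q - {?q}) = Q" using R2.hyps(2) by blast
      finally show ?thesis by simp
    qed
    have sq': "set s \<inter> set ?q' = {}" using dsx dPq by auto
    have zs: "set z \<inter> set s = {}" "set z \<inter> set ?q' = {}" if "z \<in> Q - {?q}" for z
      using d1[of z] that by auto
    have zz: "set z \<inter> set z' = {}" if "z \<in> Q - {?q}" "z' \<in> Q - {?q}" "z \<noteq> z'" for z z'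
      using f that unfolding forest_def by blast
    show "set a \<inter> set b = {}" if "a \<in> insert s (insert ?q' (Q - {?q}))"
      "b \<in> insert s (insert ?q' (Q - {?q}))" "a \<noteq> b" for a b
    proof (rule disj_insertI[OF _ _ that])
      show "set z \<inter> set s = {}" if "z \<in> insert ?q' (Q - {?q})" for z
        using that sq' zs(1)[of z] by blast
      show "set z \<inter> set z' = {}" if "z \<in> insert ?q' (Q - {?q})" "z' \<in> insert ?q' (Q - {?q})" "z \<noteq> z'" for z z'
        by (rule disj_insertI[OF zs(2) zz that])
    qed
  qed
next
  case (TR p v Q)
  let ?P = "p @ [v]"
  have f: "forest (insert ?P Q)" and nin: "?P \<notin> Q" using TR.IH by (auto simp: valid_def)
  have dq: "set q' \<inter> set ?P = {}" if "q' \<in> Q" for q'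
    using f nin that unfolding forest_def by (metis insertCI)
  have pp: "pth p" using f TR.hyps(2) pth_appendD1 by (auto simp: forest_def)
  show ?case
  proof (rule validI[OF TR.IH])
    show "finite Q" "\<And>q. q \<in> Q \<Longrightarrow> pth q" using f by (auto simp: forest_def)
    show "p \<notin> Q" using dq[of p] TR.hyps(2) by auto
    show "set a \<inter> set b = {}" if "a \<in> insert p Q" "b \<in> insert p Q" "a \<noteq> b" for a b
    proof (rule disj_insertI[OF _ _ that])
      show "set z \<inter> set p = {}" if "z \<in> Q" for z using dq[OF that] by auto
      show "set z \<inter> set z' = {}" if "z \<in> Q" "z' \<in> Q" "z \<noteq> z'" for z z'
        using f that unfolding forest_def by blast
    qed
    show "cov (insert p Q) \<subseteq> W" using TR.IH by (auto simp: valid_def cov_def)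
    show "hd ` insert p Q = hd ` insert ?P Q" using TR.hyps(2) by (auto simp: hd_append)
  qed (use pp in auto)
next
  case (EX P Q r)
  have f: "forest (insert P Q)" and nin: "P \<notin> Q" using EX.IH by (auto simp: valid_def)
  have dq: "set q' \<inter> set P = {}" if "q' \<in> Q" for q'
    using f nin that unfolding forest_def by (metis insertCI)
  have pP: "pth P" using f by (auto simp: forest_def)
  have rP: "r \<notin> set P" and rQ: "\<And>q. q \<in> Q \<Longrightarrow> r \<notin> set q" using EX.hyps(2) by (auto simp: cov_def)
  have p': "pth (P @ [r])" using pP EX.hyps(3) rP by (subst pth_append) (auto dest: pth_ne)
  have dq': "set q' \<inter> set (P @ [r]) = {}" if "q' \<in> Q" for q' using dq[OF that] rQ[OF that] by auto
  show ?case
  proof (rule validI[OF EX.IH])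
    show "finite Q" "\<And>q. q \<in> Q \<Longrightarrow> pth q" using f by (auto simp: forest_def)
    show "P @ [r] \<notin> Q" using dq'[of "P @ [r]"] by auto
    show "set a \<inter> set b = {}" if "a \<in> insert (P @ [r]) Q" "b \<in> insert (P @ [r]) Q" "a \<noteq> b" for a b
    proof (rule disj_insertI[OF _ _ that])
      show "set z \<inter> set (P @ [r]) = {}" if "z \<in> Q" for z by (rule dq'[OF that])
      show "set z \<inter> set z' = {}" if "z \<in> Q" "z' \<in> Q" "z \<noteq> z'" for z z'
        using f that unfolding forest_def by blast
    qed
    show "cov (insert (P @ [r]) Q) \<subseteq> W" using EX.IH EX.hyps(2) by (auto simp: valid_def cov_def)
    show "hd ` insert (P @ [r]) Q = hd ` insert P Q" using pth_ne[OF pP] by auto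
  qed (use p' in auto)
qed

lemma reach_pth: "reach \<tau> P Q \<Longrightarrow> p \<in> insert P Q \<Longrightarrow> pth p"
  using reach_valid[of \<tau> P Q] by (simp add: valid_def forest_def) blast

lemma reach_finite: "reach \<tau> P Q \<Longrightarrow> finite Q"
  using reach_valid[of \<tau> P Q] by (simp add: valid_def forest_def)

lemma reach_unique:
  "reach \<tau> P Q \<Longrightarrow> p \<in> insert P Q \<Longrightarrow> q \<in> insert P Q \<Longrightarrow> x \<in> set p \<Longrightarrow> x \<in> set q \<Longrightarrow> p = q"
  using reach_valid[of \<tau> P Q] unfolding valid_def forest_def by blast

text \<open>\<open>R1\<close> and \<open>R2\<close> only move vertices between paths,
  \<open>EX\<close> adds one, and the side condition of \<open>TR\<close> is the claim itself. So
  \<open>\<tau>\<close> bounds the net loss, not the number of trims.\<close>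

lemma reach_csz: "reach \<tau> P Q \<Longrightarrow> csz P0 Q0 \<le> csz P Q + \<tau>"
proof (induction rule: reach.induct)
  case (R2 P Q s x t)
  have "finite Q" using R2.hyps(1) by (rule reach_finite)
  have "P @ x # t \<notin> Q - {s @ x # t}"
  proof
    assume a: "P @ x # t \<in> Q - {s @ x # t}"
    then have "P @ x # t = P"
      using reach_unique[OF R2.hyps(1), of "P @ x # t" P "last P"] reach_pth[OF R2.hyps(1), of P] pth_ne by auto
    then show False by simp
  qed
  then have "(\<Sum>q\<in>insert (P @ x # t) (Q - {s @ x # t}). length q) + length (s @ x # t)
     = length (P @ x # t) + (\<Sum>q\<in>Q. length q)"
    using \<open>finite Q\<close> R2.hyps(2) by (simp add: sum.remove[of Q "s @ x # t" length])
  then show ?case using R2.IH by (simp add: csz_def)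
qed (auto simp: csz_def)

lemma trim:
  assumes "reach \<tau> (A @ z # B) Q"
  shows "reach (\<tau> + length B) (A @ [z]) Q"
  using assms
proof (induction B rule: rev_induct)
  case (snoc b B)
  have r: "reach \<tau> ((A @ z # B) @ [b]) Q" using snoc.prems by simp
  have r': "reach (\<tau> + length (B @ [b])) ((A @ z # B) @ [b]) Q"
    by (rule reach_mono[OF r]) simp
  have "csz P0 Q0 \<le> csz (A @ z # B @ [b]) Q + \<tau>" using reach_csz[OF snoc.prems] by simp
  then have "csz P0 Q0 \<le> csz (A @ z # B) Q + (\<tau> + 1)" by (simp add: csz_def)
  \<comment> \<open>The allowance is raised to its final value first; then the tail shrinks one
    vertex at a time. Invariant: the loss so far is at most \<open>\<tau>\<close> plus the number of
    vertices already removed.\<close>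
  have aux: "reach (\<tau> + length C) ((A @ [z]) @ C') Q \<Longrightarrow> length C' \<le> length C \<Longrightarrow>
      csz P0 Q0 \<le> csz ((A @ [z]) @ C') Q + \<tau> + (length C - length C') \<Longrightarrow> reach (\<tau> + length C) (A @ [z]) Q" for C C' :: "'a list"
  proof (induction C' rule: rev_induct)
    case (snoc c C')
    have "reach (\<tau> + length C) (((A @ [z]) @ C') @ [c]) Q" using snoc.prems by simp
    then have "reach (\<tau> + length C) ((A @ [z]) @ C') Q"
      by (rule reach.TR) (use snoc.prems in \<open>auto simp: csz_def\<close>)
    then show ?case using snoc.IH snoc.prems by (simp add: csz_def)
  qed simp
  show ?case
    by (rule aux[of "B @ [b]" "B @ [b]"]) (use r' reach_csz[OF snoc.prems] in \<open>auto\<close>)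
qed simp

lemma trim_S: "reach \<tau> (A @ z # B) Q \<Longrightarrow> z \<in> S (\<tau> + length B)"
  using SI[OF trim] by simp

text \<open>Only \<open>EX\<close> enlarges the covered set, and the vertex it adds is the active
  end at that moment.\<close>

lemma cov_sub: "reach \<tau> P Q \<Longrightarrow> cov (insert P Q) \<subseteq> cov F \<union> S \<tau>"
proof (induction rule: reach.induct)
  case (R1 p x q v Q)
  then show ?case by (simp add: cov_def) 
next
  case (R2 P Q s x t)
  have "set (s @ x # t) \<subseteq> cov Q" using R2.hyps(2) unfolding cov_def by blast
  moreover have "cov (Q - {s @ x # t}) \<subseteq> cov Q" unfolding cov_def by blast
  moreover have "set P \<union> cov Q \<subseteq> cov F \<union> S \<tau>" using R2.IH by (simp add: cov_def)
  ultimately have "set s \<union> (set (P @ x # t) \<union> cov (Q - {s @ x # t})) \<subseteq> cov F \<union> S \<tau>" by auto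
  then show ?case by (simp add: cov_def)
next
  case (TR p v Q)
  then show ?case by (auto simp: cov_def)
next
  case (EX P Q r)
  have "r \<in> S \<tau>" using SI[OF reach.EX[OF EX.hyps]] by simp
  then show ?case using EX.IH by (auto simp: cov_def)
qed (auto simp: cov_def)

text \<open>The first move that breaks a base segment makes an inner vertex of it the active end,
  with one of the two halves of the segment hanging at that end: trimming then exposes an
  extremity.\<close>

lemma intact_or_end:
  assumes "reach \<tau> P Q" and "p0 \<in> F" "sublist ys p0" "2 \<le> length ys"
  shows "(\<exists>p\<in>insert P Q. sublist ys p \<or> sublist (rev ys) p) \<or>
    hd ys \<in> S (\<tau> + (length ys - 2)) \<or> last ys \<in> S (\<tau> + (length ys - 2))"
  using assms(1)
proof (induction rule: reach.induct)
  case base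
  then show ?case using assms by blast
next
  case (R1 p x q v Q)
  let ?P = "p @ x # q @ [v]" and ?P' = "p @ x # v # rev q"
  have r': "reach \<tau> ?P' Q" by (rule reach.R1[OF R1.hyps])
  have key: "(\<exists>p\<in>insert ?P' Q. sublist zs p \<or> sublist (rev zs) p) \<or> last zs \<in> S (\<tau> + (length zs - 2))"
    if zs: "sublist zs ?P" "2 \<le> length zs" for zs
  proof -
    have "sublist zs ((p @ [x]) @ (q @ [v]))" using zs by simp
    then show ?thesis
    proof (cases rule: sublist_append_cases)
      case 1
      have "sublist (p @ [x]) ((p @ [x]) @ v # rev q)" by (rule sublist_append_rightI)
      then have "sublist (p @ [x]) ?P'" by simp
      then show ?thesis using 1 by (meson insertI1 sublist_trans)
    next
      case 2
      have "sublist (rev zs) (rev (q @ [v]))" using 2 by (subst sublist_rev)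
      moreover have "sublist (rev (q @ [v])) ((p @ [x]) @ rev (q @ [v]))" by (rule sublist_append_leftI)
      then have "sublist (rev (q @ [v])) ?P'" by simp
      ultimately show ?thesis by (meson insertI1 sublist_trans)
    next
      case (3 z1 z2)
      \<comment> \<open>The edge removed by the rotation lies inside the segment. Its later part
        \<open>z2\<close> now stands reversed at the very end of the path, so trimming all of
        \<open>z2\<close> but its last vertex exposes an extremity; as \<open>z1\<close> is nonempty
        this takes at most \<open>length zs - 2\<close> trims.\<close>
      obtain w where w: "q @ [v] = z2 @ w" using 3 by (auto simp: prefix_def)
      have "[v] @ rev q = rev w @ rev z2" by (metis rev_append rev_singleton_conv w)
      then have P': "?P' = (p @ x # rev w) @ rev z2" by simp
      have rz: "rev z2 = last z2 # rev (butlast z2)"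
      proof -
        have "rev (butlast z2 @ [last z2]) = last z2 # rev (butlast z2)" by simp
        then show ?thesis by (simp only: append_butlast_last_id[OF \<open>z2 \<noteq> []\<close>])
      qed
      have "?P' = (p @ x # rev w) @ last z2 # rev (butlast z2)"
        unfolding P' rz by simp
      with r' have "reach \<tau> ((p @ x # rev w) @ last z2 # rev (butlast z2)) Q" by simp
      then have "last z2 \<in> S (\<tau> + length (rev (butlast z2)))" by (rule trim_S)
      moreover have "length (rev (butlast z2)) \<le> length zs - 2" using 3 by (cases z1) auto
      ultimately have "last z2 \<in> S (\<tau> + (length zs - 2))" using S_mono by (meson add_le_cancel_left subsetD)
      then show ?thesis using 3 by simp
    qed
  qed
  from R1.IH show ?case
  proof (elim disjE bexE)
    fix z assume z: "z \<in> insert ?P Q" "sublist ys z"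
    then show ?thesis using key[of ys] assms(4) by auto
  next
    fix z assume z: "z \<in> insert ?P Q" "sublist (rev ys) z"
    then show ?thesis using key[of "rev ys"] assms(4) by (auto simp: last_rev)
  qed auto
next
  case (R2 P Q s x t)
  let ?q = "s @ x # t" and ?q' = "P @ x # t"
  let ?Q' = "insert ?q' (Q - {?q})"
  have r': "reach \<tau> s ?Q'" by (rule reach.R2[OF R2.hyps])
  have key: "(\<exists>p\<in>insert s ?Q'. sublist zs p \<or> sublist (rev zs) p) \<or> hd zs \<in> S (\<tau> + (length zs - 2))"
    if zs: "sublist zs z" "2 \<le> length zs" and z: "z \<in> insert P Q" for zs z
  proof (cases "z = P")
    case True
    then have "sublist zs ?q'" using zs by (meson sublist_append_rightI sublist_trans)
    then show ?thesis by blast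
  next
    case False
    show ?thesis
    proof (cases "z = ?q")
      case False
      then show ?thesis using \<open>z \<noteq> P\<close> z zs by blast
    next
      case True
      then have "sublist zs (s @ x # t)" using zs(1) by simp
      then show ?thesis
      proof (cases rule: sublist_append_cases)
        case 1
        then show ?thesis by blast
      next
        case 2
        then have "sublist zs ?q'" by (meson sublist_append_leftI sublist_trans)
        then show ?thesis by blast
      next
        case (3 z1 z2)
        then obtain w where w: "s = w @ z1" by (auto simp: suffix_def)
        have "s = w @ hd z1 # tl z1" using w 3 by simp
        then have "hd z1 \<in> S (\<tau> + length (tl z1))" using r' trim_S by metis
        moreover have "length (tl z1) \<le> length zs - 2" using 3 by (cases z2) auto
        ultimately have "hd z1 \<in> S (\<tau> + (length zs - 2))" using S_mono by (meson add_le_cancel_left subsetD)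
        then show ?thesis using 3 by simp
      qed
    qed
  qed
  from R2.IH show ?case
  proof (elim disjE bexE)
    fix z assume z: "z \<in> insert P Q" "sublist ys z"
    then show ?thesis using key[of ys z] assms(4) by blast
  next
    fix z assume z: "z \<in> insert P Q" "sublist (rev ys) z"
    then show ?thesis using key[of "rev ys" z] assms(4) by (auto simp: hd_rev)
  qed auto
next
  case (TR p v Q)
  have vS: "v \<in> S (\<tau> + n)" for n
  proof -
    have "v \<in> S \<tau>" using SI[OF TR.hyps(1)] by simp
    then show ?thesis using S_mono[of \<tau> "\<tau> + n"] by auto
  qed
  have key: "(\<exists>p\<in>insert p Q. sublist zs p \<or> sublist (rev zs) p) \<or> last zs \<in> S (\<tau> + (length zs - 2))"
    if zs: "sublist zs (p @ [v])" "2 \<le> length zs" for zs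
  proof -
    from zs(1) show ?thesis
    proof (cases rule: sublist_append_cases)
      case 1
      then show ?thesis by blast
    next
      case 2
      then have "length zs \<le> 1" by (auto dest: sublist_length_le)
      then show ?thesis using zs by simp
    next
      case (3 z1 z2)
      then have "z2 = [v]" by (cases z2) (auto simp: prefix_Cons)
      then show ?thesis using 3 vS by simp
    qed
  qed
  from TR.IH show ?case
  proof (elim disjE bexE)
    fix z assume z: "z \<in> insert (p @ [v]) Q" "sublist ys z"
    then show ?thesis using key[of ys] assms(4) by auto
  next
    fix z assume z: "z \<in> insert (p @ [v]) Q" "sublist (rev ys) z"
    then show ?thesis using key[of "rev ys"] assms(4) by (auto simp: last_rev)
  qed auto
next
  case (EX P Q r)
  have "\<exists>z'\<in>insert (P @ [r]) Q. sublist zs z'" if "z \<in> insert P Q" "sublist zs z" for z zs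
  proof (cases "z = P")
    case True
    then have "sublist zs (P @ [r])" using that sublist_trans sublist_append_rightI by metis
    then show ?thesis by blast
  qed (use that in blast)
  then show ?case using EX.IH by blast
qed

end

text \<open>The runs of length \<open>m\<close> after different members of \<open>X\<close> are
  disjoint: an overlap would put the later member itself into the run of the earlier one, hence into
  \<open>S'\<close>.\<close>

lemma list_runs_full:
  assumes d: "distinct p" and fin: "finite S'" and m: "1 \<le> m"
    and X: "\<And>x. x \<in> X \<Longrightarrow> x \<notin> S' \<and> (\<exists>l r. p = l @ x # r \<and> m \<le> length r \<and> set (take m r) \<subseteq> S')"
  shows "m * card X \<le> card (S' \<inter> set p)"
proof -
  have "\<exists>i. x \<in> X \<longrightarrow> i + m < length p \<and> p ! i = x \<and> (\<forall>j. 1 \<le> j \<and> j \<le> m \<longrightarrow> p ! (i + j) \<in> S')" for x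
  proof (cases "x \<in> X")
    case True
    then obtain l r where lr: "p = l @ x # r" "m \<le> length r" "set (take m r) \<subseteq> S'" using X by blast
    have "p ! (length l + j) \<in> S'" if "1 \<le> j" "j \<le> m" for j
    proof -
      have "p ! (length l + j) = r ! (j - 1)" using lr(1) that by (simp add: nth_append nth_Cons')
      moreover have "r ! (j - 1) = take m r ! (j - 1)" using that by simp
      moreover have "take m r ! (j - 1) \<in> set (take m r)" using that lr(2) by (intro nth_mem) simp
      ultimately show ?thesis using lr(3) by auto
    qed
    then show ?thesis using lr by (intro exI[of _ "length l"]) (auto simp: nth_append)
  qed simp
  then obtain idx where idx: "\<And>x. x \<in> X \<Longrightarrow> idx x + m < length p \<and> p ! idx x = x \<and>
      (\<forall>j. 1 \<le> j \<and> j \<le> m \<longrightarrow> p ! (idx x + j) \<in> S')"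
    by metis
  have Xp: "X \<subseteq> set p" using X by (metis in_set_conv_decomp subsetI)
  then have finX: "finite X" by (rule finite_subset) simp
  let ?f = "\<lambda>(x, j). p ! (idx x + j)"
  have no: "x = y" if xy: "x \<in> X" "y \<in> X" "idx x \<le> idx y" and j: "j \<in> {1..m}" "j' \<in> {1..m}"
    "idx x + j = idx y + j'" for x y j j'
  proof (rule ccontr)
    assume "x \<noteq> y"
    then have "idx x < idx y" using idx xy by (metis le_neq_implies_less)
    moreover have "idx y - idx x \<le> m" using j by auto
    moreover have "1 \<le> idx y - idx x" using \<open>idx x < idx y\<close> by simp
    moreover have "\<forall>j. 1 \<le> j \<and> j \<le> m \<longrightarrow> p ! (idx x + j) \<in> S'" using idx[OF xy(1)] by blast
    ultimately have "p ! (idx x + (idx y - idx x)) \<in> S'" by blast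
    then have "y \<in> S'" using idx[OF xy(2)] \<open>idx x < idx y\<close> by simp
    then show False using X xy(2) by blast
  qed
  have inj: "inj_on ?f (X \<times> {1..m})"
  proof (rule inj_onI, clarify)
    fix x j y j' assume a: "x \<in> X" "y \<in> X" "j \<in> {1..m}" "j' \<in> {1..m}" "p ! (idx x + j) = p ! (idx y + j')"
    have "idx x + j < length p" "idx y + j' < length p" using idx[OF a(1)] idx[OF a(2)] a(3,4) by auto
    then have e: "idx x + j = idx y + j'" using a(5) d nth_eq_iff_index_eq by blast
    have "x = y"
    proof (cases "idx x \<le> idx y")
      case True
      then show ?thesis using no a e by blast
    next
      case False
      then show ?thesis using no[of y x j' j] a e by auto
    qed
    then show "x = y \<and> j = j'" using e by simp
  qed
  have "?f ` (X \<times> {1..m}) \<subseteq> S' \<inter> set p"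
  proof clarify
    fix x j assume a: "x \<in> X" "j \<in> {1..m}"
    then have "idx x + j < length p" using idx[OF a(1)] by auto
    then show "p ! (idx x + j) \<in> S' \<inter> set p" using idx[OF a(1)] a(2) by auto
  qed
  then have "card (?f ` (X \<times> {1..m})) \<le> card (S' \<inter> set p)" using fin by (intro card_mono) auto
  moreover have "card (?f ` (X \<times> {1..m})) = card (X \<times> {1..m})" by (rule card_image[OF inj])
  then have "card (?f ` (X \<times> {1..m})) = m * card X" by (simp add: card_cartesian_product)
  ultimately show ?thesis by simp
qed

text \<open>Such an \<open>x\<close> is the last entry of \<open>p\<close> outside
  \<open>S'\<close>, hence unique.\<close>

lemma list_runs_short:
  assumes d: "distinct p"
    and X: "\<And>x. x \<in> X \<Longrightarrow> x \<notin> S' \<and> (\<exists>l r. p = l @ x # r \<and> set r \<subseteq> S')"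
  shows "card X \<le> 1"
proof -
  have "x = y" if "x \<in> X" "y \<in> X" for x y
  proof (rule ccontr)
    assume ne: "x \<noteq> y"
    obtain l r where a: "p = l @ x # r" "set r \<subseteq> S'" using X \<open>x \<in> X\<close> by blast
    obtain l' r' where b: "p = l' @ y # r'" "set r' \<subseteq> S'" using X \<open>y \<in> X\<close> by blast
    have nx: "x \<notin> S'" "y \<notin> S'" using X that by auto
    have "y \<in> set p" using b by simp
    then have "y \<in> set l" using a nx ne by auto
    then obtain u v where u: "l = u @ y # v" by (meson split_list)
    have p: "p = u @ y # (v @ x # r)" using a u by simp
    then have "y \<notin> set u" "y \<notin> set (v @ x # r)" using d by auto
    then have "r' = v @ x # r" using p b(1) append_Cons_eq_iff[of y u "v @ x # r" l' r'] by simp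
    then show False using b nx by auto
  qed
  then have "X = {} \<or> (\<exists>x. X = {x})" by blast
  then show ?thesis by auto
qed

context rot
begin

text \<open>Unordered pairs of consecutive vertices on a path of the system.\<close>

definition sed :: "'a list \<Rightarrow> 'a list set \<Rightarrow> 'a \<Rightarrow> 'a \<Rightarrow> bool" where
  "sed P Q a b \<longleftrightarrow> (\<exists>p\<in>insert P Q. sublist [a, b] p \<or> sublist [b, a] p)"

definition broken :: "nat \<Rightarrow> 'a \<Rightarrow> 'a \<Rightarrow> bool" where
  "broken \<tau> x y \<longleftrightarrow> sed P0 Q0 x y \<and> (\<exists>P Q. reach \<tau> P Q \<and> \<not> sed P Q x y)"

lemma sed_sym: "sed P Q a b \<longleftrightarrow> sed P Q b a"
  by (auto simp: sed_def)

lemma sed_in_path: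
  assumes r: "reach \<tau> P Q" and p: "p \<in> insert P Q" "x \<in> set p" and e: "sed P Q x y"
  shows "sublist [x, y] p \<or> sublist [y, x] p"
proof -
  obtain q where q: "q \<in> insert P Q" "sublist [x, y] q \<or> sublist [y, x] q" using e by (auto simp: sed_def)
  then have "x \<in> set q" by (auto dest: sublist_set)
  then have "q = p" using reach_unique[OF r q(1) p(1)] p(2) by blast
  then show ?thesis using q(2) by simp
qed

lemma sublist_mid1: "sublist [a, b] (l @ a # b # r)"
  by (auto simp: sublist_def)

lemma R1_breaks:
  assumes r: "reach \<tau> (p @ x # q @ [v]) Q" "adj v x" "q \<noteq> []"
  shows "\<not> sed (p @ x # v # rev q) Q x (hd q)" "sed (p @ x # q @ [v]) Q x (hd q)"
proof -
  let ?P' = "p @ x # v # rev q"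
  have r': "reach \<tau> ?P' Q" by (rule reach.R1[OF r])
  have d: "distinct ?P'" using reach_pth[OF r', of ?P'] by (auto simp: pth_def)
  show "\<not> sed ?P' Q x (hd q)"
  proof
    assume "sed ?P' Q x (hd q)"
    then have "sublist [x, hd q] ?P' \<or> sublist [hd q, x] ?P'"
      using sed_in_path[OF r', of ?P' x] by auto
    then have "hd q = v \<or> (p \<noteq> [] \<and> hd q = last p)"
      using distinct_pair_succ[OF d] distinct_pair_pred[OF d] by force
    moreover have "hd q \<in> set q" using r(3) by simp
    moreover have "p \<noteq> [] \<Longrightarrow> last p \<in> set p" by simp
    ultimately show False using d by (metis Un_iff distinct_append disjoint_iff list.set_intros(1,2) set_append set_rev distinct.simps(2))
  qed
  have "p @ x # q @ [v] = p @ x # hd q # (tl q @ [v])" using r(3) by simp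
  then have "sublist [x, hd q] (p @ x # q @ [v])" using sublist_mid1 by metis
  then show "sed (p @ x # q @ [v]) Q x (hd q)" by (auto simp: sed_def)
qed

lemma R2_breaks:
  assumes r: "reach \<tau> P Q" "s @ x # t \<in> Q" "s \<noteq> []" "adj (last P) x"
  shows "\<not> sed s (insert (P @ x # t) (Q - {s @ x # t})) x (last s)" "sed P Q x (last s)"
proof -
  let ?Q' = "insert (P @ x # t) (Q - {s @ x # t})"
  have r': "reach \<tau> s ?Q'" by (rule reach.R2[OF r])
  have d: "distinct (P @ x # t)" using reach_pth[OF r', of "P @ x # t"] by (auto simp: pth_def)
  have dq: "distinct (s @ x # t)" using reach_pth[OF r(1), of "s @ x # t"] r(2) by (auto simp: pth_def)
  have P: "P \<noteq> []" using reach_pth[OF r(1), of P] by (auto simp: pth_def)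
  have ls: "last s \<in> set (s @ x # t)" using r(3) by simp
  show "\<not> sed s ?Q' x (last s)"
  proof
    assume "sed s ?Q' x (last s)"
    then have "sublist [x, last s] (P @ x # t) \<or> sublist [last s, x] (P @ x # t)"
      using sed_in_path[OF r', of "P @ x # t" x] by auto
    then have "(t \<noteq> [] \<and> last s = hd t) \<or> (P \<noteq> [] \<and> last s = last P)"
      using distinct_pair_succ[OF d] distinct_pair_pred[OF d] by blast
    then show False
    proof
      assume "t \<noteq> [] \<and> last s = hd t"
      then have "last s \<in> set t" by simp
      moreover have "last s \<in> set s" using r(3) by simp
      ultimately show False using dq by auto
    next
      assume "P \<noteq> [] \<and> last s = last P"
      then have "last s \<in> set P" by simp
      then have "P = s @ x # t" using reach_unique[OF r(1), of P "s @ x # t"] r(2) ls by blast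
      then show False using r(1,2) reach_valid by (auto simp: valid_def)
    qed
  qed
  have "s @ x # t = butlast s @ last s # x # t" using r(3) by simp
  then have "sublist [last s, x] (s @ x # t)" using sublist_mid1 by metis
  then show "sed P Q x (last s)" using r(2) by (auto simp: sed_def)
qed

text \<open>Every new path edge joins an active end to the vertex at which the move acts. As
  \<open>x\<close> is never an active end, it can gain an edge only by being that vertex in
  \<open>R1\<close> or \<open>R2\<close>; the move then deletes an edge at \<open>x\<close> that so
  far was a base edge, and this edge is broken.\<close>

lemma base_edges_only:
  assumes "reach \<tau> P Q" and xF: "x \<notin> S \<tau>"
  shows "(\<exists>y. broken \<tau> x y) \<or> (\<forall>y. sed P Q x y \<longrightarrow> sed P0 Q0 x y)"
  using assms(1)
proof (induction rule: reach.induct)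
  case (R1 p x' q v Q)
  let ?P = "p @ x' # q @ [v]" and ?P' = "p @ x' # v # rev q"
  have r': "reach \<tau> ?P' Q" by (rule reach.R1[OF R1.hyps])
  have vS: "v \<in> S \<tau>" using SI[OF R1.hyps(1)] by simp
  show ?case
  proof (cases "\<exists>y. broken \<tau> x y")
    case False
    then have all: "\<forall>y. sed ?P Q x y \<longrightarrow> sed P0 Q0 x y" using R1.IH by blast
    have "x \<noteq> x'"
    proof
      assume "x = x'"
      then have "broken \<tau> x (hd q)"
        using R1_breaks[OF R1.hyps] all r' unfolding broken_def by blast
      then show False using False by blast
    qed
    have sub: "sed ?P Q x y" if "sed ?P' Q x y" for y
    proof -
      have aux: "sublist [a, b] ?P \<or> sublist [b, a] ?P" if s: "sublist [a, b] ?P'" "x = a \<or> x = b" for a b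
      proof -
        have "sublist [a, b] ((p @ [x']) @ rev (q @ [v]))" using s by simp
        then consider "sublist [a, b] (p @ [x'])" | "sublist [a, b] (rev (q @ [v]))" | "a = x'" "b = v"
          unfolding sublist_pair_append[of a b "p @ [x']"] by (auto simp: hd_append)
        then show ?thesis
        proof cases
          case 1
          then have "sublist [a, b] ((p @ [x']) @ q @ [v])" unfolding sublist_pair_append[of _ _ "p @ [x']"] by blast
          then show ?thesis by simp
        next
          case 2
          then have "sublist [b, a] (q @ [v])" using sublist_rev_iff[of "[a,b]" "q @ [v]"] by simp
          then have "sublist [b, a] ((p @ [x']) @ q @ [v])" unfolding sublist_pair_append[of _ _ "p @ [x']"] by blast
          then show ?thesis by simp
        next
          case 3
          then show ?thesis using s(2) \<open>x \<noteq> x'\<close> vS xF by blast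
        qed
      qed
      from that obtain z where z: "z \<in> insert ?P' Q" "sublist [x, y] z \<or> sublist [y, x] z"
        by (auto simp: sed_def)
      show ?thesis
      proof (cases "z \<in> Q")
        case True
        then show ?thesis using z by (auto simp: sed_def)
      next
        case False
        then have "z = ?P'" using z by simp
        then have "sublist [x, y] ?P \<or> sublist [y, x] ?P" using aux[of x y] aux[of y x] z(2) by blast
        then show ?thesis unfolding sed_def by blast
      qed
    qed
    then show ?thesis using all by blast
  qed blast
next
  case (R2 P Q s x' t)
  let ?Q' = "insert (P @ x' # t) (Q - {s @ x' # t})"
  have r': "reach \<tau> s ?Q'" by (rule reach.R2[OF R2.hyps])
  have vS: "last P \<in> S \<tau>" using SI[OF R2.hyps(1)] by simp
  show ?case
  proof (cases "\<exists>y. broken \<tau> x y")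
    case False
    then have all: "\<forall>y. sed P Q x y \<longrightarrow> sed P0 Q0 x y" using R2.IH by blast
    have "x \<noteq> x'"
    proof
      assume "x = x'"
      then have "broken \<tau> x (last s)"
        using R2_breaks[OF R2.hyps] all r' unfolding broken_def by blast
      then show False using False by blast
    qed
    have aux: "\<exists>z\<in>insert P Q. sublist [a, b] z" if z: "z \<in> insert s ?Q'" "sublist [a, b] z" "x = a \<or> x = b" for a b z
    proof -
      have q: "\<exists>z\<in>insert P Q. sublist [a, b] z" if "sublist [a, b] (s @ x' # t)"
        using that R2.hyps(2) by blast
      consider "z = s" | "z = P @ x' # t" | "z \<in> Q" using z(1) by blast
      then show ?thesis
      proof cases
        case 1
        then show ?thesis using z(2) q by (simp add: sublist_pair_append)
      next
        case 2
        then have "sublist [a, b] P \<or> sublist [a, b] (x' # t) \<or> (last P = a \<and> x' = b)"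
          using z(2) by (auto simp: sublist_pair_append)
        moreover have "\<not> (last P = a \<and> x' = b)" using z(3) \<open>x \<noteq> x'\<close> vS xF by blast
        ultimately show ?thesis using q by (auto simp: sublist_pair_append)
      next
        case 3
        then show ?thesis using z by blast
      qed
    qed
    have "sed P Q x y" if "sed s ?Q' x y" for y
      using that aux[of _ x y] aux[of _ y x] unfolding sed_def by blast
    then show ?thesis using all by blast
  qed blast
next
  case (TR p v Q)
  have "sed (p @ [v]) Q x y" if "sed p Q x y" for y
    using that unfolding sed_def by (auto simp: sublist_pair_append)
  then show ?case using TR.IH by blast
next
  case (EX P Q r)
  have "last P \<in> S \<tau>" "r \<in> S \<tau>" using SI[OF EX.hyps(1)] SI[OF reach.EX[OF EX.hyps]] by auto
  then have "sed P Q x y" if "sed (P @ [r]) Q x y" for y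
    using that xF unfolding sed_def by (auto simp: sublist_pair_append)
  then show ?case using EX.IH by blast
qed blast

text \<open>No merge is in sight: an active end next to the first vertex of another path would let
  that path be appended whole, and one next to \<open>T0\<close> would let all but a short tail be
  appended or, with a single path left, close a cycle.\<close>

definition nohit :: "nat \<Rightarrow> bool" where
  "nohit \<tau> \<longleftrightarrow> (\<forall>P Q x. reach \<tau> P Q \<longrightarrow> adj (last P) x \<longrightarrow> x \<notin> T0 \<and> x \<notin> hd ` Q)"

lemma nohit_mono: "nohit \<tau>' \<Longrightarrow> \<tau> \<le> \<tau>' \<Longrightarrow> nohit \<tau>"
  using reach_mono unfolding nohit_def by blast

text \<open>Posa's lemma for path systems. An uncovered \<open>x\<close> would be appended and
  become an end, so \<open>x\<close> lies on a path and a move at \<open>x\<close> is possible; if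
  no base edge at \<open>x\<close> was broken before, this move breaks one and makes its other
  vertex an end. The exception is a penultimate \<open>x\<close>: nothing rotates, but a single trim
  exposes \<open>x\<close>, hence \<open>\<tau> + 1\<close>.\<close>

lemma nb_S_cases:
  assumes nh: "nohit \<tau>" and x: "x \<in> nb W (S \<tau>)"
  shows "x \<in> cov F" "x \<notin> T0" "\<exists>y\<in>S \<tau>. sed P0 Q0 x y"
    and "x \<notin> S (\<tau> + 1) \<Longrightarrow> \<exists>y. broken \<tau> x y"
proof -
  have xW: "x \<in> W" and xS: "x \<notin> S \<tau>" using x by (auto simp: nb_def)
  obtain P Q where r: "reach \<tau> P Q" and a: "adj (last P) x" using x by (auto simp: nb_def S_def)
  have nT: "x \<notin> T0" and nhd: "x \<notin> hd ` Q" using nh r a unfolding nohit_def by blast+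
  show "x \<notin> T0" by (rule nT)
  have xc: "x \<in> cov (insert P Q)"
  proof (rule ccontr)
    assume "x \<notin> cov (insert P Q)"
    then have "reach \<tau> (P @ [x]) Q" using r a xW by (intro reach.EX) auto
    then show False using SI xS by fastforce
  qed
  then show "x \<in> cov F" using cov_sub[OF r] xS by blast
  have br: "y \<in> S \<tau>" if bb: "broken \<tau> x y" for y
  proof -
    obtain P' Q' where r': "reach \<tau> P' Q'" "\<not> sed P' Q' x y" and b: "sed P0 Q0 x y"
      using bb unfolding broken_def by blast
    obtain p where p: "p \<in> F" "sublist [x, y] p \<or> sublist [y, x] p" using b by (auto simp: sed_def)
    have "x \<in> S \<tau> \<or> y \<in> S \<tau>"
      using p(2)
    proof
      assume "sublist [x, y] p"
      from intact_or_end[OF r'(1) p(1) this] show ?thesis using r'(2) by (auto simp: sed_def)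
    next
      assume "sublist [y, x] p"
      from intact_or_end[OF r'(1) p(1) this] show ?thesis using r'(2) by (auto simp: sed_def)
    qed
    then show ?thesis using xS by blast
  qed
  have main: "(\<exists>y\<in>S \<tau>. sed P0 Q0 x y) \<and> ((\<exists>y. broken \<tau> x y) \<or> x \<in> S (\<tau> + 1))"
  proof (cases "\<exists>y. broken \<tau> x y")
    case True
    then show ?thesis using br by (auto simp: broken_def)
  next
    case False
    then have all: "\<And>y. sed P Q x y \<Longrightarrow> sed P0 Q0 x y" using base_edges_only[OF r xS] by blast
    have Pne: "P \<noteq> []" using reach_pth[OF r, of P] by (auto simp: pth_def)
    show ?thesis
    proof (cases "x \<in> set P")
      case True
      then obtain p q' where P: "P = p @ x # q'" by (meson split_list)
      have "q' \<noteq> []" using P SI[OF r] xS by auto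
      then obtain q v where q': "q' = q @ [v]" by (metis rev_exhaust)
      show ?thesis
      proof (cases "q = []")
        case True
        have "sublist [x, v] P" using sublist_mid1[of x v p "[]"] unfolding P q' True by simp
        then have "sed P Q x v" by (auto simp: sed_def)
        moreover have "v \<in> S \<tau>" using SI[OF r] P q' by simp
        moreover have "x \<in> S (\<tau> + 1)" using trim_S[of \<tau> p x "[v]" Q] r P q' True by simp
        ultimately show ?thesis using all by blast
      next
        case qne: False
        have rr: "reach \<tau> (p @ x # q @ [v]) Q" using r P q' by simp
        have av: "adj v x" using a P q' by simp
        note b = R1_breaks[OF rr av qne]
        have r2: "reach \<tau> (p @ x # v # rev q) Q" by (rule reach.R1[OF rr av qne])
        have "hd q \<in> S \<tau>" using SI[OF r2] qne by (simp add: last_rev)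
        moreover have "sed P0 Q0 x (hd q)" using all b(2) P q' by simp
        ultimately show ?thesis using b(1) r2 by (auto simp: broken_def)
      qed
    next
      case False
      then obtain z where z: "z \<in> Q" "x \<in> set z" using xc by (auto simp: cov_def)
      obtain s t where st: "z = s @ x # t" using z(2) by (meson split_list)
      have sne: "s \<noteq> []"
      proof
        assume "s = []"
        then have "hd z = x" using st by simp
        then show False using nhd z by force
      qed
      note b = R2_breaks[OF r z(1)[unfolded st] sne a]
      have r2: "reach \<tau> s (insert (P @ x # t) (Q - {s @ x # t}))" by (rule reach.R2[OF r z(1)[unfolded st] sne a])
      have "last s \<in> S \<tau>" by (rule SI[OF r2])
      moreover have "sed P0 Q0 x (last s)" using all b(2) by simp
      ultimately show ?thesis using b(1) r2 by (auto simp: broken_def)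
    qed
  qed
  show "\<exists>y\<in>S \<tau>. sed P0 Q0 x y" using main by blast
  show "\<exists>y. broken \<tau> x y" if "x \<notin> S (\<tau> + 1)" using main that by blast
qed

text \<open>Apply \<open>intact_or_end\<close> to the base segment from \<open>x\<close> to each
  vertex of the run: it contains the broken edge, so fewer than \<open>m\<close> further trims
  expose one of its extremities, and this is not \<open>x\<close>.\<close>

lemma run_right:
  assumes "p \<in> F" "p = l @ x # r" "r \<noteq> []" "1 \<le> m" "x \<notin> S (\<tau> + m)"
    and r': "reach \<tau> P' Q'" "\<not> sed P' Q' x (hd r)"
  shows "set (take m r) \<subseteq> S (\<tau> + m)"
proof
  fix z assume "z \<in> set (take m r)"
  then obtain i where i: "i < m" "i < length r" "z = r ! i" by (auto simp: in_set_conv_nth)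
  let ?ys = "x # take (Suc i) r"
  have sub: "sublist ?ys p" unfolding assms(2) sublist_def
    by (metis append.assoc append_Cons append_take_drop_id)
  have len: "length ?ys = i + 2" using i by simp
  have lst: "last ?ys = z" using i by (simp add: take_Suc_conv_app_nth)
  have "sublist [x, hd r] ?ys" using assms(3) by (cases r) (auto simp: sublist_def intro: exI[of _ "[]"])
  moreover have "sublist [hd r, x] (rev ?ys)"
    using sublist_rev[of "[x, hd r]" ?ys] calculation by simp
  ultimately have "\<not> (\<exists>p\<in>insert P' Q'. sublist ?ys p \<or> sublist (rev ?ys) p)"
    using r'(2) sublist_trans unfolding sed_def by blast
  then have "hd ?ys \<in> S (\<tau> + (length ?ys - 2)) \<or> last ?ys \<in> S (\<tau> + (length ?ys - 2))"
    using intact_or_end[OF r'(1) assms(1) sub] len by linarith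
  then have "x \<in> S (\<tau> + i) \<or> z \<in> S (\<tau> + i)" using len lst by simp
  moreover have "S (\<tau> + i) \<subseteq> S (\<tau> + m)" using i by (intro S_mono) simp
  ultimately show "z \<in> S (\<tau> + m)" using assms(5) by blast
qed

lemma run_left:
  assumes "p \<in> F" "p = l @ x # r" "l \<noteq> []" "1 \<le> m" "x \<notin> S (\<tau> + m)"
    and r': "reach \<tau> P' Q'" "\<not> sed P' Q' x (last l)"
  shows "set (take m (rev l)) \<subseteq> S (\<tau> + m)"
proof
  fix z assume "z \<in> set (take m (rev l))"
  then obtain i where i: "i < m" "i < length l" "z = rev l ! i" by (auto simp: in_set_conv_nth)
  let ?ys = "rev (take (Suc i) (rev l)) @ [x]"
  have sub: "sublist ?ys p"
  proof -
    have "l = rev (drop (Suc i) (rev l)) @ rev (take (Suc i) (rev l))"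
      by (metis append_take_drop_id rev_append rev_rev_ident)
    then have "p = rev (drop (Suc i) (rev l)) @ ?ys @ r" using assms(2) by simp
    then show ?thesis unfolding sublist_def by blast
  qed
  have len: "length ?ys = i + 2" using i by simp
  have hdz: "hd ?ys = z" using i by (simp add: hd_rev take_Suc_conv_app_nth)
  have "sublist [last l, x] ?ys"
  proof -
    have "last l = hd (rev l)" using assms(3) by (simp add: hd_rev)
    then have "take (Suc i) (rev l) = last l # take i (tl (rev l))" using assms(3) by (cases "rev l") auto
    then show ?thesis by (simp add: sublist_def) (metis append_Nil2)
  qed
  moreover have "sublist [x, last l] (rev ?ys)"
    using sublist_rev[of "[last l, x]" ?ys] calculation by simp
  ultimately have "\<not> (\<exists>p\<in>insert P' Q'. sublist ?ys p \<or> sublist (rev ?ys) p)"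
    using r'(2) sublist_trans unfolding sed_def by blast
  then have "hd ?ys \<in> S (\<tau> + (length ?ys - 2)) \<or> last ?ys \<in> S (\<tau> + (length ?ys - 2))"
    using intact_or_end[OF r'(1) assms(1) sub] len by linarith
  moreover have "length ?ys - 2 = i" using len by simp
  ultimately have "z \<in> S (\<tau> + i) \<or> x \<in> S (\<tau> + i)" using hdz last_snoc by metis
  moreover have "S (\<tau> + i) \<subseteq> S (\<tau> + m)" using i by (intro S_mono) simp
  ultimately show "z \<in> S (\<tau> + m)" using assms(5) by blast
qed

end

section \<open>Expansion of small, medium and large sets\<close>

context sgraph
begin

text \<open>The first clause is void for sets of at most \<open>\<delta> * card W\<close> vertices.
  The second one gives strong expansion up to half that size and, by passing to a subset
  (\<open>good_jump\<close>), also something for all larger sets.\<close>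

definition good :: "real \<Rightarrow> 'a set \<Rightarrow> bool" where
  "good \<delta> W \<longleftrightarrow> finite W \<and>
    (\<forall>U. U \<subseteq> W \<and> 2 * card U \<le> card W \<longrightarrow> real (card U) - \<delta> * real (card W) \<le> card (nb W U)) \<and>
    (\<forall>U. U \<subseteq> W \<and> real (card U) \<le> \<delta> * real (card W) / 2 \<longrightarrow> card U / (10 * \<delta>) \<le> card (nb W U))"

text \<open>Nothing in \<open>W - (M \<union> nb W M)\<close> is adjacent to \<open>M\<close>. If
  that set held half of \<open>W\<close>, a subset \<open>U\<close> of half size and its neighbours
  would avoid \<open>M\<close>, which leaves too little room for
  \<open>card U - \<delta> * card W\<close> neighbours.\<close>

lemma additive_mid:
  assumes fin: "finite W"
    and ex: "\<And>U. U \<subseteq> W \<Longrightarrow> 2 * card U \<le> card W \<Longrightarrow> real (card U) - \<delta> * real (card W) \<le> card (nb W U)"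
    and M: "M \<subseteq> W" "real (card M) > \<delta> * real (card W) + 2"
  shows "real (card (M \<union> nb W M)) \<ge> card W / 2"
proof (rule ccontr)
  assume "\<not> ?thesis"
  then have lt: "2 * card (M \<union> nb W M) < card W" by simp
  let ?Z = "W - (M \<union> nb W M)"
  have "card ?Z = card W - card (M \<union> nb W M)"
    using M(1) nb_subset finite_nb[OF fin] finite_subset[OF M(1) fin] by (intro card_Diff_subset) auto
  then have "card W div 2 \<le> card ?Z" using lt by linarith
  then obtain U where U: "U \<subseteq> ?Z" "card U = card W div 2" by (meson obtain_subset_with_card_n)
  have UW: "U \<subseteq> W" using U by blast
  have "real (card U) - \<delta> * real (card W) \<le> card (nb W U)" using U by (intro ex UW) simp
  moreover have "card U + card (nb W U) + card M \<le> card W"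
  proof -
    have d1: "U \<inter> nb W U = {}" using nb_disjoint by blast
    have d2: "(U \<union> nb W U) \<inter> M = {}" using U M(1) adj_sym by (fastforce simp: nb_def)
    have f: "finite U" "finite (nb W U)" "finite M" using UW M fin finite_nb by (auto intro: finite_subset)
    have "card (U \<union> nb W U \<union> M) = card U + card (nb W U) + card M"
      using d1 d2 f by (simp add: card_Un_disjoint)
    moreover have "U \<union> nb W U \<union> M \<subseteq> W" using UW M nb_subset by blast
    ultimately show ?thesis using card_mono[OF fin] by metis
  qed
  ultimately have "real (2 * (card W div 2)) + card M \<le> card W + \<delta> * real (card W)" using U(2) by simp
  moreover have "card W \<le> 2 * (card W div 2) + 1" by linarith
  ultimately show False using M(2) by linarith
qed

text \<open>The same count for a half-size \<open>U \<subseteq> U0\<close>: vertices neither in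
  \<open>U0\<close> nor adjacent to it are disjoint from \<open>U\<close> and its
  neighbours.\<close>

lemma additive_big:
  assumes fin: "finite W"
    and ex: "\<And>U. U \<subseteq> W \<Longrightarrow> 2 * card U \<le> card W \<Longrightarrow> real (card U) - \<delta> * real (card W) \<le> card (nb W U)"
    and U0: "U0 \<subseteq> W" "card W \<le> 2 * card U0"
  shows "real (card (W - U0 - nb W U0)) \<le> \<delta> * real (card W) + 2"
proof -
  have "card W div 2 \<le> card U0" using U0(2) by linarith
  then obtain U where U: "U \<subseteq> U0" "card U = card W div 2" by (meson obtain_subset_with_card_n)
  let ?M = "W - U0 - nb W U0"
  have UW: "U \<subseteq> W" using U U0 by blast
  have "real (card U) - \<delta> * real (card W) \<le> card (nb W U)" using U by (intro ex UW) simp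
  moreover have "card U + card (nb W U) + card ?M \<le> card W"
  proof -
    have d1: "U \<inter> nb W U = {}" using nb_disjoint by blast
    have d2: "(U \<union> nb W U) \<inter> ?M = {}" using U by (auto simp: nb_def)
    have f: "finite U" "finite (nb W U)" "finite ?M" using UW fin finite_nb by (auto intro: finite_subset)
    have "card (U \<union> nb W U \<union> ?M) = card U + card (nb W U) + card ?M"
      using d1 d2 f by (simp add: card_Un_disjoint)
    moreover have "U \<union> nb W U \<union> ?M \<subseteq> W" using UW nb_subset by blast
    ultimately show ?thesis using card_mono[OF fin] by metis
  qed
  ultimately have "real (2 * (card W div 2)) + card ?M \<le> card W + \<delta> * real (card W)" using U(2) by simp
  moreover have "card W \<le> 2 * (card W div 2) + 1" by linarith
  ultimately show ?thesis by linarith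
qed

lemma good_ex: "good \<delta> W \<Longrightarrow> U \<subseteq> W \<Longrightarrow> 2 * card U \<le> card W \<Longrightarrow> real (card U) - \<delta> * real (card W) \<le> card (nb W U)"
  by (simp add: good_def)

lemma good_small: "good \<delta> W \<Longrightarrow> U \<subseteq> W \<Longrightarrow> real (card U) \<le> \<delta> * real (card W) / 2 \<Longrightarrow> card U / (10 * \<delta>) \<le> card (nb W U)"
  by (simp add: good_def)

lemma good_finite: "good \<delta> W \<Longrightarrow> finite W"
  by (simp add: good_def)

lemma good_mid: "good \<delta> W \<Longrightarrow> M \<subseteq> W \<Longrightarrow> real (card M) > \<delta> * real (card W) + 2 \<Longrightarrow> real (card (M \<union> nb W M)) \<ge> card W / 2"
  using additive_mid[of W \<delta> M] good_ex good_finite by blast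

lemma good_big: "good \<delta> W \<Longrightarrow> U \<subseteq> W \<Longrightarrow> card W \<le> 2 * card U \<Longrightarrow> real (card (W - U - nb W U)) \<le> \<delta> * real (card W) + 2"
  using additive_big[of W \<delta> U] good_ex good_finite by blast

text \<open>The small-set clause for a subset of nearly the largest size it allows: at least
  \<open>\<delta> * card W / 4\<close> vertices, expanding by \<open>1 / (10 * \<delta>)\<close>;
  the two factors \<open>\<delta>\<close> cancel.\<close>

lemma good_jump:
  assumes g: "good \<delta> W" and \<delta>: "0 < \<delta>" and big: "4 \<le> \<delta> * real (card W)" and Y: "Y \<subseteq> W" "\<delta> * real (card W) / 2 < card Y"
  obtains U where "U \<subseteq> Y" "real (card (nb W U)) \<ge> card W / 40"
proof -
  let ?u = "nat \<lfloor>\<delta> * real (card W) / 2\<rfloor>"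
  have u: "real ?u \<le> \<delta> * real (card W) / 2" "real ?u > \<delta> * real (card W) / 2 - 1" using big by linarith+
  have "?u \<le> card Y" using u(1) Y(2) by linarith
  then obtain U where U: "U \<subseteq> Y" "card U = ?u" by (meson obtain_subset_with_card_n)
  have "real ?u / (10 * \<delta>) \<le> card (nb W U)" using good_small[OF g, of U] U Y u by auto
  moreover have "real ?u \<ge> \<delta> * real (card W) / 4" using u big by linarith
  then have "(\<delta> * real (card W) / 4) / (10 * \<delta>) \<le> real ?u / (10 * \<delta>)" using \<delta> by (intro divide_right_mono) auto
  moreover have "(\<delta> * real (card W) / 4) / (10 * \<delta>) = card W / 40" using \<delta> by simp
  ultimately have "real (card (nb W U)) \<ge> card W / 40" by linarith
  then show thesis using that U by blast
qed

end

context rot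
begin

lemma S_W: "S \<tau> \<subseteq> W"
proof
  fix x assume "x \<in> S \<tau>"
  then obtain P Q where r: "reach \<tau> P Q" "x = last P" by (auto simp: S_def)
  then have "P \<noteq> []" using reach_pth[of \<tau> P Q P] by (auto simp: pth_def)
  then have "x \<in> set P" using r by simp
  then show "x \<in> W" using reach_valid[OF r(1)] by (auto simp: valid_def cov_def)
qed

lemma fin_S: "finite (S \<tau>)"
  using S_W finW by (rule finite_subset)

lemma S_nonempty: "S \<tau> \<noteq> {}"
  using SI[OF reach.base] by blast

lemma base_nbrs_card: "finite {x. sed P0 Q0 x y}" "card {x. sed P0 Q0 x y} \<le> 2"
proof -
  have "\<exists>a b. {x. sed P0 Q0 x y} \<subseteq> {a, b}"
  proof (cases "y \<in> cov F")
    case True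
    then obtain p where p: "p \<in> F" "y \<in> set p" by (auto simp: cov_def)
    then obtain l r where lr: "p = l @ y # r" by (meson split_list)
    have d: "distinct (l @ y # r)" using reach_pth[OF reach.base[of 0] p(1)] lr by (simp add: pth_def)
    have "x = hd r \<or> x = last l" if "sed P0 Q0 x y" for x
      using sed_in_path[OF reach.base[of 0] p] that sed_sym[of P0 Q0 x y] distinct_pair_succ[OF d] distinct_pair_pred[OF d]
      unfolding lr by blast
    then show ?thesis by blast
  next
    case False
    then have "{x. sed P0 Q0 x y} = {}" by (force simp: sed_def cov_def dest: sublist_set)
    then show ?thesis by auto
  qed
  then obtain a b where ab: "{x. sed P0 Q0 x y} \<subseteq> {a, b}" by blast
  then show "finite {x. sed P0 Q0 x y}" by (rule finite_subset) simp
  have "card {x. sed P0 Q0 x y} \<le> card {a, b}" by (rule card_mono[OF _ ab]) simp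
  also have "\<dots> \<le> 2" by (simp add: card_insert_if)
  finally show "card {x. sed P0 Q0 x y} \<le> 2" .
qed

text \<open>Posa's inequality: each such neighbour stands next to an end on a base path, and a
  vertex has at most two neighbours on its path.\<close>

lemma nb_S_le:
  assumes "nohit \<tau>"
  shows "card (nb W (S \<tau>)) \<le> 2 * card (S \<tau>)"
proof -
  have "nb W (S \<tau>) \<subseteq> (\<Union>y\<in>S \<tau>. {x. sed P0 Q0 x y})"
    using nb_S_cases(3)[OF assms] by blast
  then have "card (nb W (S \<tau>)) \<le> card (\<Union>y\<in>S \<tau>. {x. sed P0 Q0 x y})"
    using fin_S base_nbrs_card(1) by (intro card_mono) auto
  also have "\<dots> \<le> (\<Sum>y\<in>S \<tau>. card {x. sed P0 Q0 x y})" by (rule card_UN_le[OF fin_S])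
  also have "\<dots> \<le> (\<Sum>y\<in>S \<tau>. 2)" by (rule sum_mono) (rule base_nbrs_card)
  finally show ?thesis by simp
qed

text \<open>A vertex \<open>x\<close> outside \<open>S (\<tau> + m)\<close> but adjacent to \<open>S \<tau>\<close> lies on a base edge broken on the way. By
  \<open>intact_or_end\<close>, on one side of \<open>x\<close> the next \<open>m\<close> vertices of its base path all lie in \<open>S (\<tau> + m)\<close>.\<close>

lemma runs_count:
  assumes nh: "nohit \<tau>" and m: "1 \<le> m" "m \<le> M"
    and T0: "\<And>q. q \<in> Q0 \<Longrightarrow> set (drop (length q - M) q) \<subseteq> T0"
  shows "m * card (nb W (S \<tau>) - S (\<tau> + m)) \<le> 2 * card (S (\<tau> + m)) + m * (card Q0 + 2)"
proof -
  let ?S' = "S (\<tau> + m)"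
  let ?N = "nb W (S \<tau>) - ?S'"
  \<comment> \<open>\<open>R\<close> and \<open>L\<close> name the side of \<open>x\<close> on which
    the run of ends lies; \<open>F\<close> means a full run of \<open>m\<close> vertices,
    \<open>E\<close> one cut short by the end of the path.\<close>
  define RF where "RF p = {x \<in> ?N. \<exists>l r. p = l @ x # r \<and> m \<le> length r \<and> set (take m r) \<subseteq> ?S'}" for p
  define RE where "RE p = {x \<in> ?N. \<exists>l r. p = l @ x # r \<and> length r < m \<and> set r \<subseteq> ?S'}" for p
  define LF where "LF p = {x \<in> ?N. \<exists>l r. p = l @ x # r \<and> m \<le> length l \<and> set (take m (rev l)) \<subseteq> ?S'}" for p
  define LE where "LE p = {x \<in> ?N. \<exists>l r. p = l @ x # r \<and> length l < m \<and> set l \<subseteq> ?S'}" for p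
  note defs = RF_def RE_def LF_def LE_def
  have finN: "finite ?N" using finite_nb[OF finW] by blast
  have fin: "finite (RF p)" "finite (RE p)" "finite (LF p)" "finite (LE p)" for p
  proof -
    have "RF p \<subseteq> ?N" "RE p \<subseteq> ?N" "LF p \<subseteq> ?N" "LE p \<subseteq> ?N" unfolding defs by auto
    then show "finite (RF p)" "finite (RE p)" "finite (LF p)" "finite (LE p)"
      using finN finite_subset by metis+
  qed
  have finF: "finite F" and finQ: "finite Q0" using F0 by (auto simp: forest_def)
  have dist: "distinct p" if "p \<in> F" for p using F0 that by (auto simp: forest_def pth_def)
  have sub: "?N \<subseteq> (\<Union>p\<in>F. RF p \<union> LF p \<union> LE p) \<union> RE P0"
  proof
    fix x assume x: "x \<in> ?N"
    then have xn: "x \<in> nb W (S \<tau>)" and xS: "x \<notin> ?S'" by auto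
    have "S (\<tau> + 1) \<subseteq> ?S'" using m by (intro S_mono) simp
    then have "x \<notin> S (\<tau> + 1)" using xS by blast
    then obtain y where "broken \<tau> x y" using nb_S_cases(4)[OF nh xn] by blast
    then obtain P' Q' where r': "reach \<tau> P' Q'" "\<not> sed P' Q' x y" and b: "sed P0 Q0 x y"
      unfolding broken_def by blast
    obtain p where p: "p \<in> F" "x \<in> set p" using nb_S_cases(1)[OF nh xn] by (auto simp: cov_def)
    then obtain l r where lr: "p = l @ x # r" by (meson split_list)
    have d: "distinct (l @ x # r)" using dist[OF p(1)] lr by simp
    have "sublist [x, y] (l @ x # r) \<or> sublist [y, x] (l @ x # r)"
      using sed_in_path[OF reach.base p b] lr by simp
    then consider "r \<noteq> []" "y = hd r" | "l \<noteq> []" "y = last l"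
      using distinct_pair_succ[OF d] distinct_pair_pred[OF d] by blast
    then show "x \<in> (\<Union>p\<in>F. RF p \<union> LF p \<union> LE p) \<union> RE P0"
    proof cases
      case 1
      have run: "set (take m r) \<subseteq> ?S'" using run_right[OF p(1) lr 1(1) m(1) xS r'(1)] r'(2) 1(2) by simp
      show ?thesis
      proof (cases "m \<le> length r")
        case True
        then have "x \<in> RF p" using x lr run unfolding RF_def by blast
        then show ?thesis using p(1) by blast
      next
        case False
        then have E: "x \<in> RE p" using x lr run unfolding RE_def by fastforce
        show ?thesis
        proof (cases "p = P0")
          case True
          then show ?thesis using E by blast
        next
          case pn: False
          \<comment> \<open>Fewer than \<open>m \<le> M\<close> vertices follow \<open>x\<close>, so
            \<open>x\<close> would be in a protected tail and adjacent to an end, which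
            \<open>nohit\<close> excludes. Hence short right runs occur on \<open>P0\<close>
            only.\<close>
          then have "p \<in> Q0" using p(1) by blast
          have "x \<in> set (drop (length p - M) p)" using False m lr by simp
          then have "x \<in> T0" using T0[OF \<open>p \<in> Q0\<close>] by blast
          then show ?thesis using nb_S_cases(2)[OF nh xn] by blast
        qed
      qed
    next
      case 2
      have run: "set (take m (rev l)) \<subseteq> ?S'" using run_left[OF p(1) lr 2(1) m(1) xS r'(1)] r'(2) 2(2) by simp
      show ?thesis
      proof (cases "m \<le> length l")
        case True
        then have "x \<in> LF p" using x lr run unfolding LF_def by blast
        then show ?thesis using p(1) by blast
      next
        case False
        then have "set l \<subseteq> ?S'" using run by simp
        then have "x \<in> LE p" using x lr False unfolding LE_def by fastforce
        then show ?thesis using p(1) by blast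
      qed
    qed
  qed
  have rf: "m * card (RF p) \<le> card (?S' \<inter> set p)" if "p \<in> F" for p
    by (rule list_runs_full[OF dist[OF that] fin_S m(1)]) (auto simp: RF_def)
  have lf: "m * card (LF p) \<le> card (?S' \<inter> set p)" if "p \<in> F" for p
  proof -
    have "m * card (LF p) \<le> card (?S' \<inter> set (rev p))"
    proof (rule list_runs_full[OF _ fin_S m(1)])
      show "distinct (rev p)" using dist[OF that] by simp
      fix x assume "x \<in> LF p"
      then obtain l r where "x \<notin> ?S'" "p = l @ x # r" "m \<le> length l" "set (take m (rev l)) \<subseteq> ?S'"
        unfolding LF_def by blast
      then show "x \<notin> ?S' \<and> (\<exists>l r. rev p = l @ x # r \<and> m \<le> length r \<and> set (take m r) \<subseteq> ?S')"
        by (intro conjI exI[of _ "rev r"] exI[of _ "rev l"]) auto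
    qed
    then show ?thesis by simp
  qed
  have re: "card (RE P0) \<le> 1"
    by (rule list_runs_short[of P0 _ ?S']) (use dist[of P0] in \<open>auto simp: RE_def\<close>)
  have le: "card (LE p) \<le> 1" if "p \<in> F" for p
  proof (rule list_runs_short[of "rev p" _ ?S'])
    show "distinct (rev p)" using dist[OF that] by simp
    fix x assume "x \<in> LE p"
    then obtain l r where "x \<notin> ?S'" "p = l @ x # r" "set l \<subseteq> ?S'" unfolding LE_def by blast
    then show "x \<notin> ?S' \<and> (\<exists>l r. rev p = l @ x # r \<and> set r \<subseteq> ?S')"
      by (intro conjI exI[of _ "rev r"] exI[of _ "rev l"]) auto
  qed
  have disj: "(\<Sum>p\<in>F. card (?S' \<inter> set p)) \<le> card ?S'"
  proof -
    have "(\<Sum>p\<in>F. card (?S' \<inter> set p)) = card (\<Union>p\<in>F. ?S' \<inter> set p)"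
    proof (rule card_UN_disjoint[symmetric, OF finF])
      show "\<forall>p\<in>F. finite (?S' \<inter> set p)" by simp
      have "set p \<inter> set q = {}" if "p \<in> F" "q \<in> F" "p \<noteq> q" for p q
        using F0 that unfolding forest_def by blast
      then show "\<forall>p\<in>F. \<forall>q\<in>F. p \<noteq> q \<longrightarrow> (?S' \<inter> set p) \<inter> (?S' \<inter> set q) = {}" by blast
    qed
    also have "\<dots> \<le> card ?S'" using fin_S by (intro card_mono) auto
    finally show ?thesis .
  qed
  have "card ?N \<le> card ((\<Union>p\<in>F. RF p \<union> LF p \<union> LE p) \<union> RE P0)"
    using sub finF fin by (intro card_mono) auto
  also have "\<dots> \<le> card (\<Union>p\<in>F. RF p \<union> LF p \<union> LE p) + card (RE P0)" by (rule card_Un_le)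
  also have "card (\<Union>p\<in>F. RF p \<union> LF p \<union> LE p) \<le> (\<Sum>p\<in>F. card (RF p \<union> LF p \<union> LE p))"
    by (rule card_UN_le[OF finF])
  also have "\<dots> \<le> (\<Sum>p\<in>F. card (RF p) + card (LF p) + 1)"
  proof (rule sum_mono)
    fix p assume "p \<in> F"
    have "card (RF p \<union> LF p \<union> LE p) \<le> card (RF p \<union> LF p) + card (LE p)" by (rule card_Un_le)
    also have "card (RF p \<union> LF p) \<le> card (RF p) + card (LF p)" by (rule card_Un_le)
    finally show "card (RF p \<union> LF p \<union> LE p) \<le> card (RF p) + card (LF p) + 1" using le[OF \<open>p \<in> F\<close>] by simp
  qed
  finally have "card ?N \<le> (\<Sum>p\<in>F. card (RF p) + card (LF p) + 1) + 1" using re by simp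
  then have "m * card ?N \<le> m * ((\<Sum>p\<in>F. card (RF p) + card (LF p) + 1) + 1)" by (rule mult_le_mono2)
  also have "\<dots> = (\<Sum>p\<in>F. m * card (RF p) + m * card (LF p)) + m * (card F + 1)"
    by (simp add: sum.distrib sum_distrib_left algebra_simps)
  also have "(\<Sum>p\<in>F. m * card (RF p) + m * card (LF p)) \<le> (\<Sum>p\<in>F. card (?S' \<inter> set p) + card (?S' \<inter> set p))"
    by (intro sum_mono add_mono rf lf)
  also have "\<dots> \<le> 2 * card ?S'" using disj by (simp add: sum.distrib)
  finally show ?thesis using P0Q0 finQ by simp
qed

end

section \<open>Near-spanning cycles\<close>

text \<open>\<open>M\<close> is both the length of the protected tails and the largest window
  \<open>m\<close> for which \<open>runs_count\<close> may be used. The bound \<open>kQ\<close>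
  keeps the terms counting paths far below \<open>card W\<close>.\<close>

locale rotgood = rot adj W P0 Q0 T0 for adj :: "'a \<Rightarrow> 'a \<Rightarrow> bool" and W P0 Q0 T0 +
  fixes \<delta> :: real and M :: nat
  assumes good: "good \<delta> W" and \<delta>: "0 < \<delta>" "\<delta> \<le> 1 / 10000" and big: "10000 \<le> \<delta> * real (card W)"
    and kQ: "real (card Q0) + 1 \<le> 5 * \<delta> * real (card W)" and M20: "200 \<le> M"
    and T0: "\<And>q. q \<in> Q0 \<Longrightarrow> set (drop (length q - M) q) \<subseteq> T0"
begin

abbreviation "N \<equiv> real (card W)"

lemma \<delta>N: "\<delta> * N \<le> N / 10000"
  using mult_right_mono[OF \<delta>(2), of N] by simp

text \<open>Posa's factor two contradicts the factor \<open>1 / (10 * \<delta>)\<close> of small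
  sets, so \<open>S 0\<close> has more than \<open>\<delta> * N / 2\<close> vertices;
  \<open>good_jump\<close> and the factor two lift it to \<open>N / 120\<close>, and
  \<open>good_mid\<close> then gives \<open>3 * card (S 0) \<ge> N / 2\<close>.\<close>

lemma S0_large:
  assumes nh: "nohit 0"
  shows "card (S 0) \<ge> N / 6"
proof -
  have nb2: "card (nb W (S 0)) \<le> 2 * card (S 0)" by (rule nb_S_le[OF nh])
  have pos: "0 < card (S 0)" using fin_S S_nonempty by (simp add: card_gt_0_iff)
  have a: "\<delta> * N / 2 < card (S 0)"
  proof (rule ccontr)
    assume "\<not> ?thesis"
    then have "card (S 0) / (10 * \<delta>) \<le> card (nb W (S 0))" using good_small[OF good S_W] by simp
    then have "card (S 0) / (10 * \<delta>) \<le> 2 * card (S 0)" using nb2 by linarith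
    then have "1 / (10 * \<delta>) \<le> 2" using pos by (simp add: divide_simps split: if_splits)
    then show False using \<delta> by (simp add: divide_simps split: if_splits)
  qed
  obtain U where U: "U \<subseteq> S 0" "real (card (nb W U)) \<ge> N / 40"
    using good_jump[OF good \<delta>(1) _ S_W a] big by auto
  have "nb W U \<subseteq> S 0 \<union> nb W (S 0)" using U(1) by (auto simp: nb_def)
  then have "card (nb W U) \<le> card (S 0 \<union> nb W (S 0))" using fin_S finite_nb[OF finW] by (intro card_mono) auto
  also have "\<dots> \<le> 3 * card (S 0)" using card_Un_le[of "S 0" "nb W (S 0)"] nb2 by linarith
  finally have "N / 120 \<le> card (S 0)" using U(2) by linarith
  moreover have "\<delta> * N \<le> N / 10000" by (rule \<delta>N)
  ultimately have "real (card (S 0)) > \<delta> * N + 2" using big by linarith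
  then have "real (card (S 0 \<union> nb W (S 0))) \<ge> N / 2" using good_mid[OF good S_W] by blast
  then show ?thesis using card_Un_le[of "S 0" "nb W (S 0)"] nb2 by linarith
qed

lemma runs_real:
  assumes nh: "nohit \<tau>" and m: "1 \<le> m" "m \<le> M"
  shows "real (card (nb W (S \<tau>) - S (\<tau> + m))) \<le> 2 * card (S (\<tau> + m)) / m + (card Q0 + 2)"
proof -
  have "real m * card (nb W (S \<tau>) - S (\<tau> + m)) \<le> 2 * card (S (\<tau> + m)) + real m * (card Q0 + 2)"
    using runs_count[OF nh m T0] by (metis of_nat_add of_nat_le_iff of_nat_mult of_nat_numeral)
  then show ?thesis using m by (simp add: field_simps)
qed

text \<open>Window \<open>m = 20\<close>: at most a tenth of \<open>card (S (\<tau> + 20))\<close>,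
  plus a term for the paths, counts the neighbours that stay outside, while \<open>S \<tau>\<close>
  and its neighbours make up nearly \<open>2 * card (S \<tau>)\<close> vertices. So
  \<open>11 / 10\<close> of the new size is at least almost twice the old one.\<close>

lemma growth:
  assumes nh: "nohit \<tau>" and s: "N / 6 \<le> card (S \<tau>)" "2 * card (S \<tau>) \<le> card W"
  shows "real (card (S (\<tau> + 20))) \<ge> 3 / 2 * card (S \<tau>)"
proof -
  let ?S = "S \<tau>" and ?S' = "S (\<tau> + 20)"
  have 1: "real (card ?S) - \<delta> * N \<le> card (nb W ?S)" by (rule good_ex[OF good S_W s(2)])
  have 2: "real (card (nb W ?S - ?S')) \<le> card ?S' / 10 + (card Q0 + 2)"
    using runs_real[OF nh, of 20] M20 by simp
  have "card ?S + card (nb W ?S) \<le> card ?S' + card (nb W ?S - ?S')"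
  proof -
    have "card ?S + card (nb W ?S) = card (?S \<union> nb W ?S)"
      using fin_S finite_nb[OF finW] nb_disjoint[of W ?S] by (intro card_Un_disjoint[symmetric]) blast+
    also have "\<dots> \<le> card (?S' \<union> (nb W ?S - ?S'))"
      using fin_S finite_nb[OF finW] S_mono[of \<tau> "\<tau> + 20"] by (intro card_mono) auto
    also have "\<dots> \<le> card ?S' + card (nb W ?S - ?S')" by (rule card_Un_le)
    finally show ?thesis .
  qed
  then show ?thesis using 1 2 kQ big \<delta>N s by linarith
qed

text \<open>Three growth steps from \<open>N / 6\<close> give \<open>27 / 48 * N\<close>, more than
  half.\<close>

lemma S60_large:
  assumes nh: "nohit 60"
  shows "card W \<le> 2 * card (S 60)"
proof (rule ccontr)
  assume c: "\<not> ?thesis"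
  have mono: "card (S \<tau>) \<le> card (S 60)" if "\<tau> \<le> 60" for \<tau>
    using fin_S S_mono[OF that] by (rule card_mono)
  have nh': "nohit \<tau>" if "\<tau> \<le> 60" for \<tau> using nohit_mono[OF nh that] .
  have 0: "N / 6 \<le> card (S 0)" by (rule S0_large[OF nh'[of 0]]) simp
  have 1: "real (card (S 20)) \<ge> 3 / 2 * card (S 0)"
    using growth[OF nh'[of 0] 0] mono[of 0] c by simp
  have 2: "real (card (S 40)) \<ge> 3 / 2 * card (S 20)"
    using growth[OF nh'[of 20]] mono[of 20] c 0 1 by simp
  have 3: "real (card (S 60)) \<ge> 3 / 2 * card (S 40)"
    using growth[OF nh'[of 40]] mono[of 40] c 0 1 2 by simp
  have "real (card (S 60)) \<ge> 27 / 48 * N" using 0 1 2 3 by linarith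
  then show False using c by linarith
qed

lemma miss_step:
  assumes nh: "nohit \<tau>" and m: "1 \<le> m" "m \<le> M"
  shows "real (card (W - S (\<tau> + m))) \<le> 2 * N / m + (card Q0 + 2) + card (W - S \<tau> - nb W (S \<tau>))"
proof -
  have "W - S (\<tau> + m) \<subseteq> (nb W (S \<tau>) - S (\<tau> + m)) \<union> (W - S \<tau> - nb W (S \<tau>))"
    using S_mono[of \<tau> "\<tau> + m"] by auto
  then have "card (W - S (\<tau> + m)) \<le> card ((nb W (S \<tau>) - S (\<tau> + m)) \<union> (W - S \<tau> - nb W (S \<tau>)))"
    using finW finite_nb[OF finW] by (intro card_mono) auto
  also have "\<dots> \<le> card (nb W (S \<tau>) - S (\<tau> + m)) + card (W - S \<tau> - nb W (S \<tau>))" by (rule card_Un_le)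
  finally have "real (card (W - S (\<tau> + m))) \<le> card (nb W (S \<tau>) - S (\<tau> + m)) + card (W - S \<tau> - nb W (S \<tau>))"
    by linarith
  moreover have "real (2 * card (S (\<tau> + m))) / m \<le> 2 * N / m"
    using card_mono[OF finW S_W, of "\<tau> + m"] by (intro divide_right_mono) auto
  ultimately show ?thesis using runs_real[OF nh m] by linarith
qed

text \<open>Vertices without a neighbour in \<open>S \<tau>\<close> have all their neighbours among
  the few non-ends, so expansion makes them fewer by a factor \<open>10 * \<delta>\<close>. Were
  they too many for the small-set clause, \<open>good_jump\<close> would produce
  \<open>N / 40\<close> non-ends.\<close>

lemma far_small:
  assumes "real (card (W - S \<tau>)) \<le> N / 50"
  shows "real (card (W - S \<tau> - nb W (S \<tau>))) \<le> 10 * \<delta> * card (W - S \<tau>)"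
proof -
  let ?Z = "W - S \<tau> - nb W (S \<tau>)"
  have sub: "nb W U \<subseteq> W - S \<tau>" if "U \<subseteq> ?Z" for U
    using that adj_sym unfolding nb_def by blast
  have le: "card (nb W U) \<le> card (W - S \<tau>)" if "U \<subseteq> ?Z" for U
    using sub[OF that] finW by (intro card_mono) auto
  show ?thesis
  proof (cases "real (card ?Z) \<le> \<delta> * N / 2")
    case True
    then have "card ?Z / (10 * \<delta>) \<le> card (nb W ?Z)" using good_small[OF good, of ?Z] by blast
    then have "card ?Z / (10 * \<delta>) \<le> card (W - S \<tau>)" using le[OF order_refl] by linarith
    then show ?thesis using \<delta> by (simp add: field_simps)
  next
    case False
    then obtain U where U: "U \<subseteq> ?Z" "real (card (nb W U)) \<ge> N / 40"
      using good_jump[OF good \<delta>(1), of ?Z] big by auto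
    have "0 < N" using big by (metis less_le_trans mult_zero_right of_nat_0_le_iff order_le_less zero_less_numeral not_less)
    then show ?thesis using le[OF U(1)] U(2) assms by linarith
  qed
qed

text \<open>Windows of length \<open>m = 200 * 2 ^ i\<close> for \<open>i = 0, 1, \<dots>\<close>: doubling \<open>m\<close> halves the error \<open>2 * N / m\<close> of \<open>miss_step\<close> and
  keeps the total trimming below \<open>60 + 2 * m\<close>.\<close>

lemma miss_bound:
  assumes nh: "nohit (60 + 200 * (2 ^ Suc i - 1))" and i: "200 * 2 ^ i \<le> M"
  shows "real (card (W - S (60 + 200 * (2 ^ Suc i - 1)))) \<le> 3 * N / (200 * 2 ^ i) + 2 * (card Q0 + 2)
    \<and> real (card (W - S (60 + 200 * (2 ^ Suc i - 1)))) \<le> N / 50"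
  using assms
proof (induction i)
  case 0
  have nh: "nohit 60" using 0(1) by (rule nohit_mono) simp
  have "real (card (W - S (60 + 200))) \<le> 2 * N / real 200 + (card Q0 + 2) + card (W - S 60 - nb W (S 60))"
    by (rule miss_step[OF nh]) (use M20 in auto)
  \<comment> \<open>\<open>far_small\<close> needs at most \<open>N / 50\<close> missing vertices,
    so the first window relies on \<open>S 60\<close> being half of \<open>W\<close>
    instead.\<close>
  moreover have "real (card (W - S 60 - nb W (S 60))) \<le> \<delta> * N + 2"
    by (rule good_big[OF good S_W S60_large[OF nh]])
  ultimately show ?case using kQ big \<delta>N by simp
next
  case (Suc i)
  let ?\<tau> = "60 + 200 * (2 ^ Suc i - 1) :: nat" and ?m = "200 * 2 ^ Suc i :: nat"
  have e: "60 + 200 * (2 ^ Suc (Suc i) - 1) = ?\<tau> + ?m"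
  proof -
    have "(1::nat) \<le> 2 ^ i" by simp
    then show ?thesis unfolding power_Suc by linarith
  qed
  have nh: "nohit ?\<tau>" using Suc.prems(1) by (rule nohit_mono) (use e in simp)
  have IH: "real (card (W - S ?\<tau>)) \<le> 3 * N / (200 * 2 ^ i) + 2 * (card Q0 + 2)" "real (card (W - S ?\<tau>)) \<le> N / 50"
    using Suc.IH[OF nh] Suc.prems(2) by auto
  have "real (card (W - S (?\<tau> + ?m))) \<le> 2 * N / ?m + (card Q0 + 2) + card (W - S ?\<tau> - nb W (S ?\<tau>))"
    by (rule miss_step[OF nh]) (use Suc.prems in auto)
  also have "real (card (W - S ?\<tau> - nb W (S ?\<tau>))) \<le> 10 * \<delta> * card (W - S ?\<tau>)"
    by (rule far_small[OF IH(2)])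
  also have "10 * \<delta> * card (W - S ?\<tau>) \<le> (1 / 1000) * (3 * N / (200 * 2 ^ i) + 2 * (card Q0 + 2))"
    using \<delta> IH(1) by (intro mult_mono) auto
  also have "3 * N / (200 * 2 ^ i) = 6 * N / ?m" by (simp add: field_simps)
  finally have a: "real (card (W - S (?\<tau> + ?m))) \<le> 2 * N / ?m + (card Q0 + 2) + (1 / 1000) * (6 * N / ?m + 2 * (card Q0 + 2))"
    by simp
  have aux: "x \<le> 3 * n / m + 2 * q" if "x \<le> 2 * n / m + q + 1 / 1000 * (6 * n / m + 2 * q)" "0 \<le> n / m" "0 \<le> q"
    for x n m q :: real
  proof -
    have "6 * n / m = 6 * (n / m)" "2 * n / m = 2 * (n / m)" "3 * n / m = 3 * (n / m)" by simp_all
    then show ?thesis using that by argo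
  qed
  have "real (card (W - S (?\<tau> + ?m))) \<le> 3 * N / ?m + 2 * real (card Q0 + 2)"
    by (rule aux) (use a in simp_all)
  then have b: "real (card (W - S (?\<tau> + ?m))) \<le> 3 * N / ?m + 2 * (card Q0 + 2)" by simp
  have "card (W - S (?\<tau> + ?m)) \<le> card (W - S ?\<tau>)"
    using finW S_mono[of ?\<tau> "?\<tau> + ?m"] by (intro card_mono) auto
  then show ?case using b IH(2) unfolding e by simp
qed

text \<open>As long as nothing is hit, neighbours of \<open>U\<close> are no active ends, so they
  fit into the missing set of \<open>miss_bound\<close>; but \<open>U\<close> sees too many vertices
  for that. All windows up to \<open>M\<close> together trim
  \<open>60 + 2 * M - 200 \<le> 3 * M\<close>.\<close>

lemma hit:
  assumes M: "M = 200 * 2 ^ i" and U: "U \<subseteq> T0 \<inter> W" "real (card U) \<le> \<delta> * N / 2"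
    and gt: "card U / (10 * \<delta>) > 3 * N / M + 2 * (card Q0 + 2)"
  shows "\<not> nohit (3 * M)"
proof
  assume nh: "nohit (3 * M)"
  let ?\<tau> = "60 + 200 * (2 ^ Suc i - 1) :: nat"
  have nh': "nohit ?\<tau>" using nh proof (rule nohit_mono)
    have "(1::nat) \<le> 2 ^ i" by simp
    then show "?\<tau> \<le> 3 * M" unfolding M power_Suc by linarith
  qed
  have "nb W U \<subseteq> W - S ?\<tau>"
  proof
    fix v assume v: "v \<in> nb W U"
    then obtain t where t: "t \<in> U" "adj t v" by (auto simp: nb_def)
    have "v \<notin> S ?\<tau>"
    proof
      assume "v \<in> S ?\<tau>"
      then obtain P Q where "reach ?\<tau> P Q" "v = last P" by (auto simp: S_def)
      then show False using nh' t U(1) adj_sym[OF t(2)] unfolding nohit_def by blast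
    qed
    then show "v \<in> W - S ?\<tau>" using v by (auto simp: nb_def)
  qed
  then have "card (nb W U) \<le> card (W - S ?\<tau>)" using finW by (intro card_mono) auto
  moreover have "card U / (10 * \<delta>) \<le> card (nb W U)" using good_small[OF good, of U] U by auto
  moreover have "real (card (W - S ?\<tau>)) \<le> 3 * N / M + 2 * (card Q0 + 2)"
    using miss_bound[OF nh'] by (simp add: M)
  ultimately show False using gt by linarith
qed

end

section \<open>Path partitions and merging two of their paths\<close>

definition fsz :: "'a list set \<Rightarrow> nat" where
  "fsz F = (\<Sum>p\<in>F. length p)"

context sgraph
begin

lemma forest_finite: "forest F \<Longrightarrow> finite F"
  by (simp add: forest_def)

lemma forest_pth: "forest F \<Longrightarrow> p \<in> F \<Longrightarrow> pth p"
  by (simp add: forest_def)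

lemma forest_disj: "forest F \<Longrightarrow> p \<in> F \<Longrightarrow> q \<in> F \<Longrightarrow> p \<noteq> q \<Longrightarrow> set p \<inter> set q = {}"
  by (simp add: forest_def)

lemma forest_subset: "forest F \<Longrightarrow> F' \<subseteq> F \<Longrightarrow> forest F'"
  unfolding forest_def using finite_subset by blast

lemma forest_card_cov: "forest F \<Longrightarrow> card (cov F) = fsz F"
proof -
  assume f: "forest F"
  have "card (cov F) = (\<Sum>p\<in>F. card (set p))"
    unfolding cov_def using f by (intro card_UN_disjoint) (auto simp: forest_def)
  also have "\<dots> = fsz F"
    unfolding fsz_def using f by (intro sum.cong) (auto simp: forest_def pth_def distinct_card)
  finally show ?thesis .
qed

lemma forest_replace:
  assumes f: "forest F" and R: "R \<subseteq> F" and f': "forest R'" and c: "cov R' \<subseteq> cov R"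
  shows "forest ((F - R) \<union> R')" "fsz ((F - R) \<union> R') + fsz R = fsz F + fsz R'"
    "card ((F - R) \<union> R') + card R = card F + card R'" "cov ((F - R) \<union> R') \<subseteq> cov F"
proof -
  have d: "set p \<inter> set q = {}" if p: "p \<in> F - R" and q: "q \<in> R'" for p q
  proof -
    have "set p \<inter> set r = {}" if "r \<in> R" for r
    proof -
      have "r \<in> F" "p \<noteq> r" using that p R by auto
      then show ?thesis using f p by (simp add: forest_def)
    qed
    then have "set p \<inter> cov R = {}" unfolding cov_def by blast
    moreover have "set q \<subseteq> cov R" using c q unfolding cov_def by blast
    ultimately show ?thesis by blast
  qed
  show "forest ((F - R) \<union> R')"
    unfolding forest_def
  proof (intro conjI ballI impI)
    show "finite ((F - R) \<union> R')" using f f' by (simp add: forest_def)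
    show "pth p" if "p \<in> (F - R) \<union> R'" for p using that f f' by (auto simp: forest_def)
    show "set p \<inter> set q = {}" if pq: "p \<in> (F - R) \<union> R'" "q \<in> (F - R) \<union> R'" "p \<noteq> q" for p q
    proof -
      consider "p \<in> F - R" "q \<in> F - R" | "p \<in> F - R" "q \<in> R'" | "q \<in> F - R" "p \<in> R'" | "p \<in> R'" "q \<in> R'"
        using pq(1,2) by blast
      then show ?thesis
      proof cases
        case 1
        then show ?thesis using f pq(3) by (auto simp: forest_def)
      next
        case 2
        then show ?thesis by (rule d)
      next
        case 3
        then show ?thesis using d by blast
      next
        case 4
        then show ?thesis using f' pq(3) by (auto simp: forest_def)
      qed
    qed
  qed
  have dis: "(F - R) \<inter> R' = {}"
  proof -
    have "p \<noteq> []" if "p \<in> R'" for p using f' that by (auto simp: forest_def pth_def)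
    then show ?thesis using d by (metis Int_iff Int_absorb disjoint_iff set_empty)
  qed
  have fin: "finite F" "finite R'" "finite R" using f f' R finite_subset by (auto simp: forest_def)
  have "fsz ((F - R) \<union> R') = fsz (F - R) + fsz R'"
    unfolding fsz_def using dis fin by (intro sum.union_disjoint) auto
  moreover have "fsz F = fsz (F - R) + fsz R" unfolding fsz_def by (rule sum.subset_diff[OF R fin(1)])
  ultimately show "fsz ((F - R) \<union> R') + fsz R = fsz F + fsz R'" by simp
  have "card ((F - R) \<union> R') = card (F - R) + card R'" using dis fin by (intro card_Un_disjoint) auto
  moreover have "card (F - R) + card R = card F"
    using fin R by (simp add: card_Diff_subset card_mono)
  ultimately show "card ((F - R) \<union> R') + card R = card F + card R'" by simp
  show "cov ((F - R) \<union> R') \<subseteq> cov F" using c R unfolding cov_def by blast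
qed

lemma forest_single [simp]: "forest {p} \<longleftrightarrow> pth p"
  by (simp add: forest_def)

lemma forest_pair: "pth p \<Longrightarrow> pth q \<Longrightarrow> set p \<inter> set q = {} \<Longrightarrow> forest {p, q}"
  by (auto simp: forest_def)

lemma cov_simps [simp]: "cov {} = {}" "cov (insert p F) = set p \<union> cov F"
  by (auto simp: cov_def)

text \<open>A path partition with the fewest paths: the crossing trick joins two paths at an edge of
  a third one.\<close>

lemma path_cover:
  assumes g: "good \<delta> W" and \<delta>: "0 < \<delta>"
  shows "\<exists>F. forest F \<and> cov F = W \<and> real (card F) \<le> 2 * \<delta> * real (card W) + 7"
proof -
  have finW: "finite W" by (rule good_finite[OF g])
  let ?P = "\<lambda>F. forest F \<and> cov F = W"
  have "?P ((\<lambda>x. [x]) ` W)" using finW by (auto simp: forest_def cov_def)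
  from ex_has_least_nat[of ?P, OF this, of card]
  obtain F where F: "forest F" "cov F = W" and least: "\<And>F'. forest F' \<Longrightarrow> cov F' = W \<Longrightarrow> card F \<le> card F'"
    by blast
  have finF: "finite F" using F(1) by (rule forest_finite)
  note pthF = forest_pth[OF F(1)] and disF = forest_disj[OF F(1)]
  have no_improve: False if R: "R \<subseteq> F" "forest R'" "cov R' = cov R" "card R' < card R" for R R'
  proof -
    note r = forest_replace[OF F(1) R(1) R(2)]
    have "cov ((F - R) \<union> R') = W"
      using R(1,3) F(2) unfolding cov_def by blast
    then have "card F \<le> card ((F - R) \<union> R')" using r(1) R(3) least by blast
    then show False using r(3) R(3,4) by simp
  qed
  have pq: "card {p, q} = 2" if "p \<noteq> q" for p q :: "'a list" using that by simp
  have hh: "\<not> adj (hd p) (hd q)" and ll: "\<not> adj (last p) (last q)" and pn: "p \<noteq> q \<Longrightarrow> p \<noteq> []"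
    if "p \<in> F" "q \<in> F" for p q
  proof -
    have ne: "p \<noteq> []" "q \<noteq> []" using pthF that pth_ne by auto
    show "p \<noteq> []" by (rule ne)
    show "\<not> adj (hd p) (hd q)"
    proof
      assume a: "adj (hd p) (hd q)"
      then have "p \<noteq> q" using adj_irrefl by blast
      then have d: "set p \<inter> set q = {}" using disF that by blast
      have "pth (rev p @ q)" using a d ne pthF that by (subst pth_append) (auto simp: last_rev)
      then show False using no_improve[of "{p, q}" "{rev p @ q}"] that \<open>p \<noteq> q\<close> by auto
    qed
    show "\<not> adj (last p) (last q)"
    proof
      assume a: "adj (last p) (last q)"
      then have "p \<noteq> q" using adj_irrefl by blast
      then have d: "set p \<inter> set q = {}" using disF that by blast
      have "pth (p @ rev q)" using a d ne pthF that by (subst pth_append) (auto simp: hd_rev)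
      then show False using no_improve[of "{p, q}" "{p @ rev q}"] that \<open>p \<noteq> q\<close> by auto
    qed
  qed
  \<comment> \<open>If \<open>q\<close> is \<open>pa\<close> or \<open>pb\<close>, the two paths
    become one; otherwise \<open>q\<close> is cut between \<open>z\<close> and \<open>y\<close> and
    its parts absorb \<open>pb\<close> and \<open>pa\<close>, so three paths become two.\<close>
  have cross: False if p: "pa \<in> F" "pb \<in> F" "pa \<noteq> pb" and q: "q \<in> F" "q = l @ z # y # r"
    and a: "adj (hd pa) y" and b: "adj (last pb) z" for pa pb q l z y r
  proof -
    have ne: "pa \<noteq> []" "pb \<noteq> []" using pthF p pth_ne by auto
    have q': "q = (l @ [z]) @ (y # r)" using q by simp
    have s1: "pth (l @ [z])" and s2: "pth (y # r)" and s3: "set (l @ [z]) \<inter> set (y # r) = {}"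
      using pthF[OF q(1)] pth_append[of "l @ [z]" "y # r"] q(2) by auto
    have s1': "pth (z # rev l)" using pth_rev[of "l @ [z]"] s1 by simp
    have s2': "pth (rev r @ [y])" using pth_rev[of "y # r"] s2 by simp
    have d: "set pa \<inter> set pb = {}" using disF p by blast
    consider "q = pa" | "q = pb" | "q \<noteq> pa" "q \<noteq> pb" by blast
    then show False
    proof cases
      case 1
      let ?n = "(pb @ rev (l @ [z])) @ (y # r)"
      have hq: "hd (l @ [z]) = hd pa" using 1 q' by (metis append_is_Nil_conv hd_append2 not_Cons_self2)
      have "pth (pb @ rev (l @ [z]))"
        using s1 s1' pthF p ne d 1 q' b by (subst pth_append) auto
      moreover have "last (pb @ rev (l @ [z])) = hd pa" using hq by (cases l) (auto simp: last_rev)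
      ultimately have "pth ?n"
        using s1 s1' s2 s2' s3 pthF p ne d 1 q' a by (subst pth_append) auto
      moreover have "cov {?n} = cov {pa, pb}" using 1 q' by auto
      ultimately show False using no_improve[of "{pa, pb}" "{?n}"] p by simp
    next
      case 2
      let ?n = "(l @ [z]) @ (rev (y # r) @ pa)"
      have lq: "last (y # r) = last pb" using 2 q' by (metis last_appendR list.distinct(1))
      have "pth (rev (y # r) @ pa)"
        using s2 s2' pthF p ne d 2 q' adj_sym[OF a] by (subst pth_append) auto
      moreover have "hd (rev (y # r) @ pa) = last pb" using lq by (simp only: hd_append hd_rev) auto
      ultimately have "pth ?n"
        using s1 s1' s3 d 2 q' adj_sym[OF b] ne by (subst pth_append) auto
      moreover have "cov {?n} = cov {pa, pb}" using 2 q' by auto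
      ultimately show False using no_improve[of "{pa, pb}" "{?n}"] p by simp
    next
      case 3
      have dq: "set q \<inter> set pa = {}" "set q \<inter> set pb = {}" using disF p q 3 by blast+
      let ?n1 = "(l @ [z]) @ rev pb" and ?n2 = "rev pa @ (y # r)"
      have "pth ?n1" using s1 s1' pthF p ne dq q' adj_sym[OF b] by (subst pth_append) (auto simp: hd_rev)
      moreover have "pth ?n2" using s2 s2' pthF p ne dq q' a by (subst pth_append) (auto simp: last_rev)
      moreover have "set ?n1 \<inter> set ?n2 = {}" using s3 d dq q' by auto
      ultimately have "forest {?n1, ?n2}" by (rule forest_pair)
      moreover have "cov {?n1, ?n2} = cov {pa, pb, q}" using q' by auto
      moreover have "card {?n1, ?n2} \<le> 2" by (simp add: card_insert_if)
      moreover have "card {pa, pb, q} = 3" using p 3 by simp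
      ultimately show False using no_improve[of "{pa, pb, q}" "{?n1, ?n2}"] p q(1) by simp
    qed
  qed
  show ?thesis
  proof (intro exI[of _ F] conjI F, rule ccontr)
    assume c: "\<not> real (card F) \<le> 2 * \<delta> * real (card W) + 7"
    \<comment> \<open>Large enough for \<open>good_mid\<close>, and with
      \<open>2 * qq < card F\<close>: the heads are taken from one part \<open>FA\<close> of the
      paths and the last vertices from a disjoint part \<open>FB\<close>, since \<open>cross\<close>
      needs two different paths.\<close>
    define qq where "qq = nat \<lfloor>\<delta> * real (card W)\<rfloor> + 3"
    have \<delta>W: "0 \<le> \<delta> * real (card W)" using \<delta> by simp
    have q1: "real qq > \<delta> * real (card W) + 2" using \<delta>W unfolding qq_def by linarith
    have q2: "real qq \<le> \<delta> * real (card W) + 3" using \<delta>W unfolding qq_def by linarith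
    have k: "2 * qq < card F"
    proof -
      have "real (card F) > 2 * (\<delta> * real (card W)) + 7" using c by (simp add: mult.assoc)
      then have "real (2 * qq) < real (card F)" using q2 by simp
      then show ?thesis by (simp only: of_nat_less_iff)
    qed
    have "qq \<le> card F" using k by linarith
    then obtain FA where FA: "FA \<subseteq> F" "card FA = qq" by (meson obtain_subset_with_card_n)
    have "card (F - FA) = card F - qq" using FA finF finite_subset by (subst card_Diff_subset) auto
    then have "qq \<le> card (F - FA)" using k by simp
    then obtain FB where FB: "FB \<subseteq> F - FA" "card FB = qq" by (meson obtain_subset_with_card_n)
    have hdin: "hd p \<in> set p" "last p \<in> set p" if "p \<in> F" for p using pthF[OF that] by (auto simp: pth_def)
    have injh: "inj_on hd F" and injl: "inj_on last F"
      using hdin disF by (metis (no_types, lifting) disjoint_iff inj_onI)+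
    let ?A = "hd ` FA" and ?B = "last ` FB"
    have cA: "card ?A = qq" using FA injh by (metis card_image inj_on_subset)
    have cB: "card ?B = qq" using FB injl by (metis card_image inj_on_subset Diff_subset)
    have AW: "?A \<subseteq> W" "?B \<subseteq> W" "last ` F \<subseteq> W" using FA FB hdin F(2) unfolding cov_def by blast+
    let ?NA = "nb W ?A" and ?NB = "nb W ?B"
    have "real (card (?A \<union> ?NA)) \<ge> card W / 2" using good_mid[OF g AW(1)] cA q1 by simp
    then have NA: "real (card ?NA) \<ge> card W / 2 - qq" using card_Un_le[of ?A ?NA] cA by linarith
    have "real (card (?B \<union> ?NB)) \<ge> card W / 2" using good_mid[OF g AW(2)] cB q1 by simp
    then have NB: "real (card ?NB) \<ge> card W / 2 - qq" using card_Un_le[of ?B ?NB] cB by linarith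
    have "\<exists>z. y \<in> ?NA \<longrightarrow> (\<exists>pa\<in>FA. adj (hd pa) y) \<and> (\<exists>q l r. q \<in> F \<and> q = l @ z # y # r)" for y
    proof (cases "y \<in> ?NA")
      case True
      then obtain pa where pa: "pa \<in> FA" "adj (hd pa) y" and yW: "y \<in> W" by (auto simp: nb_def)
      obtain q where q: "q \<in> F" "y \<in> set q" using yW F(2) unfolding cov_def by blast
      obtain l r where lr: "q = l @ y # r" using q(2) by (meson split_list)
      have "l \<noteq> []"
      proof
        assume "l = []"
        then have "hd q = y" using lr by simp
        then show False using hh[of pa q] pa FA q(1) by auto
      qed
      then have "q = butlast l @ last l # y # r" using lr by simp
      then show ?thesis using pa q(1) by blast
    qed simp
    then obtain pr where pr: "\<And>y. y \<in> ?NA \<Longrightarrow> (\<exists>pa\<in>FA. adj (hd pa) y) \<and> (\<exists>q l r. q \<in> F \<and> q = l @ pr y # y # r)"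
      by metis
    have prin: "inj_on pr ?NA"
    proof (rule inj_onI)
      fix y y' assume y: "y \<in> ?NA" "y' \<in> ?NA" "pr y = pr y'"
      obtain q l r where q: "q \<in> F" "q = l @ pr y # y # r" using pr[OF y(1)] by blast
      obtain q' l' r' where q': "q' \<in> F" "q' = l' @ pr y # y' # r'" using pr[OF y(2)] y(3) by auto
      have "q = q'" using disF[OF q(1) q'(1)] q(2) q'(2) by auto
      moreover have "distinct q" using pthF[OF q(1)] by (simp add: pth_def)
      then have "pr y \<notin> set l" "pr y \<notin> set (y # r)" using q(2) by auto
      ultimately have "y # r = y' # r'" using q(2) q'(2) append_Cons_eq_iff[of "pr y" l "y # r" l' "y' # r'"] by simp
      then show "y = y'" by simp
    qed
    have prW: "pr ` ?NA \<subseteq> W" using pr F(2) unfolding cov_def by fastforce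
    have d1: "pr ` ?NA \<inter> ?NB = {}"
    proof (rule ccontr)
      assume "\<not> ?thesis"
      then obtain y where y: "y \<in> ?NA" "pr y \<in> ?NB" by blast
      obtain pb where pb: "pb \<in> FB" "adj (last pb) (pr y)" using y(2) by (auto simp: nb_def)
      obtain pa q l r where "pa \<in> FA" "adj (hd pa) y" "q \<in> F" "q = l @ pr y # y # r" using pr[OF y(1)] by blast
      then show False using cross[of pa pb q l "pr y" y r] pb FA FB by blast
    qed
    have d2: "(pr ` ?NA \<union> ?NB) \<inter> last ` F = {}"
    proof (rule ccontr)
      assume "\<not> ?thesis"
      then obtain v where v: "v \<in> last ` F" "v \<in> pr ` ?NA \<or> v \<in> ?NB" by blast
      then obtain p where p: "p \<in> F" "last p \<in> pr ` ?NA \<or> last p \<in> ?NB" by (metis imageE)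
      from p(2) show False
      proof
        assume "last p \<in> pr ` ?NA"
        then obtain y q l r where y: "q \<in> F" "q = l @ last p # y # r" using pr by force
        then have "q = p" using disF[OF y(1) p(1)] hdin(2)[OF p(1)] by auto
        then have "last p = last (y # r)" using y(2) by (metis last.simps last_appendR list.distinct(1))
        moreover have "distinct q" using pthF[OF y(1)] by (simp add: pth_def)
        moreover have "last (y # r) \<in> set (y # r)" by (rule last_in_set) simp
        ultimately show False using y(2) by auto
      next
        assume "last p \<in> ?NB"
        then obtain pb where "pb \<in> FB" "adj (last pb) (last p)" by (auto simp: nb_def)
        then show False using ll[of pb p] FB p(1) by blast
      qed
    qed
    \<comment> \<open>Three pairwise disjoint sets in \<open>W\<close>: the predecessors of
      neighbours of heads, the neighbours of last vertices, and all last vertices. The first two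
      have at least \<open>card W / 2 - qq\<close> elements each, which leaves room for at most
      \<open>2 * qq\<close> paths.\<close>
    have "card (pr ` ?NA \<union> ?NB \<union> last ` F) = card (pr ` ?NA) + card ?NB + card (last ` F)"
      using d1 d2 finite_nb[OF finW] finF by (simp add: card_Un_disjoint)
    moreover have "card (pr ` ?NA \<union> ?NB \<union> last ` F) \<le> card W"
      by (rule card_mono[OF finW]) (intro Un_least prW nb_subset AW(3))
    moreover have "card (pr ` ?NA) = card ?NA" by (rule card_image[OF prin])
    moreover have "card (last ` F) = card F" by (rule card_image[OF injl])
    ultimately have "card ?NA + card ?NB + card F \<le> card W" by simp
    then show False using NA NB k by linarith
  qed
qed

end

context rot
begin

text \<open>Up to the first hit of \<open>T0\<close>, the protected ends stay in place.\<close>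

lemma tails_kept:
  assumes T0: "\<And>q. q \<in> Q0 \<Longrightarrow> set (drop (length q - M) q) \<subseteq> T0"
  shows "reach \<tau> P Q \<Longrightarrow> (\<forall>q\<in>Q0. \<exists>q'\<in>Q. suffix (drop (length q - M) q) q') \<or>
    (\<exists>P' Q' x. reach \<tau> P' Q' \<and> (\<forall>q\<in>Q0. \<exists>q'\<in>Q'. suffix (drop (length q - M) q) q') \<and> adj (last P') x \<and> x \<in> T0)"
    (is "_ \<Longrightarrow> ?inv Q \<or> ?hit")
proof (induction rule: reach.induct)
  case base
  then show ?case by (meson suffix_drop)
next
  case (R2 P Q s x t)
  show ?case
  proof (cases ?hit)
    case False
    then have inv: "?inv Q" using R2.IH by blast
    then have "x \<notin> T0" using False R2.hyps by blast
    have "\<exists>q'\<in>insert (P @ x # t) (Q - {s @ x # t}). suffix (drop (length q - M) q) q'" if qQ: "q \<in> Q0" for q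
    proof -
      let ?d = "drop (length q - M) q"
      have xd: "x \<notin> set ?d" using T0[OF qQ] \<open>x \<notin> T0\<close> by blast
      obtain q' where q': "q' \<in> Q" "suffix ?d q'" using inv qQ by blast
      show ?thesis
      proof (cases "q' = s @ x # t")
        case True
        then have "suffix ?d (s @ x # t)" using q' by simp
        then have "suffix ?d (x # t)"
          using xd unfolding suffix_append[of ?d s "x # t"] by fastforce
        then have "suffix ?d t" using xd unfolding suffix_Cons by fastforce
        then have "suffix ?d (P @ x # t)" by (metis append_Cons suffix_ConsI suffix_appendI append.assoc)
        then show ?thesis by blast
      qed (use q' in blast)
    qed
    then show ?thesis by blast
  qed blast
qed auto

lemma csz_fsz: "valid P Q \<Longrightarrow> csz P Q = fsz (insert P Q)"
  unfolding csz_def fsz_def valid_def forest_def by simp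

end

context rotgood
begin

text \<open>After a hit at \<open>y\<close> on \<open>q = u @ y # w\<close>, the active path
  continues through \<open>y\<close> backwards along \<open>u\<close> and loses only
  \<open>w\<close>, which lies within the last \<open>M\<close> vertices; at a first vertex nothing
  is lost. Together with trimming by \<open>3 * M\<close> this makes \<open>4 * M\<close>.\<close>

lemma merge:
  assumes M: "M = 200 * 2 ^ i" and T0eq: "T0 = (\<Union>q\<in>Q0. set (drop (length q - M) q))"
    and U: "U \<subseteq> T0 \<inter> W" "real (card U) \<le> \<delta> * N / 2"
    and gt: "card U / (10 * \<delta>) > 3 * N / M + 2 * (card Q0 + 2)"
  shows "\<exists>F'. forest F' \<and> cov F' \<subseteq> W \<and> card F' = card Q0 \<and> fsz F \<le> fsz F' + 4 * M"
proof -
  let ?inv = "\<lambda>Q. \<forall>q\<in>Q0. \<exists>q'\<in>Q. suffix (drop (length q - M) q) q'"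
  have "\<not> nohit (3 * M)" by (rule hit[OF M U gt])
  then obtain P Q x where r: "reach (3 * M) P Q" "adj (last P) x" "x \<in> T0 \<or> x \<in> hd ` Q"
    unfolding nohit_def by blast
  have fszF: "fsz F = csz P0 Q0" using csz_fsz[OF reach_valid[OF reach.base[of 0]]] by simp
  have fin: ?thesis if s: "reach (3 * M) P' Q'" and q: "q \<in> Q'" "q = u @ y # w" and a: "adj (last P') y"
    and len: "u = [] \<or> length w \<le> M" for P' Q' q u y w
  proof -
    have v: "valid P' Q'" by (rule reach_valid[OF s])
    then have f: "forest (insert P' Q')" and nin: "P' \<notin> Q'" and cW: "cov (insert P' Q') \<subseteq> W" and cc: "card Q' = card Q0"
      by (auto simp: valid_def)
    have qq: "q \<noteq> P'" using nin q(1) by blast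
    have d: "set P' \<inter> set q = {}" using forest_disj[OF f] q(1) qq by blast
    have pp: "pth P'" "pth q" using f q(1) by (auto simp: forest_def)
    define n where "n = (if u = [] then P' @ q else P' @ y # rev u)"
    have pn: "pth n"
    proof (cases "u = []")
      case True
      then show ?thesis using pp d a q(2) unfolding n_def by (simp add: pth_append pth_ne)
    next
      case False
      have "pth ((u @ [y]) @ w)" using pp q(2) by simp
      then have "pth (u @ [y])" by (rule pth_appendD1) simp
      then have "pth (rev (u @ [y]))" by (simp only: pth_rev)
      then have "pth (y # rev u)" by simp
      then show ?thesis using pp d a q(2) False unfolding n_def by (auto simp: pth_append pth_ne)
    qed
    have sn: "set n \<subseteq> set P' \<union> set q" using q(2) by (auto simp: n_def split: if_splits)
    have ln: "length P' + length q \<le> length n + M" using len q(2) by (auto simp: n_def)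
    have RF: "{P', q} \<subseteq> insert P' Q'" using q(1) by blast
    have "cov {n} \<subseteq> cov {P', q}" using sn by simp
    note rep = forest_replace[OF f RF _ this]
    let ?F' = "(insert P' Q' - {P', q}) \<union> {n}"
    have "forest ?F'" using rep(1) pn by simp
    moreover have "cov ?F' \<subseteq> W" using rep(4) pn cW by (meson forest_single order_trans)
    moreover have "card ?F' = card Q0"
    proof -
      have "card ?F' + 2 = card (insert P' Q') + 1" using rep(3) pn qq by auto
      moreover have "finite Q'" using forest_finite[OF f] by simp
      ultimately show ?thesis using nin cc by simp
    qed
    moreover have "fsz ?F' + (length P' + length q) = fsz (insert P' Q') + length n"
      using rep(2) pn qq unfolding fsz_def by auto
    then have "fsz F \<le> fsz ?F' + 4 * M"
      using ln fszF reach_csz[OF s] csz_fsz[OF v] by linarith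
    ultimately show ?thesis by blast
  qed
  have tail: ?thesis if s: "reach (3 * M) P' Q'" "?inv Q'" and a: "adj (last P') y" "y \<in> T0" for P' Q' y
  proof -
    obtain q0 where q0: "q0 \<in> Q0" "y \<in> set (drop (length q0 - M) q0)" using a(2) T0eq by blast
    obtain q where q: "q \<in> Q'" "suffix (drop (length q0 - M) q0) q" using s(2) q0(1) by blast
    obtain u w where uw: "drop (length q0 - M) q0 = u @ y # w" using q0(2) by (meson split_list)
    have "length (u @ y # w) \<le> M" unfolding uw[symmetric] by simp
    then have lw: "length w \<le> M" by simp
    obtain b where "q = b @ drop (length q0 - M) q0" using q(2) by (auto simp: suffix_def)
    then have "q = (b @ u) @ y # w" using uw by simp
    then show ?thesis using fin[OF s(1) q(1) _ a(1)] lw by blast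
  qed
  show ?thesis
  proof (cases "x \<in> T0")
    case True
    then show ?thesis using tails_kept[OF T0 r(1)] tail r by blast
  next
    case False
    then obtain q where q: "q \<in> Q" "x = hd q" using r(3) by blast
    then have "q = [] @ x # tl q" using reach_pth[OF r(1), of q] by (cases q) (auto simp: pth_def)
    then show ?thesis using fin[OF r(1) q(1) _ r(2)] by blast
  qed
qed

text \<open>The target is the beginning of the only path. Until the first hit it remains a prefix: a
  rotation inside it would be a hit, and trimming is too limited to reach it. The hit cuts off what
  precedes it and closes the rest to a cycle; \<open>4 * M + 3\<close> ensures three
  vertices.\<close>

lemma close:
  assumes M: "M = 200 * 2 ^ i" and Q0: "Q0 = {}" and T0eq: "T0 = set (take M P0)" and len: "4 * M + 3 \<le> length P0"
    and U: "U \<subseteq> T0 \<inter> W" "real (card U) \<le> \<delta> * N / 2"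
    and gt: "card U / (10 * \<delta>) > 3 * N / M + 2 * (card Q0 + 2)"
  shows "\<exists>c. cyc c \<and> set c \<subseteq> W \<and> length P0 \<le> length c + 4 * M"
proof -
  let ?pre = "take M P0"
  have Qe: "Q = {}" if "reach \<tau> P Q" for \<tau> P Q
  proof -
    have "card Q = card Q0" using reach_valid[OF that] by (simp add: valid_def)
    then show ?thesis using reach_finite[OF that] unfolding Q0 by simp
  qed
  have keep: "reach (3 * M) P Q \<Longrightarrow> prefix ?pre P \<or>
      (\<exists>P' Q' x. reach (3 * M) P' Q' \<and> prefix ?pre P' \<and> adj (last P') x \<and> x \<in> T0)"
    (is "_ \<Longrightarrow> _ \<or> ?hit") for P Q
  proof (induction rule: reach.induct)
    case base
    then show ?case by (simp add: take_is_prefix)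
  next
    case (R1 p x q v Q)
    show ?case
    proof (cases ?hit)
      case False
      then have pre: "prefix ?pre (p @ x # q @ [v])" using R1.IH by blast
      have "x \<notin> T0"
      proof
        assume "x \<in> T0"
        moreover have "adj (last (p @ x # q @ [v])) x" using R1.hyps(2) by simp
        ultimately show False using False pre R1.hyps(1) by blast
      qed
      then have xp: "x \<notin> set ?pre" using T0eq by simp
      have "prefix ?pre p"
      proof (cases "length ?pre \<le> length p")
        case True
        then show ?thesis using pre by (meson prefix_length_prefix prefixI)
      next
        case False
        have "p @ x # q @ [v] = (p @ [x]) @ (q @ [v])" by simp
        then have "prefix (p @ [x]) (p @ x # q @ [v])" by (rule prefixI)
        moreover have "length (p @ [x]) \<le> length ?pre" using False by (simp del: length_take)
        ultimately have "prefix (p @ [x]) ?pre" using pre prefix_length_prefix by blast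
        then have "set (p @ [x]) \<subseteq> set ?pre" by (rule set_mono_prefix)
        then show ?thesis using xp by simp
      qed
      then show ?thesis by (meson prefix_append prefix_prefix)
    qed blast
  next
    case (R2 P Q s x t)
    have "Q = {}" using Qe R2.hyps(1) by blast
    then show ?case using R2.hyps(2) by simp
  next
    case (TR p v Q)
    show ?case
    proof (cases ?hit)
      case False
      then have pre: "prefix ?pre (p @ [v])" using TR.IH by blast
      have "Q = {}" using Qe TR.hyps(1) by blast
      then have "length P0 \<le> length p + 3 * M" using TR.hyps(3) Q0 by (simp add: csz_def)
      then have "length ?pre \<le> length p" using len by simp
      then have "prefix ?pre p" using pre by (meson prefix_length_prefix prefixI)
      then show ?thesis by blast
    qed blast
  next
    case (EX P Q r)
    then show ?case by (meson prefix_prefix)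
  qed
  have "\<not> nohit (3 * M)" by (rule hit[OF M U gt])
  then obtain P Q x where r: "reach (3 * M) P Q" "adj (last P) x" "x \<in> T0 \<or> x \<in> hd ` Q"
    unfolding nohit_def by blast
  then have "x \<in> T0" using Qe[OF r(1)] by simp
  then obtain P' Q' y where s: "reach (3 * M) P' Q'" "prefix ?pre P'" "adj (last P') y" "y \<in> T0"
    using keep[OF r(1)] r by blast
  obtain u w where uw: "?pre = u @ y # w" using s(4) T0eq by (metis split_list)
  obtain z where z: "P' = ?pre @ z" using s(2) by (auto simp: prefix_def)
  let ?c = "y # w @ z"
  have P': "P' = u @ ?c" using uw z by simp
  have pP: "pth P'" using reach_pth[OF s(1)] by blast
  then have pc: "pth ?c" unfolding P' by (rule pth_appendD2) simp
  have "length P0 \<le> length P' + 3 * M" using reach_csz[OF s(1)] Qe[OF s(1)] Q0 by (simp add: csz_def)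
  moreover have "length (u @ y # w) \<le> M" unfolding uw[symmetric] by simp
  ultimately have l: "length P0 \<le> length ?c + 4 * M" using P' by simp
  have "cyc ?c" using pc l len s(3) P' by (simp add: cyc_def)
  moreover have "set ?c \<subseteq> W"
  proof -
    have "set P' \<subseteq> W" using reach_valid[OF s(1)] by (simp add: valid_def)
    then show ?thesis using P' by auto
  qed
  ultimately show ?thesis using l by blast
qed

end

text \<open>The trimming budget affordable when \<open>k\<close> paths are left; \<open>x\<close> stands for \<open>\<delta>\<close> times the number of vertices.\<close>

definition budget :: "real \<Rightarrow> nat \<Rightarrow> nat" where
  "budget x k = 200 * 2 ^ (LEAST i. real k * real (200 * 2 ^ i) ^ 2 \<ge> 120 * x)"

text \<open>The first property is what \<open>good_step\<close> uses:
  \<open>k * M / (40 * \<delta>)\<close> is at least \<open>3 * N / M\<close> once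
  \<open>k * M ^ 2 \<ge> 120 * \<delta> * N\<close>. For the upper bound, either the budget is
  \<open>200\<close>, or half of it fails the test and is at most
  \<open>11 * sqrt (x / k)\<close>.\<close>

lemma budget_props:
  assumes k: "1 \<le> k" and x: "0 \<le> x"
  shows "real k * real (budget x k) ^ 2 \<ge> 120 * x" "\<exists>i. budget x k = 200 * 2 ^ i"
    "real (budget x k) \<le> 200 + 22 * sqrt (x / k)"
proof -
  let ?P = "\<lambda>i. real k * real (200 * 2 ^ i) ^ 2 \<ge> 120 * x"
  obtain i where i: "x < 2 ^ i" using real_arch_pow[of 2 x] by auto
  have "?P i"
  proof -
    have "120 * x \<le> 40000 * (2 ^ i * 2 ^ i)"
    proof -
      have "x * 1 \<le> 2 ^ i * 2 ^ i" using i x by (intro mult_mono) auto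
      then show ?thesis using x by linarith
    qed
    also have "40000 * (2 ^ i * 2 ^ i) = 1 * real (200 * 2 ^ i) ^ 2" by (simp add: power2_eq_square)
    also have "\<dots> \<le> real k * real (200 * 2 ^ i) ^ 2" using k by (intro mult_right_mono) auto
    finally show ?thesis .
  qed
  then have L: "?P (LEAST i. ?P i)" by (rule LeastI)
  then show "real k * real (budget x k) ^ 2 \<ge> 120 * x" by (simp add: budget_def)
  show "\<exists>i. budget x k = 200 * 2 ^ i" by (auto simp: budget_def)
  show "real (budget x k) \<le> 200 + 22 * sqrt (x / k)"
  proof (cases "LEAST i. ?P i")
    case 0
    then have "budget x k = 200" by (simp add: budget_def)
    moreover have "0 \<le> sqrt (x / k)" using x by simp
    ultimately show ?thesis by simp
  next
    case (Suc j)
    then have "\<not> ?P j" by (metis lessI not_less_Least)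
    then have "real k * real (200 * 2 ^ j) ^ 2 < 120 * x" by simp
    then have "real (200 * 2 ^ j) ^ 2 \<le> 121 * (x / k)" using k x by (simp add: field_simps)
    then have "real (200 * 2 ^ j) \<le> sqrt (121 * (x / k))" by (intro real_le_rsqrt) simp
    also have "\<dots> = 11 * sqrt (x / k)"
    proof -
      have "sqrt 121 = (11::real)" by (rule real_sqrt_unique) auto
      then show ?thesis by (simp only: real_sqrt_mult)
    qed
    finally have "real (budget x k) \<le> 22 * sqrt (x / k)" using Suc by (simp add: budget_def)
    then show ?thesis by simp
  qed
qed

lemma sum_inverse_sqrt: "(\<Sum>j=1..n. 1 / sqrt (real j)) \<le> 2 * sqrt (real n)"
proof (induction n)
  case (Suc n)
  have a: "0 \<le> sqrt (real n)" "0 < sqrt (real (Suc n))" "sqrt (real n) \<le> sqrt (real (Suc n))" by auto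
  have "1 = sqrt (real (Suc n)) * sqrt (real (Suc n)) - sqrt (real n) * sqrt (real n)" by simp
  also have "\<dots> = (sqrt (real (Suc n)) - sqrt (real n)) * (sqrt (real (Suc n)) + sqrt (real n))"
    by (simp add: algebra_simps)
  also have "\<dots> \<le> (sqrt (real (Suc n)) - sqrt (real n)) * (2 * sqrt (real (Suc n)))"
    using a by (intro mult_left_mono) auto
  finally have "1 / sqrt (real (Suc n)) \<le> 2 * (sqrt (real (Suc n)) - sqrt (real n))"
    using a(2) by (simp add: field_simps)
  then show ?case using Suc.IH by simp
qed simp

lemma budget_sum:
  assumes "0 \<le> x"
  shows "(\<Sum>j=1..n. real (budget x j)) \<le> 200 * n + 44 * sqrt (x * n)"
proof -
  have "(\<Sum>j=1..n. real (budget x j)) \<le> (\<Sum>j=1..n. 200 + 22 * sqrt x * (1 / sqrt (real j)))"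
    using budget_props(3)[OF _ assms] by (intro sum_mono) (auto simp: real_sqrt_divide)
  also have "\<dots> = 200 * n + 22 * sqrt x * (\<Sum>j=1..n. 1 / sqrt (real j))"
    by (simp add: sum.distrib sum_distrib_left)
  also have "\<dots> \<le> 200 * n + 22 * sqrt x * (2 * sqrt (real n))"
    using sum_inverse_sqrt[of n] assms by (intro add_mono mult_left_mono) auto
  finally show ?thesis by (simp add: real_sqrt_mult)
qed

section \<open>All merging steps within the budget\<close>

context sgraph
begin

text \<open>A path with fewer than \<open>M\<close> vertices is simply dropped. Otherwise all
  protected tails have \<open>M\<close> vertices, and \<open>T0\<close> or a part of it meets the
  condition of \<open>merge\<close>.\<close>

lemma good_step:
  assumes g: "good \<delta> W" and \<delta>: "0 < \<delta>" "\<delta> \<le> 1 / 10000" and big: "10000 \<le> \<delta> * real (card W)"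
    and F: "forest F" "cov F \<subseteq> W" and k: "card F = k" "2 \<le> k" "real k \<le> 5 * \<delta> * real (card W)"
  shows "\<exists>F'. forest F' \<and> cov F' \<subseteq> W \<and> card F' = k - 1 \<and> fsz F \<le> fsz F' + 4 * budget (\<delta> * real (card W)) k"
proof -
  let ?N = "real (card W)"
  let ?x = "\<delta> * ?N"
  define M where "M = budget ?x k"
  have x0: "0 \<le> ?x" using big by linarith
  have finF: "finite F" using F(1) by (rule forest_finite)
  obtain i where i: "M = 200 * 2 ^ i" using budget_props(2)[of k ?x] k x0 M_def by auto
  have M200: "200 \<le> M" using i by simp
  have Msq: "real k * real M ^ 2 \<ge> 120 * ?x" using budget_props(1)[of k ?x] k x0 M_def by simp
  show ?thesis
  proof (cases "\<exists>p\<in>F. length p < M")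
    case True
    then obtain p where p: "p \<in> F" "length p < M" by blast
    have "fsz F = length p + fsz (F - {p})" unfolding fsz_def by (rule sum.remove[OF finF p(1)])
    moreover have "forest (F - {p})" using F(1) forest_subset by blast
    moreover have "cov (F - {p}) \<subseteq> W" using F(2) unfolding cov_def by blast
    moreover have "card (F - {p}) = k - 1" using p(1) finF k by simp
    ultimately show ?thesis using p(2) unfolding M_def[symmetric] by (intro exI[of _ "F - {p}"]) simp
  next
    case False
    then have long: "\<And>p. p \<in> F \<Longrightarrow> M \<le> length p" by force
    obtain P0 where P0: "P0 \<in> F" using k by fastforce
    define Q0 where "Q0 = F - {P0}"
    define T0 where "T0 = (\<Union>q\<in>Q0. set (drop (length q - M) q))"
    have FQ: "insert P0 Q0 = F" using P0 by (auto simp: Q0_def)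
    have cQ: "card Q0 = k - 1" using P0 finF k by (simp add: Q0_def)
    interpret rotgood adj W P0 Q0 T0 \<delta> M
    proof unfold_locales
      show "finite W" by (rule good_finite[OF g])
      show "forest (insert P0 Q0)" "cov (insert P0 Q0) \<subseteq> W" using F FQ by simp_all
      show "P0 \<notin> Q0" by (simp add: Q0_def)
      show "real (card Q0) + 1 \<le> 5 * \<delta> * real (card W)" using cQ k by simp
      show "set (drop (length q - M) q) \<subseteq> T0" if "q \<in> Q0" for q using that by (auto simp: T0_def)
    qed fact+
    have cT: "card T0 = (k - 1) * M"
    proof -
      have "card T0 = (\<Sum>q\<in>Q0. card (set (drop (length q - M) q)))"
        unfolding T0_def
      proof (rule card_UN_disjoint)
        show "finite Q0" using finF by (simp add: Q0_def)
        have "set (drop (length p - M) p) \<inter> set (drop (length q - M) q) = {}" if "p \<in> Q0" "q \<in> Q0" "p \<noteq> q" for p q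
          using forest_disj[OF F(1), of p q] that set_drop_subset[of "length p - M" p] set_drop_subset[of "length q - M" q]
          unfolding Q0_def by blast
        then show "\<forall>p\<in>Q0. \<forall>q\<in>Q0. p \<noteq> q \<longrightarrow> set (drop (length p - M) p) \<inter> set (drop (length q - M) q) = {}"
          by blast
      qed simp
      also have "\<dots> = (\<Sum>q\<in>Q0. M)"
      proof (rule sum.cong)
        fix q assume "q \<in> Q0"
        then have "q \<in> F" by (simp add: Q0_def)
        then have "distinct q" "M \<le> length q" using forest_pth[OF F(1)] long by (auto simp: pth_def)
        then show "card (set (drop (length q - M) q)) = M" by (simp add: distinct_card)
      qed simp
      finally show ?thesis using cQ by simp
    qed
    have TW: "T0 \<subseteq> W"
    proof
      fix t assume "t \<in> T0"
      then obtain q where "q \<in> Q0" "t \<in> set q" unfolding T0_def by (auto dest: in_set_dropD)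
      then show "t \<in> W" using F(2) by (auto simp: Q0_def cov_def)
    qed
    have k1: "real (k - 1) \<ge> real k / 2" using k by linarith
    have Npos: "0 < ?N" using big \<delta> by (metis mult_eq_0_iff not_numeral_le_zero of_nat_0_le_iff order_less_le)
    have dN: "?x \<le> ?N / 10000" by (rule \<delta>N)
    have card2: "2 * real (card Q0 + 2) = 2 * real k + 2" using cQ k by simp
    have "\<exists>U. U \<subseteq> T0 \<inter> W \<and> real (card U) \<le> \<delta> * ?N / 2 \<and> card U / (10 * \<delta>) > 3 * ?N / M + 2 * (card Q0 + 2)"
    proof (cases "real (card T0) \<le> \<delta> * ?N / 2")
      case True
      have "card T0 / (10 * \<delta>) = real (k - 1) * M / (10 * \<delta>)" using cT by simp
      also have "\<dots> \<ge> (real k / 2) * M / (10 * \<delta>)"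
        using k1 \<delta> by (intro divide_right_mono mult_right_mono) auto
      \<comment> \<open>Half of the expansion pays for \<open>3 * ?N / M\<close>, by the choice of
        the budget; the other half pays for the number of paths, by
        \<open>200 \<le> M\<close>.\<close>
      finally have 1: "card T0 / (10 * \<delta>) \<ge> real k * M / (40 * \<delta>) + real k * M / (40 * \<delta>)" by (simp add: mult.commute)
      have 2: "real k * M / (40 * \<delta>) \<ge> 3 * ?N / M"
        using Msq M200 \<delta> by (simp add: field_simps power2_eq_square)
      have "real k * M / (40 * \<delta>) \<ge> real k * 200 / (40 * \<delta>)"
        using M200 \<delta> by (intro divide_right_mono mult_left_mono) auto
      moreover have "real k * 200 / (40 * \<delta>) = real k * (5 / \<delta>)" by simp
      moreover have "real k * (5 / \<delta>) \<ge> real k * 5"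
        using \<delta> by (intro mult_left_mono) (auto simp: field_simps)
      ultimately have 3: "real k * M / (40 * \<delta>) > 2 * (card Q0 + 2)" using card2 k by simp
      have "card T0 / (10 * \<delta>) > 3 * ?N / M + 2 * (card Q0 + 2)" using 1 2 3 by argo
      then show ?thesis using True TW by (intro exI[of _ T0] conjI) simp_all
    next
      case False
      \<comment> \<open>Too many tail vertices for the small-set clause; but about
        \<open>?x / 2\<close> of them already see \<open>?N / 40\<close> vertices, more than
        \<open>3 * ?N / 200\<close> and the path terms.\<close>
      then have "nat \<lfloor>?x / 2\<rfloor> \<le> card T0" by linarith
      then obtain U where U: "U \<subseteq> T0" "card U = nat \<lfloor>?x / 2\<rfloor>" by (meson obtain_subset_with_card_n)
      have u: "real (card U) \<le> ?x / 2" "real (card U) \<ge> ?x / 4" using U(2) big by linarith+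
      have "card U / (10 * \<delta>) \<ge> (?x / 4) / (10 * \<delta>)" using u \<delta> by (intro divide_right_mono) auto
      moreover have "(?x / 4) / (10 * \<delta>) = ?N / 40" using \<delta> by simp
      moreover have "3 * ?N / M \<le> 3 * ?N / 200" using M200 by (intro divide_left_mono) auto
      ultimately have "card U / (10 * \<delta>) > 3 * ?N / M + 2 * (card Q0 + 2)"
        using card2 k(3) dN big Npos by linarith
      then show ?thesis using U u TW by (intro exI[of _ U]) auto
    qed
    then obtain U where "U \<subseteq> T0 \<inter> W" "real (card U) \<le> \<delta> * ?N / 2" "card U / (10 * \<delta>) > 3 * ?N / M + 2 * (card Q0 + 2)"
      by blast
    from merge[OF i T0_def this] show ?thesis unfolding FQ cQ M_def[symmetric] .
  qed
qed

lemma good_path: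
  assumes g: "good \<delta> W" and \<delta>: "0 < \<delta>" "\<delta> \<le> 1 / 10000" and big: "10000 \<le> \<delta> * real (card W)"
  shows "forest F \<Longrightarrow> cov F \<subseteq> W \<Longrightarrow> card F = Suc k \<Longrightarrow> real (Suc k) \<le> 5 * \<delta> * real (card W) \<Longrightarrow>
    \<exists>p. pth p \<and> set p \<subseteq> W \<and> real (fsz F) \<le> length p + 4 * (\<Sum>j=1..Suc k. real (budget (\<delta> * real (card W)) j))"
proof (induction k arbitrary: F)
  case 0
  then obtain p where "F = {p}" by (metis One_nat_def card_1_singletonE)
  then show ?case using 0 by (intro exI[of _ p]) (auto simp: fsz_def)
next
  case (Suc k)
  from good_step[OF g \<delta> big Suc.prems(1,2,3)] Suc.prems(4)
  obtain F' where F': "forest F'" "cov F' \<subseteq> W" "card F' = Suc k"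
    "fsz F \<le> fsz F' + 4 * budget (\<delta> * real (card W)) (Suc (Suc k))" by auto
  from Suc.IH[OF F'(1,2,3)] Suc.prems(4)
  obtain p where p: "pth p" "set p \<subseteq> W"
    "real (fsz F') \<le> length p + 4 * (\<Sum>j=1..Suc k. real (budget (\<delta> * real (card W)) j))" by auto
  have "real (fsz F) \<le> real (fsz F') + 4 * real (budget (\<delta> * real (card W)) (Suc (Suc k)))"
    using F'(4) by linarith
  then show ?case using p by (intro exI[of _ p]) simp
qed

text \<open>Put \<open>x = \<delta> * card W\<close>. There are at most \<open>2 * x + 7\<close>
  paths; by \<open>budget_sum\<close> merging them loses at most \<open>2000 * x\<close> vertices,
  and closing the last one at most \<open>x\<close> more.\<close>

theorem near_spanning_cycle:
  assumes g: "good \<delta> W" and \<delta>: "0 < \<delta>" "\<delta> \<le> 1 / 10000" and big: "10000 \<le> \<delta> * real (card W)"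
  shows "\<exists>c. cyc c \<and> set c \<subseteq> W \<and> real (length c) \<ge> (1 - 3000 * \<delta>) * card W"
proof -
  let ?N = "real (card W)"
  let ?x = "\<delta> * ?N"
  have x0: "0 \<le> ?x" using big by linarith
  have Npos: "0 < ?N" using big \<delta> by (metis mult_eq_0_iff not_numeral_le_zero of_nat_0_le_iff order_less_le)
  have dN: "?x \<le> ?N / 10000" using mult_right_mono[OF \<delta>(2), of ?N] by simp
  have sq: "sqrt ?x \<le> ?x / 100"
  proof -
    have "?x * 10000 \<le> ?x * ?x" using big by (intro mult_left_mono) auto
    then have "?x \<le> (?x / 100) ^ 2" by (simp add: power2_eq_square)
    then show ?thesis using x0 by (intro real_le_lsqrt) auto
  qed
  obtain F where F: "forest F" "cov F = W" "real (card F) \<le> 2 * ?x + 7"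
    using path_cover[OF g \<delta>(1)] by (auto simp: mult.assoc)
  have fF: "fsz F = card W" using forest_card_cov[OF F(1)] F(2) by simp
  have "F \<noteq> {}" using fF Npos by (auto simp: fsz_def)
  then obtain k where k: "card F = Suc k" using forest_finite[OF F(1)] by (cases "card F") auto
  obtain p where p: "pth p" "set p \<subseteq> W" "?N \<le> length p + 4 * (\<Sum>j=1..Suc k. real (budget ?x j))"
    using good_path[OF g \<delta> big F(1) _ k] F(2,3) k big fF by auto
  define B where "B = (\<Sum>j=1..Suc k. real (budget ?x j))"
  have "B \<le> 200 * real (Suc k) + 44 * sqrt (?x * real (Suc k))"
    using budget_sum[OF x0, of "Suc k"] unfolding B_def .
  moreover have "sqrt (?x * real (Suc k)) \<le> 2 * ?x"
  proof -
    have "?x * real (Suc k) \<le> ?x * (4 * ?x)" using F(3) k big by (intro mult_left_mono) auto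
    then have "?x * real (Suc k) \<le> (2 * ?x) ^ 2" by (simp add: power2_eq_square)
    then show ?thesis using x0 by (intro real_le_lsqrt) auto
  qed
  moreover have "real (Suc k) \<le> 2 * ?x + 7" using F(3) k by simp
  moreover have "4 * b \<le> 800 * (2 * y + 7) + 176 * (2 * y)" if "b \<le> 200 * r + 44 * s" "s \<le> 2 * y" "r \<le> 2 * y + 7"
    for b r s y :: real using that by argo
  ultimately have "4 * B \<le> 800 * (2 * ?x + 7) + 176 * (2 * ?x)" by blast
  moreover have "l \<ge> n - 2000 * y" if "4 * b \<le> 800 * (2 * y + 7) + 176 * (2 * y)" "n \<le> l + 4 * b" "10000 \<le> y"
    for b l n y :: real using that by argo
  ultimately have lp: "real (length p) \<ge> ?N - 2000 * ?x" using p(3)[folded B_def] big by blast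
  define M where "M = budget ?x 1"
  obtain i where i: "M = 200 * 2 ^ i" using budget_props(2)[of 1 ?x] x0 M_def by auto
  have M200: "200 \<le> M" using i by simp
  have Msq: "real M ^ 2 \<ge> 120 * ?x" using budget_props(1)[of 1 ?x] x0 M_def by simp
  have Mle: "real M \<le> 200 + 22 * (?x / 100)"
    using budget_props(3)[of 1 ?x] x0 sq M_def by simp
  have M4: "4 * real M + 3 \<le> ?x" using Mle big by linarith
  have lenp: "4 * M + 3 \<le> length p"
  proof -
    have "?x \<le> real (length p)" using lp dN Npos by linarith
    then have "real (4 * M + 3) \<le> real (length p)" using M4 by linarith
    then show ?thesis by linarith
  qed
  interpret rotgood adj W p "{}" "set (take M p)" \<delta> M
    by unfold_locales (use good_finite[OF g] p g \<delta> big M200 in auto)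
  have cT: "card (set (take M p)) = M" using lenp p(1) by (simp add: distinct_card pth_def)
  have U1: "set (take M p) \<subseteq> set (take M p) \<inter> W" using p(2) set_take_subset[of M p] by blast
  have U2: "real (card (set (take M p))) \<le> \<delta> * ?N / 2" using cT M4 by linarith
  have "real M / (10 * \<delta>) > 3 * ?N / M + 2 * real (card {} + 2)"
  proof -
    have "real M ^ 2 \<ge> 60 * ?x" using Msq x0 by argo
    then have "real M / (20 * \<delta>) \<ge> 3 * ?N / M" using M200 \<delta> by (simp add: field_simps power2_eq_square)
    moreover have "real M / (20 * \<delta>) > 4"
      using M200 \<delta> by (simp add: field_simps)
    ultimately show ?thesis by simp
  qed
  then have U3: "real (card (set (take M p))) / (10 * \<delta>) > 3 * ?N / M + 2 * (card {} + 2)" using cT by simp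
  obtain c where c: "cyc c" "set c \<subseteq> W" "length p \<le> length c + 4 * M"
    using close[OF i refl refl lenp U1 U2 U3] by blast
  have "real (length c) \<ge> ?N - 3000 * ?x" using c(3) lp M4 x0 by linarith
  then show ?thesis using c by (intro exI[of _ c]) (simp add: algebra_simps)
qed

section \<open>Expansion factor just below one\<close>

definition additive :: "real \<Rightarrow> 'a set \<Rightarrow> bool" where
  "additive \<delta> W \<longleftrightarrow> finite W \<and>
    (\<forall>U. U \<subseteq> W \<and> 2 * card U \<le> card W \<longrightarrow> real (card U) - \<delta> * real (card W) \<le> card (nb W U))"

lemma additive_remove:
  assumes a: "additive \<delta> W" and R: "R \<subseteq> W" and \<delta>': "\<delta> * real (card W) + card R \<le> \<delta>' * real (card (W - R))"
  shows "additive \<delta>' (W - R)"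
  unfolding additive_def
proof (intro conjI allI impI)
  have fin: "finite W" using a by (simp add: additive_def)
  then show "finite (W - R)" by simp
  fix U assume U: "U \<subseteq> W - R \<and> 2 * card U \<le> card (W - R)"
  have "card (W - R) \<le> card W" using fin by (intro card_mono) auto
  then have "real (card U) - \<delta> * real (card W) \<le> card (nb W U)" using a U unfolding additive_def by auto
  moreover have "nb W U \<subseteq> nb (W - R) U \<union> R" by (auto simp: nb_def)
  then have "card (nb W U) \<le> card (nb (W - R) U \<union> R)"
    using fin finite_nb[of "W - R" U] finite_subset[OF R fin] by (intro card_mono) auto
  then have "card (nb W U) \<le> card (nb (W - R) U) + card R" using card_Un_le[of "nb (W - R) U" R] by linarith
  ultimately show "real (card U) - \<delta>' * real (card (W - R)) \<le> card (nb (W - R) U)" using \<delta>' by linarith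
qed

lemma nb_Un_subset: "nb W (B \<union> U) \<subseteq> nb W B \<union> nb (W - B) U"
  by (auto simp: nb_def)

text \<open>Removing a largest set of poor expansion: small sets of the rest expand by a factor of order \<open>1 / \<delta>\<close>,
  because a medium set sees half of the graph.\<close>

lemma cleaning:
  assumes a: "additive \<delta> W" and \<delta>: "0 < \<delta>" "\<delta> \<le> 1 / 100" and big: "100 \<le> \<delta> * real (card W)"
  shows "\<exists>B \<subseteq> W. real (card B) \<le> \<delta> * real (card W) + 2 \<and> good (4 * \<delta>) (W - B)"
proof -
  let ?N = "real (card W)"
  have fin: "finite W" using a by (simp add: additive_def)
  have ex: "real (card U) - \<delta> * real (card W) \<le> card (nb W U)" if "U \<subseteq> W" "2 * card U \<le> card W" for U
    using a that by (simp add: additive_def)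
  \<comment> \<open>The cap \<open>4 * \<delta> * ?N\<close> is generous on purpose: a maximal
    \<open>B\<close> turns out to have at most \<open>\<delta> * ?N + 2\<close> elements, so its
    union with a small \<open>U\<close> is still below the cap and must violate the other
    condition.\<close>
  define bad where "bad B \<longleftrightarrow> B \<subseteq> W \<and> real (card B) \<le> 4 * \<delta> * ?N \<and> real (card (nb W B)) \<le> card B / (16 * \<delta>)" for B
  have b0: "bad {}" using \<delta> by (simp add: bad_def nb_def)
  have "\<forall>B. bad B \<longrightarrow> card B < Suc (card W)" using fin by (auto simp: bad_def less_Suc_eq_le card_mono)
  from ex_has_greatest_nat[of bad, OF b0 this]
  obtain B where B: "bad B" and mx: "\<And>B'. bad B' \<Longrightarrow> card B' \<le> card B" by blast
  have BW: "B \<subseteq> W" using B by (simp add: bad_def)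
  have finB: "finite B" using BW fin by (rule finite_subset)
  \<comment> \<open>Otherwise \<open>B\<close> and its neighbours would fill half of
    \<open>W\<close>, but poor expansion leaves them only
    \<open>4 * \<delta> * ?N + ?N / 4\<close>.\<close>
  have Bs: "real (card B) \<le> \<delta> * ?N + 2"
  proof (rule ccontr)
    assume "\<not> ?thesis"
    then have "real (card (B \<union> nb W B)) \<ge> ?N / 2" using additive_mid[OF fin ex BW] by simp
    moreover have "real (card (B \<union> nb W B)) \<le> card B + card (nb W B)" using card_Un_le[of B "nb W B"] by linarith
    ultimately have "?N / 2 \<le> card B + card B / (16 * \<delta>)" using B unfolding bad_def by linarith
    also have "\<dots> \<le> 4 * \<delta> * ?N + 4 * \<delta> * ?N / (16 * \<delta>)"
      using B \<delta> unfolding bad_def by (intro add_mono divide_right_mono) auto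
    also have "4 * \<delta> * ?N / (16 * \<delta>) = ?N / 4" using \<delta> by simp
    also have "4 * \<delta> * ?N \<le> 4 * (1 / 100) * ?N" using \<delta> by (intro mult_right_mono) auto
    finally have "?N \<le> 0" by simp
    moreover have "0 < \<delta> * ?N" using big by linarith
    ultimately show False using \<delta> by (simp add: zero_less_mult_iff)
  qed
  have Ndiff: "card (W - B) = card W - card B" using finB BW by (simp add: card_Diff_subset)
  have cBW: "card B \<le> card W" using fin BW by (rule card_mono)
  have N': "real (card (W - B)) = ?N - card B" using Ndiff cBW by simp
  have dd: "\<delta> * (\<delta> * ?N) \<le> (1 / 100) * (\<delta> * ?N)" using \<delta> big by (intro mult_right_mono) auto
  have dN': "\<delta> * real (card (W - B)) \<ge> \<delta> * ?N - \<delta> * (\<delta> * ?N + 2)"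
  proof -
    have "\<delta> * real (card B) \<le> \<delta> * (\<delta> * ?N + 2)" using Bs \<delta> by (intro mult_left_mono) auto
    then show ?thesis unfolding N' by (simp add: algebra_simps)
  qed
  have "\<delta> * (\<delta> * ?N + 2) \<le> (1 / 100) * (\<delta> * ?N) + 2 / 100"
    unfolding distrib_left using dd \<delta> by linarith
  then have dN2: "\<delta> * real (card (W - B)) \<ge> (9 / 10) * (\<delta> * ?N)" using dN' big by linarith
  have "additive (4 * \<delta>) (W - B)"
  proof (rule additive_remove[OF a BW])
    have "\<delta> * ?N + card B \<le> 2 * (\<delta> * ?N) + 2" using Bs by linarith
    also have "\<dots> \<le> 4 * (\<delta> * real (card (W - B)))" using dN2 big by linarith
    finally show "\<delta> * ?N + card B \<le> 4 * \<delta> * real (card (W - B))" by simp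
  qed
  moreover have "card U / (10 * (4 * \<delta>)) \<le> card (nb (W - B) U)"
    if U: "U \<subseteq> W - B" "real (card U) \<le> 4 * \<delta> * real (card (W - B)) / 2" for U
  proof (cases "U = {}")
    case True
    then show ?thesis by simp
  next
    case False
    have finU: "finite U" using U fin by (meson finite_Diff finite_subset)
    have "\<delta> * real (card (W - B)) \<le> \<delta> * ?N" using N' \<delta> by (intro mult_left_mono) auto
    then have "real (card B + card U) \<le> 4 * (\<delta> * ?N)" using U(2) Bs big by simp
    moreover have cU: "card (B \<union> U) = card B + card U" using U(1) finU finB by (intro card_Un_disjoint) auto
    moreover have "0 < card U" using False finU by (simp add: card_gt_0_iff)
    ultimately have "\<not> bad (B \<union> U) \<and> B \<union> U \<subseteq> W \<and> real (card (B \<union> U)) \<le> 4 * \<delta> * ?N"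
      using mx[of "B \<union> U"] U(1) BW by auto
    then have "card (B \<union> U) / (16 * \<delta>) < card (nb W (B \<union> U))" unfolding bad_def by linarith
    also have "card (nb W (B \<union> U)) \<le> card (nb W B \<union> nb (W - B) U)"
      using fin finite_nb by (intro card_mono nb_Un_subset) auto
    also have "\<dots> \<le> card (nb W B) + card (nb (W - B) U)" by (rule card_Un_le)
    finally have "card (B \<union> U) / (16 * \<delta>) < card (nb W B) + card (nb (W - B) U)" by simp
    moreover have "card (B \<union> U) / (16 * \<delta>) = card B / (16 * \<delta>) + card U / (16 * \<delta>)"
      unfolding cU by (simp add: add_divide_distrib)
    ultimately have "card U / (16 * \<delta>) \<le> card (nb (W - B) U)" using B unfolding bad_def by linarith
    moreover have "card U / (10 * (4 * \<delta>)) \<le> card U / (16 * \<delta>)" using \<delta> by (intro divide_left_mono) auto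
    ultimately show ?thesis by linarith
  qed
  ultimately have "good (4 * \<delta>) (W - B)" unfolding good_def additive_def by blast
  then show ?thesis using BW Bs by blast
qed

text \<open>Here \<open>h\<close> counts vertices, not edges.\<close>

definition broom :: "'a set \<Rightarrow> 'a \<Rightarrow> 'a set \<Rightarrow> nat \<Rightarrow> bool" where
  "broom T r A h \<longleftrightarrow> (\<forall>a\<in>A. \<exists>p. pth p \<and> set p \<subseteq> T \<and> hd p = r \<and> last p = a \<and> length p = h)"

lemma broom_extend:
  assumes "broom T r A h" "A' \<subseteq> nb W A" "A' \<inter> T = {}" "T \<subseteq> T'" "A' \<subseteq> T'"
  shows "broom T' r A' (Suc h)"
  unfolding broom_def
proof
  fix a' assume a': "a' \<in> A'"
  then obtain a where a: "a \<in> A" "adj a a'" using assms(2) by (auto simp: nb_def)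
  then obtain p where p: "pth p" "set p \<subseteq> T" "hd p = r" "last p = a" "length p = h"
    using assms(1) unfolding broom_def by blast
  have "p \<noteq> []" by (rule pth_ne[OF p(1)])
  then have "pth (p @ [a'])" using p a a' assms(3) by (subst pth_append) auto
  then show "\<exists>p. pth p \<and> set p \<subseteq> T' \<and> hd p = r \<and> last p = a' \<and> length p = Suc h"
    using p a' assms(4,5) \<open>p \<noteq> []\<close> by (intro exI[of _ "p @ [a']"]) auto
qed

text \<open>A layer of \<open>s\<close> leaves has at least \<open>100 * s\<close> neighbours, while
  the two trees occupy at most \<open>4 * s\<close> vertices and the other new layer at most
  \<open>40 * s\<close>.\<close>

lemma two_brooms_step:
  assumes g: "good \<delta> W" and \<delta>: "0 < \<delta>" "\<delta> \<le> 1 / 1000"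
    and T: "T1 \<subseteq> W" "T2 \<subseteq> W" "T1 \<inter> T2 = {}" and A: "A1 \<subseteq> T1" "A2 \<subseteq> T2" "card A1 = s" "card A2 = s"
    and c: "card T1 \<le> 2 * s" "card T2 \<le> 2 * s" and s: "real s \<le> \<delta> * real (card W) / 2"
    and b: "broom T1 r1 A1 h" "broom T2 r2 A2 h" and m: "m \<le> 40"
  obtains A1' A2' where "A1' \<subseteq> W" "A2' \<subseteq> W" "card A1' = m * s" "card A2' = m * s"
    "(T1 \<union> A1') \<inter> (T2 \<union> A2') = {}" "broom (T1 \<union> A1') r1 A1' (Suc h)" "broom (T2 \<union> A2') r2 A2' (Suc h)"
    "card (T1 \<union> A1') \<le> (m + 2) * s" "card (T2 \<union> A2') \<le> (m + 2) * s"
proof -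
  have fin: "finite W" by (rule good_finite[OF g])
  have finT: "finite T1" "finite T2" by (rule finite_subset[OF T(1) fin], rule finite_subset[OF T(2) fin])
  have nbig: "100 * s \<le> card (nb W A)" if "A \<subseteq> W" "card A = s" for A
  proof -
    have "s / (10 * \<delta>) \<le> card (nb W A)" using good_small[OF g that(1)] that(2) s by simp
    moreover have "real s * 100 \<le> s / (10 * \<delta>)"
    proof -
      have "100 \<le> 1 / (10 * \<delta>)" using \<delta> by (simp add: field_simps)
      then have "real s * 100 \<le> real s * (1 / (10 * \<delta>))" by (rule mult_left_mono) simp
      then show ?thesis by simp
    qed
    ultimately have "real (100 * s) \<le> real (card (nb W A))" by simp
    then show ?thesis by (simp only: of_nat_le_iff)
  qed
  have n100: "100 * s \<le> card (nb W A1)" "100 * s \<le> card (nb W A2)"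
    by (rule nbig; use A T in blast)+
  have ms: "m * s \<le> 40 * s" using m by (rule mult_le_mono1)
  have "card (nb W A1) - card (T1 \<union> T2) \<le> card (nb W A1 - (T1 \<union> T2))"
    using finT by (intro diff_card_le_card_Diff) auto
  moreover have "card (T1 \<union> T2) \<le> 4 * s" using card_Un_le[of T1 T2] c by linarith
  ultimately have "m * s \<le> card (nb W A1 - (T1 \<union> T2))"
    using n100 ms by linarith
  then obtain A1' where A1': "A1' \<subseteq> nb W A1 - (T1 \<union> T2)" "card A1' = m * s" by (meson obtain_subset_with_card_n)
  have A1W: "A1' \<subseteq> W" using A1'(1) nb_subset by blast
  have finA1: "finite A1'" using A1W fin finite_subset by auto
  have "card (nb W A2) - card (T1 \<union> T2 \<union> A1') \<le> card (nb W A2 - (T1 \<union> T2 \<union> A1'))"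
    using finT finA1 by (intro diff_card_le_card_Diff) auto
  moreover have "card (T1 \<union> T2 \<union> A1') \<le> 4 * s + m * s"
    using card_Un_le[of "T1 \<union> T2" A1'] card_Un_le[of T1 T2] c A1'(2) by linarith
  ultimately have "m * s \<le> card (nb W A2 - (T1 \<union> T2 \<union> A1'))"
    using n100 ms by linarith
  then obtain A2' where A2': "A2' \<subseteq> nb W A2 - (T1 \<union> T2 \<union> A1')" "card A2' = m * s" by (meson obtain_subset_with_card_n)
  show thesis
  proof (rule that[OF A1W _ A1'(2) A2'(2)])
    show "A2' \<subseteq> W" using A2'(1) nb_subset by blast
    show "(T1 \<union> A1') \<inter> (T2 \<union> A2') = {}" using A1'(1) A2'(1) T(3) by blast
    show "broom (T1 \<union> A1') r1 A1' (Suc h)" by (rule broom_extend[OF b(1), of _ W]) (use A1' in auto)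
    show "broom (T2 \<union> A2') r2 A2' (Suc h)" by (rule broom_extend[OF b(2), of _ W]) (use A2' in auto)
    show "card (T1 \<union> A1') \<le> (m + 2) * s" using card_Un_le[of T1 A1'] A1'(2) c(1) by (simp add: algebra_simps)
    show "card (T2 \<union> A2') \<le> (m + 2) * s" using card_Un_le[of T2 A2'] A2'(2) c(2) by (simp add: algebra_simps)
  qed
qed

text \<open>The leaf layers quadruple up to the last power \<open>4 ^ i\<close> within
  \<open>\<delta> * card W / 2\<close>. A final step by the factor 16 lifts the leaf sets above the
  threshold of \<open>good_mid\<close>, with trees of at most \<open>18 * 4 ^ i\<close> vertices.
  Geometric growth makes \<open>h\<close> logarithmic.\<close>

lemma two_brooms:
  assumes g: "good \<delta> W" and \<delta>: "0 < \<delta>" "\<delta> \<le> 1 / 1000" and big: "100 \<le> \<delta> * real (card W)"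
  shows "\<exists>T1 T2 A1 A2 r1 r2 h. T1 \<subseteq> W \<and> T2 \<subseteq> W \<and> T1 \<inter> T2 = {} \<and> A1 \<subseteq> T1 \<and> A2 \<subseteq> T2 \<and> adj r1 r2 \<and>
    broom T1 r1 A1 h \<and> broom T2 r2 A2 h \<and> real (card A1) > \<delta> * real (card W) + 2 \<and> real (card A2) > \<delta> * real (card W) + 2 \<and>
    real (card T1) \<le> 9 * \<delta> * real (card W) \<and> real (card T2) \<le> 9 * \<delta> * real (card W) \<and> 2 ^ h \<le> 16 * card W"
proof -
  let ?x = "\<delta> * real (card W)"
  have lev: "real (4 ^ i) \<le> 2 * ?x \<Longrightarrow> \<exists>T1 T2 A1 A2 r1 r2. T1 \<subseteq> W \<and> T2 \<subseteq> W \<and> T1 \<inter> T2 = {} \<and> A1 \<subseteq> T1 \<and> A2 \<subseteq> T2 \<and> adj r1 r2 \<and>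
    card A1 = 4 ^ i \<and> card A2 = 4 ^ i \<and> card T1 \<le> 2 * 4 ^ i \<and> card T2 \<le> 2 * 4 ^ i \<and>
    broom T1 r1 A1 (Suc i) \<and> broom T2 r2 A2 (Suc i)" for i
  proof (induction i)
    case 0
    have "W \<noteq> {}" using big by auto
    then obtain r1 where r1: "r1 \<in> W" by blast
    have "card {r1} / (10 * \<delta>) \<le> card (nb W {r1})" by (rule good_small[OF g]) (use r1 big in auto)
    then have "0 < card (nb W {r1})" using \<delta> by (cases "card (nb W {r1})") (auto simp: field_simps)
    then obtain r2 where r2: "r2 \<in> nb W {r1}" by (metis card.empty ex_in_conv less_irrefl)
    have "broom {r} r {r} (Suc 0)" for r unfolding broom_def by (auto intro!: exI[of _ "[r]"])
    then show ?case using r1 r2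
      by (intro exI[of _ "{r1}"] exI[of _ "{r2}"] exI[of _ r1] exI[of _ r2]) (auto simp: nb_def)
  next
    case (Suc i)
    have "real (4 ^ i) \<le> ?x / 2" using Suc.prems by simp
    then have le: "real (4 ^ i) \<le> 2 * ?x" "real (4 ^ i) \<le> \<delta> * real (card W) / 2" using big by linarith+
    obtain T1 T2 A1 A2 r1 r2 where t: "T1 \<subseteq> W" "T2 \<subseteq> W" "T1 \<inter> T2 = {}" "A1 \<subseteq> T1" "A2 \<subseteq> T2" and r: "adj r1 r2" and
      c: "card A1 = 4 ^ i" "card A2 = 4 ^ i" "card T1 \<le> 2 * 4 ^ i" "card T2 \<le> 2 * 4 ^ i"
      and b: "broom T1 r1 A1 (Suc i)" "broom T2 r2 A2 (Suc i)" using Suc.IH[OF le(1)] by blast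
    obtain A1' A2' where n: "A1' \<subseteq> W" "A2' \<subseteq> W" "card A1' = 4 * 4 ^ i" "card A2' = 4 * 4 ^ i"
      "(T1 \<union> A1') \<inter> (T2 \<union> A2') = {}" "broom (T1 \<union> A1') r1 A1' (Suc (Suc i))" "broom (T2 \<union> A2') r2 A2' (Suc (Suc i))"
      "card (T1 \<union> A1') \<le> (4 + 2) * 4 ^ i" "card (T2 \<union> A2') \<le> (4 + 2) * 4 ^ i"
      by (rule two_brooms_step[OF g \<delta> t c le(2) b, of 4]) simp_all
    show ?case
      by (rule exI[of _ "T1 \<union> A1'"], rule exI[of _ "T2 \<union> A2'"], rule exI[of _ A1'], rule exI[of _ A2'],
          rule exI[of _ r1], rule exI[of _ r2]) (use t r n in auto)
  qed
  have "\<exists>i. real (4 ^ i) \<le> ?x / 2 \<and> ?x / 2 < real (4 ^ Suc i)"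
  proof -
    obtain j where j: "?x / 2 < 4 ^ j" using real_arch_pow[of 4 "?x / 2"] by auto
    define k where "k = (LEAST j. ?x / 2 < 4 ^ j)"
    have k: "?x / 2 < 4 ^ k" unfolding k_def using j by (rule LeastI)
    have "k \<noteq> 0" using k big by (cases k) auto
    then obtain i where i: "k = Suc i" by (cases k) auto
    have "\<not> ?x / 2 < 4 ^ i" using i k_def by (metis lessI not_less_Least)
    then show ?thesis using k i by (intro exI[of _ i]) simp
  qed
  then obtain i where i: "real (4 ^ i) \<le> ?x / 2" "?x / 2 < real (4 ^ Suc i)" by blast
  have "real (4 ^ i) \<le> 2 * ?x" using i(1) big by linarith
  from lev[OF this] obtain T1 T2 A1 A2 r1 r2 where t: "T1 \<subseteq> W" "T2 \<subseteq> W" "T1 \<inter> T2 = {}" "A1 \<subseteq> T1" "A2 \<subseteq> T2" and r: "adj r1 r2" and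
      c: "card A1 = 4 ^ i" "card A2 = 4 ^ i" "card T1 \<le> 2 * 4 ^ i" "card T2 \<le> 2 * 4 ^ i"
      and b: "broom T1 r1 A1 (Suc i)" "broom T2 r2 A2 (Suc i)" by blast
  have i': "real (4 ^ i) \<le> \<delta> * real (card W) / 2" using i(1) by simp
  obtain A1' A2' where n: "A1' \<subseteq> W" "A2' \<subseteq> W" "card A1' = 16 * 4 ^ i" "card A2' = 16 * 4 ^ i"
      "(T1 \<union> A1') \<inter> (T2 \<union> A2') = {}" "broom (T1 \<union> A1') r1 A1' (Suc (Suc i))" "broom (T2 \<union> A2') r2 A2' (Suc (Suc i))"
      "card (T1 \<union> A1') \<le> (16 + 2) * 4 ^ i" "card (T2 \<union> A2') \<le> (16 + 2) * 4 ^ i"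
    by (rule two_brooms_step[OF g \<delta> t c i' b, of 16]) simp_all
  have "real (16 * 4 ^ i) > ?x + 2" using i big by simp
  then have A: "real (card A1') > ?x + 2" "real (card A2') > ?x + 2" using n by simp_all
  have "real ((16 + 2) * 4 ^ i) \<le> 9 * ?x" using i by simp
  then have Tc: "real (card (T1 \<union> A1')) \<le> 9 * ?x" "real (card (T2 \<union> A2')) \<le> 9 * ?x"
    using n(8,9) by (meson of_nat_le_iff order_trans)+
  have h: "2 ^ Suc (Suc i) \<le> 16 * card W"
  proof -
    have "(2::nat) ^ i \<le> 4 ^ i" by (intro power_mono) auto
    also have "4 ^ i \<le> card A1'" using n(3) by simp
    also have "\<dots> \<le> card W" using n(1) good_finite[OF g] by (intro card_mono)
    finally show ?thesis by simp
  qed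
  show ?thesis
    by (rule exI[of _ "T1 \<union> A1'"], rule exI[of _ "T2 \<union> A2'"], rule exI[of _ A1'], rule exI[of _ A2'],
        rule exI[of _ r1], rule exI[of _ r2], rule exI[of _ "Suc (Suc i)"])
      (use t r n A Tc h in \<open>auto simp: mult.assoc\<close>)
qed

lemma cyc_rotate1:
  assumes "cyc c"
  shows "cyc (rotate1 c)"
proof -
  obtain x y xs where c: "c = x # y # xs" using assms by (auto simp: cyc_def numeral_3_eq_3 Suc_le_length_iff)
  have p: "pth c" and a: "adj (last c) x" and l: "3 \<le> length c" using assms c by (auto simp: cyc_def)
  have "pth (y # xs)" "adj x y" "x \<notin> set (y # xs)" using p c by (auto simp: pth_def)
  then have "pth ((y # xs) @ [x])" using a c by (subst pth_append) auto
  then show ?thesis using l c \<open>adj x y\<close> by (simp add: cyc_def)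
qed

lemma cyc_rotate: "cyc c \<Longrightarrow> cyc (rotate i c)"
  by (induction i) (simp_all add: cyc_rotate1)

text \<open>Pigeonhole over the rotations of the cycle.\<close>

lemma cyc_distance:
  assumes c: "cyc c" and H: "card (H1 \<inter> set c) + card (H2 \<inter> set c) > length c"
  shows "\<exists>c'. cyc c' \<and> set c' = set c \<and> length c' = length c \<and> c' ! 0 \<in> H1 \<and> c' ! (d mod length c) \<in> H2"
proof -
  let ?L = "length c"
  have dist: "distinct c" and L: "0 < ?L" using c by (auto simp: cyc_def pth_def)
  have idx: "card {i. i < ?L \<and> c ! i \<in> H} = card (H \<inter> set c)" for H
  proof -
    have "bij_betw ((!) c) {i. i < ?L \<and> c ! i \<in> H} (H \<inter> set c)"
      unfolding bij_betw_def
    proof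
      show "inj_on ((!) c) {i. i < ?L \<and> c ! i \<in> H}" using dist by (auto simp: inj_on_def nth_eq_iff_index_eq)
      show "(!) c ` {i. i < ?L \<and> c ! i \<in> H} = H \<inter> set c" by (auto simp: in_set_conv_nth)
    qed
    then show ?thesis by (rule bij_betw_same_card)
  qed
  let ?I1 = "{i. i < ?L \<and> c ! i \<in> H1}" and ?I2 = "{i. i < ?L \<and> c ! i \<in> H2}"
  let ?f = "\<lambda>i. (i + d) mod ?L"
  have key: "i = j" if ij: "j < ?L" "?f i = ?f j" "i \<le> j" for i j
  proof -
    have "?L dvd (j + d) - (i + d)" using ij mod_eq_dvd_iff_nat[of "i + d" "j + d" ?L] by simp
    then have "?L dvd j - i" by simp
    then show ?thesis using ij dvd_imp_le[of ?L "j - i"] by (cases "j - i = 0") auto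
  qed
  have inj: "inj_on ?f ?I1"
  proof (rule inj_onI)
    fix i j assume a: "i \<in> ?I1" "j \<in> ?I1" "?f i = ?f j"
    show "i = j"
    proof (cases "i \<le> j")
      case True
      then show ?thesis using key[of j i] a by simp
    next
      case False
      then show ?thesis using key[of i j] a by simp
    qed
  qed
  have "\<exists>i\<in>?I1. ?f i \<in> ?I2"
  proof (rule ccontr)
    assume n: "\<not> ?thesis"
    have "card (?f ` ?I1 \<union> ?I2) = card (?f ` ?I1) + card ?I2" using n by (intro card_Un_disjoint) auto
    also have "card (?f ` ?I1) = card ?I1" by (rule card_image[OF inj])
    finally have "card (?f ` ?I1 \<union> ?I2) > ?L" using H idx[of H1] idx[of H2] by simp
    moreover have "?f ` ?I1 \<union> ?I2 \<subseteq> {..<?L}" using L by auto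
    then have "card (?f ` ?I1 \<union> ?I2) \<le> ?L" using card_mono[of "{..<?L}"] by fastforce
    ultimately show False by simp
  qed
  then obtain i where i: "i < ?L" "c ! i \<in> H1" "c ! ((i + d) mod ?L) \<in> H2" by auto
  have "rotate i c ! 0 \<in> H1" using i L by (simp add: nth_rotate)
  moreover have "rotate i c ! (d mod ?L) \<in> H2" using i L by (simp add: nth_rotate mod_simps)
  ultimately show ?thesis using cyc_rotate[OF c, of i] by (intro exI[of _ "rotate i c"]) simp
qed

text \<open>The leaves \<open>A1\<close> see a set \<open>G\<close> of almost half of the graph. If a small set \<open>M2\<close> in the second neighbourhood \<open>Lb\<close> sees
  many further vertices, it becomes an additional layer. Otherwise every such \<open>M2\<close> has many neighbours in \<open>G\<close>, so
  most of \<open>Lb\<close> has degree of order \<open>1 / \<delta>\<close> into \<open>G\<close>, and by double counting \<open>O(\<delta> N)\<close> greedily chosen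
  vertices of \<open>G\<close> see a constant fraction of the graph in \<open>Lb\<close>.\<close>

lemma boost:
  assumes g: "good \<delta> W" and \<delta>: "0 < \<delta>" "\<delta> \<le> 1 / 10000" and big: "100 \<le> \<delta> * real (card W)"
    and T: "T1 \<subseteq> W" "T2 \<subseteq> W" "T1 \<inter> T2 = {}" "A1 \<subseteq> T1"
    and cT: "real (card T1) \<le> 9 * \<delta> * real (card W)" "real (card T2) \<le> 9 * \<delta> * real (card W)"
    and cA: "real (card A1) > \<delta> * real (card W) + 2" and br: "broom T1 r A1 h"
  shows "\<exists>T H. T1 \<subseteq> T \<and> T \<subseteq> W \<and> T \<inter> T2 = {} \<and> real (card T) \<le> 20 * \<delta> * real (card W) \<and> H \<subseteq> W - T - T2 \<and>
    real (card H) \<ge> 6 / 10 * real (card W) \<and>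
    (\<forall>x\<in>H. \<exists>p. pth p \<and> set p \<subseteq> T \<and> hd p = r \<and> adj (last p) x \<and> h \<le> length p \<and> length p \<le> h + 2)"
proof -
  define N where "N = real (card W)"
  define x where "x = \<delta> * N"
  have xN: "x \<le> N / 10000" using mult_right_mono[OF \<delta>(2), of N] by (simp add: x_def N_def)
  have x100: "100 \<le> x" using big by (simp add: x_def N_def)
  have fin: "finite W" by (rule good_finite[OF g])
  have finT: "finite T1" "finite T2" by (rule finite_subset[OF T(1) fin], rule finite_subset[OF T(2) fin])
  have cT': "real (card T1) \<le> 9 * x" "real (card T2) \<le> 9 * x" using cT by (simp_all add: x_def N_def mult.assoc)
  define R where "R = T1 \<union> T2"
  have cR: "real (card R) \<le> 18 * x" using card_Un_le[of T1 T2] cT' unfolding R_def by linarith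
  have finR: "finite R" using finT by (simp add: R_def)
  have AW: "A1 \<subseteq> W" using T by blast
  have cA1: "real (card A1) \<le> 9 * x" using card_mono[OF finT(1) T(4)] cT' by linarith
  define G where "G = nb W A1 - R"
  have GW: "G \<subseteq> W" using nb_subset by (auto simp: G_def)
  have finG: "finite G" using GW fin by (rule finite_subset)
  have cG: "real (card G) \<ge> N / 2 - 27 * x"
  proof -
    have "real (card (A1 \<union> nb W A1)) \<ge> N / 2" using good_mid[OF g AW cA] by (simp add: N_def)
    moreover have "card (nb W A1) \<le> card (G \<union> R)"
      using finG finR by (intro card_mono) (auto simp: G_def)
    ultimately show ?thesis using card_Un_le[of A1 "nb W A1"] card_Un_le[of G R] cA1 cR by linarith
  qed
  have hG: "\<exists>p. pth p \<and> set p \<subseteq> T' \<and> hd p = r \<and> adj (last p) y \<and> h \<le> length p \<and> length p \<le> h + 2"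
    if y: "y \<in> G" and T': "T1 \<subseteq> T'" for y T'
  proof -
    obtain a where a: "a \<in> A1" "adj a y" using y by (auto simp: G_def nb_def)
    then obtain p where "pth p" "set p \<subseteq> T1" "hd p = r" "last p = a" "length p = h"
      using br unfolding broom_def by blast
    then show ?thesis using a T' by (intro exI[of _ p]) auto
  qed
  show ?thesis
  proof (cases "real (card G) \<ge> 6 / 10 * N")
    case True
    have "T1 \<subseteq> T1" "T1 \<subseteq> W" "T1 \<inter> T2 = {}" using T by auto
    moreover have "real (card T1) \<le> 20 * \<delta> * real (card W)" using cT' x100 by (simp add: x_def N_def)
    moreover have "G \<subseteq> W - T1 - T2" using GW by (auto simp: G_def R_def)
    moreover have "6 / 10 * real (card W) \<le> real (card G)" using True by (simp add: N_def)
    moreover have "\<forall>y\<in>G. \<exists>p. pth p \<and> set p \<subseteq> T1 \<and> hd p = r \<and> adj (last p) y \<and> h \<le> length p \<and> length p \<le> h + 2"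
      using hG[of _ T1] by simp
    ultimately show ?thesis by (intro exI[of _ T1] exI[of _ G] conjI)
  next
    case Gs: False
    define La where "La = W - R - G"
    define Lb where "Lb = La \<inter> nb W G"
    have finL: "finite La" "finite Lb" using fin by (auto simp: La_def Lb_def)
    have LbW: "Lb \<subseteq> W" by (auto simp: Lb_def La_def)
    have cLb: "real (card Lb) \<ge> 38 / 100 * N"
    proof (cases "2 * card G \<le> card W")
      case True
      have "real (card G) - x \<le> card (nb W G)" using good_ex[OF g GW True] by (simp add: x_def N_def)
      moreover have "card (nb W G) \<le> card (Lb \<union> R)"
        using finL finR by (intro card_mono) (auto simp: Lb_def La_def nb_def)
      ultimately show ?thesis using cG cR card_Un_le[of Lb R] xN x100 by linarith
    next
      case False
      then have "real (card (W - G - nb W G)) \<le> x + 2" using good_big[OF g GW] by (simp add: x_def N_def)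
      moreover have "card W \<le> card (G \<union> (W - G - nb W G) \<union> (R \<union> Lb))"
        using finL finR finG fin by (intro card_mono) (auto simp: Lb_def La_def)
      moreover have "card (G \<union> (W - G - nb W G) \<union> (R \<union> Lb)) \<le> card G + card (W - G - nb W G) + (card R + card Lb)"
        using card_Un_le[of "G \<union> (W - G - nb W G)" "R \<union> Lb"] card_Un_le[of G "W - G - nb W G"] card_Un_le[of R Lb] by linarith
      ultimately show ?thesis using cR Gs xN x100 unfolding N_def by linarith
    qed
    \<comment> \<open>Above the threshold \<open>x + 2\<close> of \<open>good_mid\<close>, and still
      \<open>O(x)\<close>.\<close>
    define f where "f = nat \<lceil>2 * x\<rceil>"
    have f: "2 * x \<le> real f" "real f \<le> 3 * x" using x100 unfolding f_def by linarith+
    show ?thesis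
    proof (cases "\<exists>M2\<subseteq>Lb. card M2 = f \<and> real (card (nb W M2 \<inter> La)) \<ge> 12 / 100 * N")
      case True
      then obtain M2 where M2: "M2 \<subseteq> Lb" "card M2 = f" "real (card (nb W M2 \<inter> La)) \<ge> 12 / 100 * N" by blast
      have "\<exists>a. m \<in> M2 \<longrightarrow> a \<in> G \<and> adj a m" for m using M2(1) by (auto simp: Lb_def nb_def)
      then obtain gg where gg: "\<And>m. m \<in> M2 \<Longrightarrow> gg m \<in> G \<and> adj (gg m) m" by metis
      define M1 where "M1 = gg ` M2"
      have M1G: "M1 \<subseteq> G" using gg by (auto simp: M1_def)
      have finM2: "finite M2" using M2(1) finL finite_subset by blast
      have cM1: "card M1 \<le> f" using card_image_le[OF finM2, of gg] M2(2) by (simp add: M1_def)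
      have finM1: "finite M1" using finM2 by (simp add: M1_def)
      let ?T = "T1 \<union> M1 \<union> M2"
      let ?H = "(G \<union> (nb W M2 \<inter> La)) - (M1 \<union> M2)"
      have GT: "G \<inter> T1 = {}" "G \<inter> T2 = {}" by (auto simp: G_def R_def)
      have LT: "La \<inter> T1 = {}" "La \<inter> T2 = {}" "La \<inter> G = {}" by (auto simp: La_def R_def)
      have M2L: "M2 \<subseteq> La" using M2(1) by (auto simp: Lb_def)
      have b1: "broom (T1 \<union> M1) r M1 (Suc h)"
        by (rule broom_extend[OF br, of _ W]) (use M1G GT in \<open>auto simp: G_def\<close>)
      have b2: "broom ?T r M2 (Suc (Suc h))"
      proof (rule broom_extend[OF b1, of _ W])
        show "M2 \<subseteq> nb W M1"
        proof
          fix m assume m: "m \<in> M2"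
          then have "m \<in> W" "m \<notin> M1" using M2L LT M1G by (auto simp: La_def)
          moreover have "gg m \<in> M1" "adj (gg m) m" using gg[OF m] m by (auto simp: M1_def)
          ultimately show "m \<in> nb W M1" by (auto simp: nb_def)
        qed
        show "M2 \<inter> (T1 \<union> M1) = {}" using M2L LT M1G by blast
      qed auto
      have "real (card ?T) \<le> 20 * x"
        using card_Un_le[of "T1 \<union> M1" M2] card_Un_le[of T1 M1] cM1 M2(2) f cT' x100 by linarith
      moreover have "real (card ?H) \<ge> 6 / 10 * N"
      proof -
        have "card G + card (nb W M2 \<inter> La) = card (G \<union> (nb W M2 \<inter> La))"
          using finG finL LT by (intro card_Un_disjoint[symmetric]) auto
        also have "\<dots> \<le> card (?H \<union> (M1 \<union> M2))" using finG finL finM1 finM2 by (intro card_mono) auto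
        finally show ?thesis using card_Un_le[of ?H "M1 \<union> M2"] card_Un_le[of M1 M2] cM1 M2 f cG xN by linarith
      qed
      moreover have "?H \<subseteq> W - ?T - T2" using GW GT LT nb_subset[of W M2] by blast
      moreover have "?T \<subseteq> W" "?T \<inter> T2 = {}" using T M1G GW M2L LT GT by (auto simp: La_def)
      moreover have hook: "\<exists>p. pth p \<and> set p \<subseteq> ?T \<and> hd p = r \<and> adj (last p) y \<and> h \<le> length p \<and> length p \<le> h + 2"
        if y: "y \<in> ?H" for y
      proof (cases "y \<in> G")
        case True
        then show ?thesis by (rule hG) auto
      next
        case False
        then obtain m where m: "m \<in> M2" "adj m y" using y by (auto simp: nb_def)
        then obtain p where "pth p" "set p \<subseteq> ?T" "hd p = r" "last p = m" "length p = Suc (Suc h)"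
          using b2 unfolding broom_def by blast
        then show ?thesis using m by (intro exI[of _ p]) auto
      qed
      moreover have "\<forall>y\<in>?H. \<exists>p. pth p \<and> set p \<subseteq> ?T \<and> hd p = r \<and> adj (last p) y \<and> h \<le> length p \<and> length p \<le> h + 2"
        using hook by blast
      moreover have "T1 \<subseteq> ?T" by blast
      moreover have "20 * x = 20 * \<delta> * real (card W)" by (simp add: x_def N_def)
      ultimately show ?thesis unfolding N_def by (intro exI[of _ ?T] exI[of _ ?H] conjI) simp_all
    next
      case False
      \<comment> \<open>\<open>M2\<close> and its neighbours fill half of \<open>W\<close>; fewer
        than \<open>12 / 100 * N\<close> of them are in \<open>La\<close>, so nearly all others are
        in \<open>G\<close>.\<close>
      have see: "real (card (nb W M2 \<inter> G)) \<ge> 37 / 100 * N" if M2: "M2 \<subseteq> Lb" "card M2 = f" for M2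
      proof -
        have M2W: "M2 \<subseteq> W" using M2(1) LbW by blast
        have "real (card M2) > \<delta> * real (card W) + 2" using M2(2) f x100 by (simp add: x_def N_def)
        then have "real (card (M2 \<union> nb W M2)) \<ge> N / 2" using good_mid[OF g M2W] by (simp add: N_def)
        moreover have "card (nb W M2) \<le> card ((nb W M2 \<inter> La) \<union> (nb W M2 \<inter> G) \<union> R)"
          using finL finG finR by (intro card_mono) (auto simp: La_def nb_def)
        moreover have "card ((nb W M2 \<inter> La) \<union> (nb W M2 \<inter> G) \<union> R) \<le> card (nb W M2 \<inter> La) + card (nb W M2 \<inter> G) + card R"
          using card_Un_le[of "(nb W M2 \<inter> La) \<union> (nb W M2 \<inter> G)" R] card_Un_le[of "nb W M2 \<inter> La" "nb W M2 \<inter> G"] by linarith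
        moreover have "\<not> real (card (nb W M2 \<inter> La)) \<ge> 12 / 100 * N" using False M2 by blast
        ultimately show ?thesis using card_Un_le[of M2 "nb W M2"] M2(2) f cR xN by linarith
      qed
      \<comment> \<open>There are at least \<open>25 / 100 * N\<close> vertices in
        \<open>Hi\<close>, each with at least \<open>1 / (10 * \<delta>)\<close> neighbours in
        \<open>G\<close>, and \<open>G\<close> has fewer than \<open>6 / 10 * N\<close> vertices; so
        the average number of neighbours in \<open>Hi\<close> of a vertex of \<open>G\<close>
        exceeds \<open>q\<close>.\<close>
      define q where "q = 4 / (100 * \<delta>)"
      have q0: "0 < q" using \<delta> by (simp add: q_def)
      have greedy: "\<exists>M1\<subseteq>G. card M1 \<le> j \<and>
          (real (card (nb W M1 \<inter> Lb)) \<ge> 12 / 100 * N \<or> real (card (nb W M1 \<inter> Lb)) \<ge> real j * q)" for j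
      proof (induction j)
        case 0
        show ?case by (intro exI[of _ "{}"]) auto
      next
        case (Suc j)
        then obtain M1 where M1: "M1 \<subseteq> G" "card M1 \<le> j"
          "real (card (nb W M1 \<inter> Lb)) \<ge> 12 / 100 * N \<or> real (card (nb W M1 \<inter> Lb)) \<ge> real j * q" by blast
        have finM1: "finite M1" using M1(1) finG finite_subset by blast
        show ?case
        proof (cases "real (card (nb W M1 \<inter> Lb)) \<ge> 12 / 100 * N")
          case True
          then show ?thesis using M1 by (intro exI[of _ M1]) auto
        next
          case few: False
          let ?C = "nb W M1 \<inter> Lb"
          define U where "U = Lb - ?C"
          define dg where "dg u = card {a \<in> G. adj a u}" for u
          have finU: "finite U" using finL by (simp add: U_def)
          have cU: "real (card U) \<ge> 26 / 100 * N"
          proof -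
            have "card Lb \<le> card (U \<union> ?C)" using finU finL by (intro card_mono) (auto simp: U_def)
            then show ?thesis using card_Un_le[of U ?C] few cLb by linarith
          qed
          define Low where "Low = {u \<in> U. real (dg u) < 1 / (10 * \<delta>)}"
          \<comment> \<open>A set of \<open>f\<close> vertices of low degree would see at most
            \<open>3 / 10 * N\<close> vertices of \<open>G\<close>, against
            \<open>see\<close>.\<close>
          have low: "card Low < f"
          proof (rule ccontr)
            assume "\<not> ?thesis"
            then obtain M2 where M2: "M2 \<subseteq> Low" "card M2 = f" by (meson not_less obtain_subset_with_card_n)
            have M2b: "M2 \<subseteq> Lb" using M2(1) by (auto simp: Low_def U_def)
            have finM2: "finite M2" using M2b finL finite_subset by blast
            have "card (nb W M2 \<inter> G) \<le> card (\<Union>u\<in>M2. {a \<in> G. adj a u})"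
              using finM2 finG by (intro card_mono) (auto simp: nb_def adj_commute)
            also have "\<dots> \<le> (\<Sum>u\<in>M2. dg u)" unfolding dg_def by (rule card_UN_le[OF finM2])
            finally have "real (card (nb W M2 \<inter> G)) \<le> (\<Sum>u\<in>M2. real (dg u))" by (metis of_nat_le_iff of_nat_sum)
            also have "\<dots> \<le> (\<Sum>u\<in>M2. 1 / (10 * \<delta>))" using M2(1) by (intro sum_mono) (auto simp: Low_def)
            also have "\<dots> = real f * (1 / (10 * \<delta>))" using M2(2) by simp
            also have "\<dots> \<le> 3 * x * (1 / (10 * \<delta>))" using f \<delta> by (intro mult_right_mono) auto
            also have "\<dots> = 3 / 10 * N" using \<delta> by (simp add: x_def)
            finally show False using see[OF M2b M2(2)] x100 xN by linarith
          qed
          define Hi where "Hi = U - Low"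
          have finHi: "finite Hi" using finU by (simp add: Hi_def)
          have cHi: "real (card Hi) \<ge> 25 / 100 * N"
          proof -
            have "card U \<le> card (Hi \<union> Low)" using finU by (intro card_mono) (auto simp: Hi_def Low_def)
            then show ?thesis using card_Un_le[of Hi Low] low cU f xN by linarith
          qed
          have "\<exists>a\<in>G. real (card {u \<in> Hi. adj a u}) \<ge> q"
          proof (rule ccontr)
            assume "\<not> ?thesis"
            then have lt: "\<And>a. a \<in> G \<Longrightarrow> real (card {u \<in> Hi. adj a u}) \<le> q" by force
            have "(\<Sum>a\<in>G. card {u \<in> Hi. adj a u}) = (\<Sum>u\<in>Hi. dg u)"
              by (rule sum_multicount_gen) (use finG finHi in \<open>auto simp: dg_def\<close>)
            then have "(\<Sum>u\<in>Hi. real (dg u)) = (\<Sum>a\<in>G. real (card {u \<in> Hi. adj a u}))"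
              by (metis of_nat_sum)
            also have "\<dots> \<le> (\<Sum>a\<in>G. q)" by (rule sum_mono) (rule lt)
            also have "\<dots> = real (card G) * q" by simp
            also have "\<dots> \<le> 6 / 10 * N * q" using Gs q0 by (intro mult_right_mono) auto
            also have "\<dots> = 24 / 1000 * (N / \<delta>)" by (simp add: q_def)
            finally have "(\<Sum>u\<in>Hi. real (dg u)) \<le> 24 / 1000 * (N / \<delta>)" .
            moreover have "(\<Sum>u\<in>Hi. real (dg u)) \<ge> (\<Sum>u\<in>Hi. 1 / (10 * \<delta>))"
              by (intro sum_mono) (auto simp: Hi_def Low_def)
            moreover have "(\<Sum>u\<in>Hi. 1 / (10 * \<delta>)) = real (card Hi) * (1 / (10 * \<delta>))" by simp
            moreover have "real (card Hi) * (1 / (10 * \<delta>)) \<ge> 25 / 100 * N * (1 / (10 * \<delta>))"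
              using cHi \<delta> by (intro mult_right_mono) auto
            moreover have "25 / 100 * N * (1 / (10 * \<delta>)) = 25 / 1000 * (N / \<delta>)" by simp
            moreover have "0 < N / \<delta>" using xN x100 \<delta> by (intro divide_pos_pos) linarith+
            ultimately show False by linarith
          qed
          then obtain a where a: "a \<in> G" "real (card {u \<in> Hi. adj a u}) \<ge> q" by blast
          have GLb: "G \<inter> Lb = {}" by (auto simp: Lb_def La_def)
          have "?C \<union> {u \<in> Hi. adj a u} \<subseteq> nb W (insert a M1) \<inter> Lb"
            using a(1) M1(1) GLb LbW by (auto simp: nb_def Hi_def U_def)
          then have "card (?C \<union> {u \<in> Hi. adj a u}) \<le> card (nb W (insert a M1) \<inter> Lb)"
            using finL by (intro card_mono) auto
          moreover have "card (?C \<union> {u \<in> Hi. adj a u}) = card ?C + card {u \<in> Hi. adj a u}"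
            using finL finHi by (intro card_Un_disjoint) (auto simp: Hi_def U_def)
          ultimately have "real (card (nb W (insert a M1) \<inter> Lb)) \<ge> real (Suc j) * q"
            using a(2) M1(3) few by (simp add: algebra_simps)
          moreover have "card (insert a M1) \<le> Suc j" using M1(2) finM1 by (simp add: card_insert_if)
          ultimately show ?thesis using a(1) M1(1) by (intro exI[of _ "insert a M1"]) auto
        qed
      qed
      \<comment> \<open>Enough greedy choices, as \<open>3 * x * q = 12 / 100 * N\<close>.\<close>
      define j where "j = nat \<lceil>3 * x\<rceil>"
      have j: "3 * x \<le> real j" "real j \<le> 4 * x" using x100 unfolding j_def by linarith+
      have "3 * x * q \<le> real j * q" using j q0 by (intro mult_right_mono) auto
      moreover have "3 * x * q = 12 / 100 * N" using \<delta> by (simp add: x_def q_def)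
      ultimately have "12 / 100 * N \<le> real j * q" by simp
      then obtain M1 where M1: "M1 \<subseteq> G" "card M1 \<le> j" "real (card (nb W M1 \<inter> Lb)) \<ge> 12 / 100 * N"
        using greedy[of j] by force
      have finM1: "finite M1" using M1(1) finG finite_subset by blast
      let ?T = "T1 \<union> M1"
      let ?H = "(G \<union> (nb W M1 \<inter> Lb)) - M1"
      have GT: "G \<inter> T1 = {}" "G \<inter> T2 = {}" by (auto simp: G_def R_def)
      have LT: "Lb \<inter> T1 = {}" "Lb \<inter> T2 = {}" "Lb \<inter> G = {}" by (auto simp: La_def Lb_def R_def)
      have b1: "broom ?T r M1 (Suc h)"
        by (rule broom_extend[OF br, of _ W]) (use M1 GT in \<open>auto simp: G_def\<close>)
      have "real (card ?T) \<le> 20 * x"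
        using card_Un_le[of T1 M1] M1(2) j cT' x100 by linarith
      moreover have "real (card ?H) \<ge> 6 / 10 * N"
      proof -
        have "card G + card (nb W M1 \<inter> Lb) = card (G \<union> (nb W M1 \<inter> Lb))"
          using finG finL LT by (intro card_Un_disjoint[symmetric]) auto
        also have "\<dots> \<le> card (?H \<union> M1)" using finG finL finM1 by (intro card_mono) auto
        finally show ?thesis using card_Un_le[of ?H M1] M1 j cG xN by linarith
      qed
      moreover have "?H \<subseteq> W - ?T - T2" using GW GT LT nb_subset[of W M1] by blast
      moreover have "?T \<subseteq> W" "?T \<inter> T2 = {}" using T M1(1) GW GT by auto
      moreover have hook: "\<exists>p. pth p \<and> set p \<subseteq> ?T \<and> hd p = r \<and> adj (last p) y \<and> h \<le> length p \<and> length p \<le> h + 2"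
        if y: "y \<in> ?H" for y
      proof (cases "y \<in> G")
        case True
        then show ?thesis by (rule hG) auto
      next
        case False
        then obtain m where m: "m \<in> M1" "adj m y" using y by (auto simp: nb_def)
        then obtain p where "pth p" "set p \<subseteq> ?T" "hd p = r" "last p = m" "length p = Suc h"
          using b1 unfolding broom_def by blast
        then show ?thesis using m by (intro exI[of _ p]) auto
      qed
      moreover have "\<forall>y\<in>?H. \<exists>p. pth p \<and> set p \<subseteq> ?T \<and> hd p = r \<and> adj (last p) y \<and> h \<le> length p \<and> length p \<le> h + 2"
        using hook by blast
      moreover have "T1 \<subseteq> ?T" by blast
      moreover have "20 * x = 20 * \<delta> * real (card W)" by (simp add: x_def N_def)
      ultimately show ?thesis unfolding N_def by (intro exI[of _ ?T] exI[of _ ?H] conjI) simp_all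
    qed
  qed
qed

text \<open>The loss parameter rises from \<open>\<epsilon>\<close> to \<open>4 * \<epsilon>\<close>
  (first cleaning), \<open>160 * \<epsilon>\<close> (removal of the trees) and
  \<open>640 * \<epsilon>\<close> (second cleaning). The cycle then misses a fraction
  \<open>3000 * 640 * \<epsilon>\<close>, which together with the deleted vertices stays below
  \<open>2 * 10 ^ 6 * \<epsilon>\<close>. Boosting one tree is enough for
  \<open>cyc_distance\<close>, since \<open>6 / 10 + 1 / 2 > 1\<close>.\<close>

theorem near_dirac_cycles:
  assumes a: "additive \<epsilon> V" and \<epsilon>: "0 < \<epsilon>" "\<epsilon> \<le> 1 / 10 ^ 9" and big: "10 ^ 6 \<le> \<epsilon> * real (card V)"
  shows "\<exists>h. 2 ^ h \<le> 16 * card V \<and> (\<forall>l. 2 * h + 2 \<le> l \<and> real l \<le> (1 - 2 * 10 ^ 6 * \<epsilon>) * real (card V) \<longrightarrow>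
    (\<exists>c. cyc c \<and> set c \<subseteq> V \<and> l \<le> length c \<and> length c \<le> l + 2))"
proof -
  define n where "n = real (card V)"
  define e where "e = \<epsilon> * n"
  have e6: "1000000 \<le> e" using big by (simp add: e_def n_def)
  have en: "e \<le> n / 10 ^ 9" using mult_right_mono[OF \<epsilon>(2), of n] by (simp add: e_def n_def)
  have finV: "finite V" using a by (simp add: additive_def)
  obtain B where B: "B \<subseteq> V" "real (card B) \<le> e + 2" "good (4 * \<epsilon>) (V - B)"
    using cleaning[OF a \<epsilon>(1)] \<epsilon>(2) big by (auto simp: e_def n_def)
  define W where "W = V - B"
  define N where "N = real (card W)"
  have WV: "W \<subseteq> V" and finW: "finite W" using finV by (auto simp: W_def)
  have g: "good (4 * \<epsilon>) W" using B(3) by (simp add: W_def)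
  have finB: "finite B" using B(1) finV by (rule finite_subset)
  have N: "N = n - card B"
  proof -
    have "card W = card V - card B" unfolding W_def using finB B(1) by (simp add: card_Diff_subset)
    moreover have "card B \<le> card V" using finV B(1) by (rule card_mono)
    ultimately show ?thesis by (simp add: N_def n_def)
  qed
  have N2: "N \<le> n" "N \<ge> n - e - 2" using N B(2) by simp_all
  define x where "x = 4 * \<epsilon> * N"
  have x: "x \<le> 4 * e" "x \<ge> 2 * e" 
  proof -
    have "\<epsilon> * N \<le> \<epsilon> * n" using N2 \<epsilon> by (intro mult_left_mono) auto
    then show "x \<le> 4 * e" by (simp add: x_def e_def)
    have "n / 2 \<le> N" using N2 en e6 by simp
    then have "\<epsilon> * (n / 2) \<le> \<epsilon> * N" using \<epsilon> by (intro mult_left_mono) auto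
    then show "x \<ge> 2 * e" by (simp add: x_def e_def algebra_simps)
  qed
  have xN: "x = 4 * \<epsilon> * real (card W)" by (simp add: x_def N_def)
  have big1: "100 \<le> 4 * \<epsilon> * real (card W)" using x e6 unfolding xN[symmetric] by linarith
  obtain T1 T2 A1 A2 r1 r2 h where T: "T1 \<subseteq> W" "T2 \<subseteq> W" "T1 \<inter> T2 = {}" "A1 \<subseteq> T1" "A2 \<subseteq> T2" and r: "adj r1 r2"
    and b: "broom T1 r1 A1 h" "broom T2 r2 A2 h"
    and cA: "real (card A1) > 4 * \<epsilon> * real (card W) + 2" "real (card A2) > 4 * \<epsilon> * real (card W) + 2"
    and cT: "real (card T1) \<le> 9 * (4 * \<epsilon>) * real (card W)" "real (card T2) \<le> 9 * (4 * \<epsilon>) * real (card W)"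
    and h: "2 ^ h \<le> 16 * card W"
    using two_brooms[OF g _ _ big1] \<epsilon> by auto
  obtain T H1 where TT: "T1 \<subseteq> T" "T \<subseteq> W" "T \<inter> T2 = {}" "real (card T) \<le> 20 * (4 * \<epsilon>) * real (card W)"
    and H1: "H1 \<subseteq> W - T - T2" "real (card H1) \<ge> 6 / 10 * real (card W)"
      "\<And>x. x \<in> H1 \<Longrightarrow> \<exists>p. pth p \<and> set p \<subseteq> T \<and> hd p = r1 \<and> adj (last p) x \<and> h \<le> length p \<and> length p \<le> h + 2"
    using boost[OF g _ _ big1 T(1-4) cT cA(1) b(1)] \<epsilon> by auto
  define R where "R = T \<union> T2"
  have RW: "R \<subseteq> W" using TT(2) T(2) by (auto simp: R_def)
  have finR: "finite R" using RW finW by (rule finite_subset)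
  have cT2: "real (card T2) \<le> 9 * x" and cTx: "real (card T) \<le> 20 * x" using cT(2) TT(4) by (simp_all add: xN)
  have cR: "real (card R) \<le> 29 * x" using card_Un_le[of T T2] cT2 cTx by (simp add: R_def)
  have A2W: "A2 \<subseteq> W" using T by blast
  define H2 where "H2 = nb W A2 - R"
  have cH2: "real (card H2) \<ge> N / 2 - 38 * x"
  proof -
    have "real (card (A2 \<union> nb W A2)) \<ge> N / 2" using good_mid[OF g A2W cA(2)] by (simp add: N_def)
    moreover have "card (nb W A2) \<le> card (H2 \<union> R)"
      using finR finite_nb[OF finW] by (intro card_mono) (auto simp: H2_def)
    moreover have "card A2 \<le> card T2" using T(2,5) finW finite_subset by (intro card_mono) auto
    ultimately show ?thesis using card_Un_le[of A2 "nb W A2"] card_Un_le[of H2 R] cT2 cR by linarith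
  qed
  define W2 where "W2 = W - R"
  have cW2: "real (card W2) = N - card R"
  proof -
    have "card W2 = card W - card R" unfolding W2_def using finR RW by (simp add: card_Diff_subset)
    moreover have "card R \<le> card W" using finW RW by (rule card_mono)
    ultimately show ?thesis by (simp add: N_def)
  qed
  have aW: "additive (4 * \<epsilon>) W" using g unfolding good_def additive_def by blast
  have w2: "\<epsilon> * real (card W2) \<ge> 3 / 4 * (\<epsilon> * N)"
  proof -
    have "N - card R \<ge> 3 / 4 * N" using cR x N2 en e6 by simp
    then have "\<epsilon> * (3 / 4 * N) \<le> \<epsilon> * (N - card R)" using \<epsilon> by (intro mult_left_mono) auto
    then show ?thesis by (simp add: cW2)
  qed
  have a2: "additive (160 * \<epsilon>) W2"
    unfolding W2_def
  proof (rule additive_remove[OF aW RW])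
    have "4 * \<epsilon> * real (card W) + card R \<le> 30 * x" using cR by (simp add: xN)
    also have "\<dots> = 120 * (\<epsilon> * N)" by (simp add: x_def)
    also have "\<dots> \<le> 160 * (\<epsilon> * real (card W2))" using w2 by linarith
    finally show "4 * \<epsilon> * real (card W) + card R \<le> 160 * \<epsilon> * real (card (W - R))" by (simp add: W2_def)
  qed
  have "x = 4 * (\<epsilon> * N)" by (simp add: x_def)
  then have eN: "\<epsilon> * N \<ge> e / 2" "\<epsilon> * N \<le> e" using x by linarith+
  have w3: "\<epsilon> * real (card W2) \<ge> e / 4" "\<epsilon> * real (card W2) \<le> e"
  proof -
    show "\<epsilon> * real (card W2) \<ge> e / 4" using w2 eN e6 by linarith
    have "\<epsilon> * real (card W2) \<le> \<epsilon> * N" using cW2 \<epsilon> by (intro mult_left_mono) auto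
    then show "\<epsilon> * real (card W2) \<le> e" using eN by linarith
  qed
  have "100 \<le> 160 * \<epsilon> * real (card W2)" using w3 e6 by simp
  then obtain B2 where B2: "B2 \<subseteq> W2" "real (card B2) \<le> 160 * \<epsilon> * real (card W2) + 2" "good (4 * (160 * \<epsilon>)) (W2 - B2)"
    using cleaning[OF a2] \<epsilon> by auto
  define W3 where "W3 = W2 - B2"
  have finW2: "finite W2" using finW by (simp add: W2_def)
  have finB2: "finite B2" using B2(1) finW2 by (rule finite_subset)
  have cB2: "real (card B2) \<le> 160 * e + 2" using B2(2) w3 by linarith
  have cW3: "real (card W3) = real (card W2) - card B2"
  proof -
    have "card W3 = card W2 - card B2" unfolding W3_def using finB2 B2(1) by (simp add: card_Diff_subset)
    moreover have "card B2 \<le> card W2" using finW2 B2(1) by (rule card_mono)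
    ultimately show ?thesis by simp
  qed
  have W3n: "real (card W3) \<ge> n - 300 * e" "real (card W3) \<le> N"
    using cW3 cW2 cB2 cR x N2 e6 by linarith+
  have "\<epsilon> * real (card W3) \<ge> \<epsilon> * (n / 2)"
    using W3n(1) en e6 \<epsilon> by (intro mult_left_mono) auto
  then have e3: "\<epsilon> * real (card W3) \<ge> e / 2" by (simp add: e_def)
  obtain c where c: "cyc c" "set c \<subseteq> W3" "real (length c) \<ge> (1 - 3000 * (4 * (160 * \<epsilon>))) * real (card W3)"
    using near_spanning_cycle[of "4 * (160 * \<epsilon>)" W3] B2(3) \<epsilon> e3 e6 by (auto simp: W3_def)
  have distc: "distinct c" using c(1) by (simp add: cyc_def pth_def)
  have Ln: "real (length c) \<ge> n - 1930000 * e"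
  proof -
    have "1920000 * (\<epsilon> * real (card W3)) \<le> 1920000 * e"
      using W3n(2) eN \<epsilon> mult_left_mono[of "real (card W3)" N \<epsilon>] by linarith
    moreover have "(1 - 3000 * (4 * (160 * \<epsilon>))) * real (card W3) = real (card W3) - 1920000 * (\<epsilon> * real (card W3))"
      by (simp add: algebra_simps)
    ultimately show ?thesis using c(3) W3n(1) e6 by linarith
  qed
  have cW: "set c \<subseteq> W" and cR0: "set c \<inter> R = {}" using c(2) by (auto simp: W3_def W2_def)
  have cap: "real (card (H \<inter> set c)) \<ge> card H - (N - length c)" if "H \<subseteq> W" for H
  proof -
    have "card (H \<union> set c) \<le> card W" using that cW finW by (intro card_mono) auto
    moreover have "card H + card (set c) = card (H \<union> set c) + card (H \<inter> set c)"
      using that finW finite_subset by (intro card_Un_Int) auto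
    moreover have "card (set c) = length c" using distc by (rule distinct_card)
    ultimately show ?thesis unfolding N_def by linarith
  qed
  have H2W: "H2 \<subseteq> W" using nb_subset by (auto simp: H2_def)
  have H1W: "H1 \<subseteq> W" using H1(1) by blast
  have big2: "card (H1 \<inter> set c) + card (H2 \<inter> set c) > length c"
  proof -
    have "real (card (H1 \<inter> set c)) + card (H2 \<inter> set c) \<ge> 11 / 10 * N - 38 * x - 2 * (N - length c)"
      using cap[OF H1W] cap[OF H2W] H1(2) cH2 unfolding N_def by argo
    moreover have "11 / 10 * N - 38 * x - 2 * (N - length c) > length c"
      using Ln N2 x en e6 by simp
    ultimately have "real (card (H1 \<inter> set c) + card (H2 \<inter> set c)) > real (length c)" by simp
    then show ?thesis by (simp only: of_nat_less_iff)
  qed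
  show ?thesis
  proof (intro exI[of _ h] conjI allI impI)
    show "2 ^ h \<le> 16 * card V" using h card_mono[OF finV WV] by linarith
    fix l assume l: "2 * h + 2 \<le> l \<and> real l \<le> (1 - 2 * 10 ^ 6 * \<epsilon>) * real (card V)"
    have "(1 - 2 * 10 ^ 6 * \<epsilon>) * real (card V) = n - 2000000 * e" by (simp add: e_def n_def algebra_simps)
    then have lL: "real l \<le> n - 2000000 * e" using l by linarith
    \<comment> \<open>A stretch of \<open>Suc d\<close> cycle vertices between one tree path of
      \<open>h\<close> to \<open>h + 2\<close> vertices and one of exactly \<open>h\<close> gives a
      length from \<open>l\<close> to \<open>l + 2\<close>.\<close>
    define d where "d = l - 2 * h - 1"
    have d1: "1 \<le> d" unfolding d_def using l by linarith
    have "real l < real (length c)" using lL Ln e6 by linarith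
    then have dL: "d < length c" by (simp add: d_def)
    obtain c' where c': "cyc c'" "set c' = set c" "length c' = length c" "c' ! 0 \<in> H1" "c' ! (d mod length c) \<in> H2"
      using cyc_distance[OF c(1) big2, of d] by blast
    let ?s = "take (Suc d) c'"
    have pc': "pth c'" using c'(1) by (simp add: cyc_def)
    have c'ne: "c' \<noteq> []" using pth_ne[OF pc'] .
    have sne: "?s \<noteq> []" using c'ne by simp
    have ps: "pth ?s" using pth_appendD1[of ?s "drop (Suc d) c'"] pc' sne by simp
    have hs: "hd ?s \<in> H1" using c'(4) c'ne by (simp add: hd_conv_nth)
    have ls: "last ?s \<in> H2" using c'(3,5) dL by (simp add: take_Suc_conv_app_nth)
    have slen: "length ?s = Suc d" using dL c'(3) by simp
    have sR: "set ?s \<inter> R = {}" using cR0 c'(2) set_take_subset[of "Suc d" c'] by blast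
    obtain p1 where p1: "pth p1" "set p1 \<subseteq> T" "hd p1 = r1" "adj (last p1) (hd ?s)" "h \<le> length p1" "length p1 \<le> h + 2"
      using H1(3)[OF hs] by blast
    obtain a2 where a2: "a2 \<in> A2" "adj a2 (last ?s)" using ls by (auto simp: H2_def nb_def)
    then obtain p2 where p2: "pth p2" "set p2 \<subseteq> T2" "hd p2 = r2" "last p2 = a2" "length p2 = h"
      using b(2) unfolding broom_def by blast
    have p2s: "adj (last ?s) (last p2)" using a2(2) p2(4) adj_sym by simp
    have ne: "p1 \<noteq> []" "p2 \<noteq> []" using pth_ne p1(1) p2(1) by auto
    let ?c = "p1 @ (?s @ rev p2)"
    have pp: "pth (?s @ rev p2)"
      using ps p2(1,2) sR ne sne p2s by (subst pth_append) (auto simp: hd_rev R_def)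
    have "pth ?c"
    proof (subst pth_append)
      show "p1 \<noteq> []" "?s @ rev p2 \<noteq> []" using ne by auto
      have "set p1 \<inter> set (?s @ rev p2) = {}" using p1(2) p2(2) sR TT(3) by (auto simp: R_def)
      moreover have "adj (last p1) (hd (?s @ rev p2))" using p1(4) sne by (simp add: hd_append)
      ultimately show "pth p1 \<and> pth (?s @ rev p2) \<and> set p1 \<inter> set (?s @ rev p2) = {} \<and> adj (last p1) (hd (?s @ rev p2))"
        using p1(1) pp by blast
    qed
    moreover have len: "length ?c = length p1 + Suc d + h" using slen p2(5) by simp
    moreover have "last ?c = r2" "hd ?c = r1" using ne p1(3) p2(3) by (simp_all add: last_rev)
    moreover have "1 \<le> length p1" "1 \<le> h" using ne p2(5) by (auto simp: Suc_le_eq)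
    ultimately have "cyc ?c" using adj_sym[OF r] d1 by (simp add: cyc_def)
    moreover have "set ?c \<subseteq> V"
      using p1(2) p2(2) TT(2) T(2) WV cW c'(2) set_take_subset[of "Suc d" c'] by auto
    moreover have "l \<le> length ?c" "length ?c \<le> l + 2" unfolding len using p1(5,6) l by (auto simp: d_def)
    ultimately show "\<exists>c. cyc c \<and> set c \<subseteq> V \<and> l \<le> length c \<and> length c \<le> l + 2" by blast
  qed
qed

section \<open>Minimum degree at least half the order\<close>

text \<open>Dirac's theorem via a longest path: both ends have all their neighbours on it, so by
  counting, chords from the two ends cross at some consecutive pair and turn the path into a cycle.
  A vertex off the cycle would have a neighbour on it and yield a longer path.\<close>

lemma dirac_hamilton:
  assumes fin: "finite V" and n3: "3 \<le> card V" and deg: "\<And>w. w \<in> V \<Longrightarrow> card V \<le> 2 * card {u \<in> V. adj w u}"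
  shows "\<exists>c. cyc c \<and> set c = V"
proof -
  let ?n = "card V"
  let ?Q = "\<lambda>p. pth p \<and> set p \<subseteq> V"
  obtain v where "v \<in> V" using n3 by fastforce
  then have "?Q [v]" by simp
  moreover have "\<forall>p. ?Q p \<longrightarrow> length p < Suc ?n"
    using fin by (metis card_mono distinct_card less_Suc_eq_le pth_distinct)
  ultimately obtain P where P: "pth P" "set P \<subseteq> V" and mx: "\<And>p. pth p \<Longrightarrow> set p \<subseteq> V \<Longrightarrow> length p \<le> length P"
    using ex_has_greatest_nat[of ?Q "[v]" length] by blast
  let ?m = "length P"
  have ne: "P \<noteq> []" by (rule pth_ne[OF P(1)])
  have dist: "distinct P" by (rule pth_distinct[OF P(1)])
  have mle: "?m \<le> ?n" using P fin by (metis card_mono distinct_card dist)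
  have hV: "hd P \<in> V" "last P \<in> V" using ne P(2) by auto
  have N0: "{u \<in> V. adj (hd P) u} \<subseteq> set P"
  proof
    fix u assume u: "u \<in> {u \<in> V. adj (hd P) u}"
    show "u \<in> set P"
    proof (rule ccontr)
      assume "u \<notin> set P"
      then have "pth ([u] @ P)" using P(1) ne u adj_sym by (subst pth_append) auto
      then show False using mx[of "[u] @ P"] P(2) u by simp
    qed
  qed
  have N1: "{u \<in> V. adj (last P) u} \<subseteq> set P"
  proof
    fix u assume u: "u \<in> {u \<in> V. adj (last P) u}"
    show "u \<in> set P"
    proof (rule ccontr)
      assume "u \<notin> set P"
      then have "pth (P @ [u])" using P(1) ne u by (subst pth_append) auto
      then show False using mx[of "P @ [u]"] P(2) u by simp
    qed
  qed
  have hd0: "hd P = P ! 0" and lst: "last P = P ! (?m - 1)" using ne by (simp_all add: hd_conv_nth last_conv_nth)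
  let ?I0 = "{i. Suc i < ?m \<and> adj (hd P) (P ! Suc i)}" and ?I1 = "{i. Suc i < ?m \<and> adj (last P) (P ! i)}"
  have fI: "finite ?I0" "finite ?I1" by (rule finite_subset[of _ "{..<?m}"]; auto)+
  have c0: "card {u \<in> V. adj (hd P) u} \<le> card ?I0"
  proof -
    have "{u \<in> V. adj (hd P) u} \<subseteq> (\<lambda>i. P ! Suc i) ` ?I0"
    proof
      fix u assume u: "u \<in> {u \<in> V. adj (hd P) u}"
      then obtain i where i: "i < ?m" "P ! i = u" using N0 by (metis in_set_conv_nth subsetD)
      have "i \<noteq> 0" using u i(2) hd0 adj_irrefl by (metis mem_Collect_eq)
      then obtain j where "i = Suc j" by (cases i) auto
      then show "u \<in> (\<lambda>i. P ! Suc i) ` ?I0" using i u by auto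
    qed
    then show ?thesis by (rule surj_card_le[OF fI(1)])
  qed
  have c1: "card {u \<in> V. adj (last P) u} \<le> card ?I1"
  proof -
    have "{u \<in> V. adj (last P) u} \<subseteq> (\<lambda>i. P ! i) ` ?I1"
    proof
      fix u assume u: "u \<in> {u \<in> V. adj (last P) u}"
      then obtain i where i: "i < ?m" "P ! i = u" using N1 by (metis in_set_conv_nth subsetD)
      have "i \<noteq> ?m - 1" using u i(2) lst adj_irrefl by auto
      then show "u \<in> (\<lambda>i. P ! i) ` ?I1" using i u by auto
    qed
    then show ?thesis by (rule surj_card_le[OF fI(2)])
  qed
  have sub: "?I0 \<union> ?I1 \<subseteq> {..<?m - 1}" by auto
  have "?I0 \<inter> ?I1 \<noteq> {}"
  proof
    assume e: "?I0 \<inter> ?I1 = {}"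
    have "card ?I0 + card ?I1 = card (?I0 \<union> ?I1)" using e fI by (intro card_Un_disjoint[symmetric]) auto
    also have "\<dots> \<le> ?m - 1" using card_mono[OF _ sub] by simp
    finally show False using c0 c1 deg[OF hV(1)] deg[OF hV(2)] mle n3 by linarith
  qed
  then obtain i where i: "Suc i < ?m" "adj (hd P) (P ! Suc i)" "adj (last P) (P ! i)" by blast
  have "2 \<le> card {u \<in> V. adj (hd P) u}" using deg[OF hV(1)] n3 by linarith
  then have "2 \<le> card ?I0" using c0 by linarith
  also have "card ?I0 \<le> ?m - 1" using card_mono[of "{..<?m - 1}" ?I0] by fastforce
  finally have m3: "3 \<le> ?m" by linarith
  let ?a = "take (Suc i) P" and ?b = "drop (Suc i) P"
  let ?c = "?a @ rev ?b"
  have ab: "P = ?a @ ?b" by simp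
  have nab: "?a \<noteq> []" "?b \<noteq> []" using i ne by auto
  have pab: "pth ?a" "pth ?b" "set ?a \<inter> set ?b = {}"
    using P(1) pth_append[OF nab] by simp_all
  have la: "last ?a = P ! i" using i by (simp add: take_Suc_conv_app_nth)
  have lb: "last ?b = last P" using nab by (metis ab last_appendR)
  have hb: "hd ?b = P ! Suc i" using i by (simp add: hd_drop_conv_nth)
  have ha: "hd ?a = hd P" using ne by (cases P) auto
  have pc: "pth ?c" using pab nab la lb i(3) by (subst pth_append) (auto simp: hd_rev adj_commute)
  have sc: "set ?c = set P" by (metis ab set_append set_rev)
  have lc: "length ?c = ?m" by (metis ab length_append length_rev)
  have "last ?c = P ! Suc i" "hd ?c = hd P" using nab hb ha by (simp_all add: last_rev)
  then have cc: "cyc ?c" using pc lc m3 adj_sym[OF i(2)] by (simp add: cyc_def)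
  have "set P = V"
  proof (rule ccontr)
    assume "set P \<noteq> V"
    then obtain u where u: "u \<in> V" "u \<notin> set P" using P(2) by blast
    have "{w \<in> V. adj u w} \<inter> set P \<noteq> {}"
    proof
      assume e: "{w \<in> V. adj u w} \<inter> set P = {}"
      have "card {w \<in> V. adj u w} + card (set P) = card ({w \<in> V. adj u w} \<union> set P)"
        using e fin by (intro card_Un_disjoint[symmetric]) auto
      also have "\<dots> \<le> card (V - {u})" using u P(2) fin adj_irrefl by (intro card_mono) auto
      also have "\<dots> = ?n - 1" using u fin by simp
      finally have "card {w \<in> V. adj u w} + ?m \<le> ?n - 1" using dist by (simp add: distinct_card)
      moreover have "card {w \<in> V. adj (hd P) w} \<le> ?m - 1" using c0 card_mono[of "{..<?m - 1}" ?I0] by fastforce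
      ultimately show False using deg[OF u(1)] deg[OF hV(1)] n3 by linarith
    qed
    then obtain w where w: "adj u w" "w \<in> set ?c" using sc by blast
    then obtain j where j: "j < length ?c" "?c ! j = w" by (metis in_set_conv_nth)
    have r: "cyc (rotate j ?c)" by (rule cyc_rotate[OF cc])
    then have pr: "pth (rotate j ?c)" by (simp add: cyc_def)
    have "hd (rotate j ?c) = w" using j by (metis cyc_def hd_rotate_conv_nth less_nat_zero_code list.size(3) mod_less)
    moreover have "set (rotate j ?c) = set P" using sc by simp
    ultimately have "pth ([u] @ rotate j ?c)" using pr pth_ne[OF pr] w(1) u(2) by (subst pth_append) auto
    moreover have "set ([u] @ rotate j ?c) \<subseteq> V" using u(1) P(2) sc by simp
    ultimately have "length ([u] @ rotate j ?c) \<le> ?m" by (rule mx)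
    then show False using lc by simp
  qed
  then show ?thesis using cc sc by blast
qed

text \<open>Chords from two consecutive vertices of a Hamilton cycle: if length \<open>l\<close> is missing, the neighbourhood of
  one determines that of the other, and if also \<open>l + 1\<close> is missing, it is an initial segment.\<close>

lemma dirac_cycles:
  assumes fin: "finite V" and deg: "\<And>w. w \<in> V \<Longrightarrow> card V \<le> 2 * card {u \<in> V. adj w u}"
    and l: "4 \<le> l" "l \<le> card V"
  shows "\<exists>c. cyc c \<and> set c \<subseteq> V \<and> l \<le> length c \<and> length c \<le> l + 1"
proof -
  let ?n = "card V"
  obtain c where c: "cyc c" "set c = V" using dirac_hamilton[OF fin _ deg] l by auto
  have pc: "pth c" and cl: "adj (last c) (hd c)" using c(1) by (auto simp: cyc_def)
  have dist: "distinct c" by (rule pth_distinct[OF pc])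
  have len: "length c = ?n" using c(2) dist by (metis distinct_card)
  show ?thesis
  proof (cases "?n \<le> l + 1")
    case True
    then show ?thesis using c l len by (intro exI[of _ c]) auto
  next
    case big: False
    show ?thesis
    proof (rule ccontr)
      assume no: "\<not> ?thesis"
      have no': False if "cyc z" "set z \<subseteq> V" "length z = l \<or> length z = l + 1" for z
      proof -
        have "l \<le> length z" "length z \<le> l + 1" using that(3) by auto
        then show False using no that(1,2) by blast
      qed
      define a b where "a = c ! 0" and "b = c ! (?n - 1)"
      have ne: "c \<noteq> []" by (rule pth_ne[OF pc])
      have ab: "a = hd c" "b = last c" using ne len by (simp_all add: a_def b_def hd_conv_nth last_conv_nth)
      have adjc: "adj (c ! i) (c ! Suc i)" if "Suc i < ?n" for i
        using pc that len by (simp add: pth_def successively_conv_nth)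
      define N0 where "N0 = {j. 1 \<le> j \<and> j \<le> ?n - 1 \<and> adj a (c ! j)}"
      define N1 where "N1 = {k. k \<le> ?n - 2 \<and> adj b (c ! k)}"
      have fin01: "finite N0" "finite N1" by (auto simp: N0_def N1_def)
      have aV: "a \<in> V" "b \<in> V" using ab ne c(2) by auto
      have N0c: "?n \<le> 2 * card N0"
      proof -
        have "{u \<in> V. adj a u} \<subseteq> (!) c ` N0"
        proof
          fix u assume u: "u \<in> {u \<in> V. adj a u}"
          then obtain i where i: "i < ?n" "c ! i = u" using c(2) len by (metis (no_types, lifting) in_set_conv_nth mem_Collect_eq)
          have "i \<noteq> 0" using u i(2) a_def adj_irrefl by (metis mem_Collect_eq)
          then show "u \<in> (!) c ` N0" using i u by (auto simp: N0_def)
        qed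
        then have "card {u \<in> V. adj a u} \<le> card N0" by (rule surj_card_le[OF fin01(1)])
        then show ?thesis using deg[OF aV(1)] by linarith
      qed
      have N1c: "?n \<le> 2 * card N1"
      proof -
        have "{u \<in> V. adj b u} \<subseteq> (!) c ` N1"
        proof
          fix u assume u: "u \<in> {u \<in> V. adj b u}"
          then obtain i where i: "i < ?n" "c ! i = u" using c(2) len by (metis (no_types, lifting) in_set_conv_nth mem_Collect_eq)
          have "i \<noteq> ?n - 1" using u i(2) b_def adj_irrefl by auto
          then show "u \<in> (!) c ` N1" using i u by (auto simp: N1_def)
        qed
        then have "card {u \<in> V. adj b u} \<le> card N1" by (rule surj_card_le[OF fin01(2)])
        then show ?thesis using deg[OF aV(2)] by linarith
      qed
      \<comment> \<open>The cycle \<open>a\<close>, \<open>c ! j\<close>, ...,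
        \<open>c ! (j + t)\<close>, \<open>b\<close> has length \<open>t + 3\<close>.\<close>
      have t1: "j + t \<notin> N1" if j: "j \<in> N0" "j + t \<le> ?n - 2" and t: "t + 3 = l \<or> t + 3 = l + 1" for j t
      proof
        assume k: "j + t \<in> N1"
        let ?s = "take (Suc t) (drop j c)"
        have ls: "length ?s = Suc t" using j len l by auto
        have sne: "?s \<noteq> []" using ls by auto
        have ps: "pth ?s"
        proof -
          have "pth (drop j c)" using pth_appendD2[of "take j c" "drop j c"] pc j len l by simp
          then show ?thesis using pth_appendD1[of ?s "drop (Suc t) (drop j c)"] sne by (simp del: drop_drop)
        qed
        have nths: "?s ! i = c ! (j + i)" if "i < Suc t" for i using that j len by simp
        have hs: "hd ?s = c ! j" using sne nths[of 0] by (simp add: hd_conv_nth)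
        have lls: "last ?s = c ! (j + t)" using sne nths[of t] ls by (simp add: last_conv_nth)
        have mem: "\<exists>i. 1 \<le> i \<and> i \<le> ?n - 2 \<and> y = c ! i" if "y \<in> set ?s" for y
        proof -
          obtain i where "i < Suc t" "y = c ! (j + i)" using \<open>y \<in> set ?s\<close> nths ls by (metis in_set_conv_nth)
          then show ?thesis using j by (intro exI[of _ "j + i"]) (auto simp: N0_def)
        qed
        have as: "a \<notin> set ?s" "b \<notin> set ?s"
          using mem[of a] mem[of b] dist len l unfolding a_def b_def by (auto simp: nth_eq_iff_index_eq)
        have anb: "a \<noteq> b" using dist len l unfolding a_def b_def by (simp add: nth_eq_iff_index_eq)
        have p1: "pth (?s @ [b])"
          using ps sne as(2) lls k adj_sym by (subst pth_append) (auto simp: N1_def)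
        have p2: "pth ([a] @ (?s @ [b]))"
          using p1 sne as(1) anb hs j(1) by (subst pth_append) (auto simp: N0_def hd_append)
        have "cyc ([a] @ (?s @ [b]))" using p2 ls cl ab by (simp add: cyc_def)
        moreover have "set ([a] @ (?s @ [b])) \<subseteq> V"
          using aV c(2) set_take_subset[of "Suc t" "drop j c"] set_drop_subset[of j c] by auto
        ultimately show False using no'[of "[a] @ (?s @ [b])"] ls t by auto
      qed
      \<comment> \<open>From \<open>a\<close> along \<open>c\<close> to \<open>c ! (j - e)\<close>,
        by a chord to \<open>b\<close>, backwards along \<open>c\<close> to \<open>c ! j\<close> and
        by a chord to \<open>a\<close>: length \<open>?n + 1 - e\<close>.\<close>
      have t2: "j - e \<notin> N1" if j: "j \<in> N0" "e \<le> j" "1 \<le> e" and t: "e + l = ?n + 1 \<or> e + l = ?n" for j e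
      proof
        assume k: "j - e \<in> N1"
        let ?x = "take (Suc (j - e)) c" and ?y = "drop j c"
        have jn: "j < ?n" using j l by (auto simp: N0_def)
        have nx: "?x \<noteq> []" "?y \<noteq> []" using ne jn len by auto
        have px: "pth ?x" using pth_appendD1[of ?x "drop (Suc (j - e)) c"] pc nx by simp
        have py: "pth ?y" using pth_appendD2[of "take j c" ?y] pc nx by simp
        have dxy: "set ?x \<inter> set ?y = {}" using dist j by (intro set_take_disj_set_drop_if_distinct) auto
        have lx: "last ?x = c ! (j - e)" using jn len by (simp add: take_Suc_conv_app_nth)
        have ly: "last ?y = b" using nx ab by (simp add: last_drop)
        have hy: "hd ?y = c ! j" using jn len by (simp add: hd_drop_conv_nth)
        have hx: "hd ?x = a" using ab ne by (cases c) auto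
        have p: "pth (?x @ rev ?y)"
          using px py nx dxy lx ly k adj_sym by (subst pth_append) (auto simp: hd_rev N1_def)
        have ll: "length (?x @ rev ?y) = Suc (j - e) + (?n - j)" using jn len by simp
        have ll': "length (?x @ rev ?y) = l \<or> length (?x @ rev ?y) = l + 1" unfolding ll using t j jn by auto
        have "last (?x @ rev ?y) = c ! j" "hd (?x @ rev ?y) = a" using nx hy hx by (simp_all add: last_rev)
        then have "cyc (?x @ rev ?y)" using p ll' l j(1) adj_sym by (auto simp: cyc_def N0_def)
        moreover have "set (?x @ rev ?y) \<subseteq> V"
          using c(2) set_take_subset[of "Suc (j - e)" c] set_drop_subset[of j c] by auto
        ultimately show False using no'[of "?x @ rev ?y"] ll' by blast
      qed
      \<comment> \<open>With these values both kinds of cycle have length \<open>l\<close>. As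
        \<open>d + e = ?n - 2\<close>, the sets \<open>X\<close> and \<open>Y\<close> together are
        \<open>N0\<close> shifted by \<open>d\<close> modulo \<open>?n - 2\<close>, where
        \<open>e\<close> appears at both ends of the range.\<close>
      define d where "d = l - 3"
      define e where "e = ?n - 2 - d"
      have de: "d + e = ?n - 2" "1 \<le> d" "2 \<le> e" using l big by (auto simp: d_def e_def)
      define X where "X = (\<lambda>j. j + d) ` {j \<in> N0. j \<le> e}"
      define Y where "Y = (\<lambda>j. j - e) ` {j \<in> N0. e \<le> j}"
      have finXY: "finite X" "finite Y" using fin01 by (auto simp: X_def Y_def)
      have XY1: "(X \<union> Y) \<inter> N1 = {}"
      proof -
        have "x \<notin> N1" if x: "x \<in> X" for x
        proof -
          obtain j where "j \<in> N0" "j \<le> e" "x = j + d" using x by (auto simp: X_def)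
          then show ?thesis using t1[of j d] de l by (auto simp: d_def)
        qed
        moreover have "x \<notin> N1" if x: "x \<in> Y" for x
        proof -
          obtain j where "j \<in> N0" "e \<le> j" "x = j - e" using x by (auto simp: Y_def)
          moreover have "e + l = ?n + 1" unfolding e_def d_def using l big by linarith
          moreover have "1 \<le> e" using de by simp
          ultimately show ?thesis using t2[of j e] by simp
        qed
        ultimately show ?thesis by blast
      qed
      have sub: "X \<union> Y \<union> N1 \<subseteq> {..?n - 2}"
        using de by (auto simp: X_def Y_def N1_def N0_def)
      have cX: "card X = card {j \<in> N0. j \<le> e}" unfolding X_def by (rule card_image) (auto simp: inj_on_def)
      have cY: "card Y = card {j \<in> N0. e \<le> j}" unfolding Y_def by (rule card_image) (auto simp: inj_on_def)
      have iXY: "X \<inter> Y \<subseteq> {Suc d}"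
      proof
        fix x assume x: "x \<in> X \<inter> Y"
        then obtain j j' where "j \<in> N0" "x = j + d" "j' \<in> N0" "x = j' - e" by (auto simp: X_def Y_def)
        then have "1 \<le> j" "j' \<le> ?n - 1" "x = j + d" "x = j' - e" by (auto simp: N0_def)
        then show "x \<in> {Suc d}" using de by simp
      qed
      have cXY: "card X + card Y \<le> card (X \<union> Y) + 1"
        using card_Un_Int[OF finXY] card_mono[OF _ iXY] by simp
      have cN: "card X + card Y = card N0 + (if e \<in> N0 then 1 else 0)"
      proof -
        have "card {j \<in> N0. j \<le> e} + card {j \<in> N0. e \<le> j} = card ({j \<in> N0. j \<le> e} \<union> {j \<in> N0. e \<le> j}) + card ({j \<in> N0. j \<le> e} \<inter> {j \<in> N0. e \<le> j})"
          using fin01 by (intro card_Un_Int) auto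
        also have "{j \<in> N0. j \<le> e} \<union> {j \<in> N0. e \<le> j} = N0" by auto
        also have "{j \<in> N0. j \<le> e} \<inter> {j \<in> N0. e \<le> j} = (if e \<in> N0 then {e} else {})" by auto
        finally show ?thesis using cX cY by simp
      qed
      have tot: "card (X \<union> Y) + card N1 = card (X \<union> Y \<union> N1)"
        using XY1 finXY fin01 by (intro card_Un_disjoint[symmetric]) auto
      have le: "card (X \<union> Y \<union> N1) \<le> ?n - 1" using card_mono[OF _ sub] de by simp
      \<comment> \<open>Both \<open>N0\<close> and \<open>N1\<close> have at least
        \<open>?n / 2\<close> elements, only \<open>?n - 1\<close> positions exist, and
        \<open>X\<close> and \<open>Y\<close> share at most one: there is no slack left for a doubly
        counted \<open>e\<close>.\<close>
      have eN0: "e \<notin> N0" using tot le cN cXY N0c N1c l by (auto split: if_splits)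
      have "card (X \<union> Y \<union> N1) = card {..?n - 2}" using tot le cN cXY N0c N1c l de by simp
      then have eq: "X \<union> Y \<union> N1 = {..?n - 2}" using sub by (intro card_subset_eq) auto
      \<comment> \<open>The missing length \<open>l + 1\<close> keeps \<open>j + d + 1\<close> out
        of \<open>N1\<close>, so by \<open>eq\<close> it lies in \<open>X\<close> or
        \<open>Y\<close>, and for \<open>Y\<close> it is too large. Hence \<open>N0\<close> passes
        from \<open>j\<close> to \<open>j + 1\<close>, up to the forbidden \<open>e\<close>.\<close>
      have "1 \<le> j \<Longrightarrow> j \<le> e \<Longrightarrow> j \<in> N0" for j
      proof (induction j rule: nat_induct_at_least)
        case base
        have "adj (c ! 0) (c ! Suc 0)" by (rule adjc) (use l big in simp)
        then show ?case using l by (auto simp: N0_def a_def)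
      next
        case (Suc j)
        have jN: "j \<in> N0" using Suc by simp
        have "j + (d + 1) \<notin> N1" by (rule t1[OF jN]) (use Suc de l in \<open>auto simp: d_def\<close>)
        moreover have "j + (d + 1) \<in> {..?n - 2}" using Suc.prems de by simp
        ultimately have "j + (d + 1) \<in> X \<union> Y" using eq by blast
        then show ?case
        proof
          assume "j + (d + 1) \<in> X"
          then obtain j' where "j' \<in> N0" "j + (d + 1) = j' + d" by (auto simp: X_def)
          then show ?thesis by simp
        next
          assume "j + (d + 1) \<in> Y"
          then obtain j' where "j' \<in> N0" "e \<le> j'" "j + (d + 1) = j' - e" by (auto simp: Y_def)
          then show ?thesis using de Suc.hyps by (auto simp: N0_def)
        qed
      qed
      then show False using eN0 de by simp
    qed
  qed
qed

section \<open>Subtrees of a breadth-first tree\<close>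

text \<open>Depth-first search with finished set \<open>X\<close> and stack \<open>P\<close>: stop when one more finished vertex would push the
  weight of \<open>X\<close> above \<open>\<theta>\<close>.\<close>

lemma dfs_split:
  fixes wt :: "'a \<Rightarrow> nat"
  assumes fin: "finite R" and wt: "\<And>x. x \<in> R \<Longrightarrow> wt x \<le> s" and \<theta>: "\<theta> \<le> sum wt R"
    and short: "\<And>p. pth p \<Longrightarrow> set p \<subseteq> R \<Longrightarrow> length p < M"
  shows "\<exists>X P. X \<subseteq> R \<and> P \<subseteq> R \<and> X \<inter> P = {} \<and> card P \<le> M \<and> nb R X \<subseteq> P \<and> sum wt X \<le> \<theta> \<and> \<theta> \<le> sum wt X + s"
proof -
  define st where "st Xp \<longleftrightarrow> (case Xp of (X, p) \<Rightarrow> X \<subseteq> R \<and> set p \<subseteq> R - X \<and> (p = [] \<or> pth p) \<and>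
    nb R X \<subseteq> set p \<and> sum wt X \<le> \<theta>)" for Xp :: "'a set \<times> 'a list"
  \<comment> \<open>Lexicographic order: finishing one more vertex outweighs any change of the
    stack, whose length is at most \<open>card R\<close>. A state that maximizes \<open>ms\<close>
    is where the search stops.\<close>
  define ms where "ms Xp = (case Xp of (X, p) \<Rightarrow> card X * (card R + 2) + length p)" for Xp :: "'a set \<times> 'a list"
  have st0: "st ({}, [])" by (simp add: st_def nb_def)
  have pl: "length p \<le> card R" if "pth p" "set p \<subseteq> R" for p
    using that fin by (metis card_mono distinct_card pth_distinct)
  have bd: "\<forall>Xp. st Xp \<longrightarrow> ms Xp < card R * (card R + 2) + card R + 1"
  proof (intro allI impI)
    fix Xp assume a: "st Xp"
    obtain X p where Xp: "Xp = (X, p)" by (cases Xp)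
    have "X \<subseteq> R" "set p \<subseteq> R" "p = [] \<or> pth p" using a by (auto simp: st_def Xp)
    then have "card X \<le> card R" "length p \<le> card R" using fin pl by (auto intro: card_mono)
    then have "card X * (card R + 2) \<le> card R * (card R + 2)" by (intro mult_le_mono1)
    then show "ms Xp < card R * (card R + 2) + card R + 1"
      using \<open>length p \<le> card R\<close> by (simp add: ms_def Xp)
  qed
  from ex_has_greatest_nat[of st, OF st0 bd]
  obtain Xp where Xp0: "st Xp" and mx0: "\<And>Yp. st Yp \<Longrightarrow> ms Yp \<le> ms Xp" by blast
  obtain X p where Xp: "Xp = (X, p)" by (cases Xp)
  have mx: "card Y * (card R + 2) + length q \<le> card X * (card R + 2) + length p" if "st (Y, q)" for Y q
    using mx0[OF that] by (simp add: ms_def Xp)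
  have X: "X \<subseteq> R" and p: "set p \<subseteq> R - X" "p = [] \<or> pth p" and nbX: "nb R X \<subseteq> set p" and wX: "sum wt X \<le> \<theta>"
    using Xp0 by (auto simp: st_def Xp)
  have finX: "finite X" using X fin by (rule finite_subset)
  have big: "\<theta> \<le> sum wt X + s"
  proof (cases "p = []")
    case True
    show ?thesis
    proof (cases "X = R")
      case True
      then show ?thesis using \<theta> by simp
    next
      case False
      then obtain y where y: "y \<in> R - X" using X by blast
      then have "st (X, [y])" using X nbX wX \<open>p = []\<close> by (auto simp: st_def)
      then show ?thesis using mx[of X "[y]"] True by simp
    qed
  next
    case ne: False
    then have pp: "pth p" using p by simp
    let ?v = "last p" and ?p = "butlast p"
    have vp: "?v \<in> set p" using ne by simp
    have dec: "p = ?p @ [?v]" using ne by simp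
    have vR: "?v \<in> R" "?v \<notin> X" using vp p by auto
    have noext: "y \<in> X \<union> set p" if y: "y \<in> R" "adj ?v y" for y
    proof (rule ccontr)
      assume n: "y \<notin> X \<union> set p"
      then have "pth (p @ [y])" using pp ne y by (subst pth_append) auto
      then have "st (X, p @ [y])" using X p nbX wX y n by (auto simp: st_def)
      then show False using mx[of X "p @ [y]"] by simp
    qed
    have dp: "distinct p" by (rule pth_distinct[OF pp])
    have nb': "nb R (insert ?v X) \<subseteq> set ?p"
    proof
      fix y assume y: "y \<in> nb R (insert ?v X)"
      then have "y \<in> set p" using noext[of y] nbX by (auto simp: nb_def)
      moreover have "y \<noteq> ?v" using y by (auto simp: nb_def)
      ultimately show "y \<in> set ?p" using dec by (metis Un_iff empty_iff empty_set set_ConsD set_append)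
    qed
    show ?thesis
    proof (rule ccontr)
      assume n: "\<not> ?thesis"
      have "sum wt (insert ?v X) = wt ?v + sum wt X" using finX vR by simp
      also have "\<dots> \<le> \<theta>" using wt[OF vR(1)] n by simp
      finally have w': "sum wt (insert ?v X) \<le> \<theta>" .
      have "?v \<notin> set ?p" using dp dec by (metis distinct_append disjoint_insert(1) list.simps(15) not_distinct_conv_prefix)
      then have "set ?p \<subseteq> R - insert ?v X" using p(1) by (auto dest: in_set_butlastD)
      moreover have "?p = [] \<or> pth ?p" using pp dec pth_appendD1[of ?p "[?v]"] by auto
      ultimately have "st (insert ?v X, ?p)" using X vR nb' w' by (auto simp: st_def)
      from mx[OF this] show False using finX vR ne by simp
    qed
  qed
  have "card (set p) \<le> M"
  proof (cases "p = []")
    case False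
    then have "length p < M" using p short by auto
    then show ?thesis using card_length[of p] by linarith
  qed simp
  then show ?thesis using X p nbX wX big by (intro exI[of _ X] exI[of _ "set p"]) auto
qed

end

locale bfs = sgraph adj for adj :: "'a \<Rightarrow> 'a \<Rightarrow> bool" +
  fixes V :: "'a set" and r :: 'a
  assumes finV: "finite V" and rV: "r \<in> V"
begin

fun ball :: "nat \<Rightarrow> 'a set" where
  "ball 0 = {r}"
| "ball (Suc i) = ball i \<union> nb V (ball i)"

text \<open>Meaningful only for vertices in some ball, hence the hypothesis
  \<open>v \<in> ball i\<close> throughout.\<close>

definition dep :: "'a \<Rightarrow> nat" where
  "dep v = (LEAST i. v \<in> ball i)"

definition par :: "'a \<Rightarrow> 'a" where
  "par v = (SOME u. adj u v \<and> u \<in> ball (dep v - 1) \<and> dep u = dep v - 1)"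

text \<open>Indexed by the depth reached, not by the number of steps, so that ancestors of different
  vertices on one level can be compared. For \<open>h > dep v\<close> it is \<open>v\<close> itself
  by truncated subtraction.\<close>

definition anc :: "'a \<Rightarrow> nat \<Rightarrow> 'a" where
  "anc v h = (par ^^ (dep v - h)) v"

definition chain :: "'a \<Rightarrow> nat \<Rightarrow> 'a list" where
  "chain v h = map (anc v) [h..<Suc (dep v)]"

lemma ball_V: "ball i \<subseteq> V"
  by (induction i) (use rV nb_subset in auto)

lemma fin_ball: "finite (ball i)"
  using ball_V finV by (rule finite_subset)

lemma ball_mono: "i \<le> j \<Longrightarrow> ball i \<subseteq> ball j"
  by (induction j) (auto simp: le_Suc_eq)

lemma dep_le: "v \<in> ball i \<Longrightarrow> dep v \<le> i"
  unfolding dep_def by (rule Least_le)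

lemma in_ball_dep: "v \<in> ball i \<Longrightarrow> v \<in> ball (dep v)"
  unfolding dep_def by (rule LeastI)

lemma ball_iff: "v \<in> ball i \<Longrightarrow> v \<in> ball j \<longleftrightarrow> dep v \<le> j"
  using dep_le in_ball_dep ball_mono by blast

lemma ball_step: "u \<in> ball i \<Longrightarrow> adj u v \<Longrightarrow> v \<in> V \<Longrightarrow> v \<in> ball (Suc i)"
  by (auto simp: nb_def)

lemma dep_step: "u \<in> ball i \<Longrightarrow> adj u v \<Longrightarrow> v \<in> V \<Longrightarrow> dep v \<le> Suc (dep u)"
  by (rule dep_le, rule ball_step[OF in_ball_dep])

lemma par_props:
  assumes v: "v \<in> ball i" "0 < dep v"
  shows "adj (par v) v" "dep (par v) = dep v - 1" "par v \<in> ball i"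
proof -
  obtain j where j: "dep v = Suc j" using v(2) by (cases "dep v") auto
  have "v \<in> ball (Suc j)" using in_ball_dep[OF v(1)] j by simp
  moreover have "v \<notin> ball j" using dep_le[of v j] j by auto
  ultimately obtain u where u: "u \<in> ball j" "adj u v" and vV: "v \<in> V" by (auto simp: nb_def)
  have "dep u = j"
    using dep_le[OF u(1)] dep_step[OF u vV] j by simp
  then have "\<exists>u. adj u v \<and> u \<in> ball (dep v - 1) \<and> dep u = dep v - 1" using u j by auto
  then have *: "adj (par v) v \<and> par v \<in> ball (dep v - 1) \<and> dep (par v) = dep v - 1"
    unfolding par_def by (rule someI_ex)
  then show "adj (par v) v" "dep (par v) = dep v - 1" by auto
  have "dep v - 1 \<le> i" using dep_le[OF v(1)] by simp
  then show "par v \<in> ball i" using * ball_mono by blast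
qed

lemma funpow_par:
  assumes "v \<in> ball i" "k \<le> dep v"
  shows "(par ^^ k) v \<in> ball i \<and> dep ((par ^^ k) v) = dep v - k"
  using assms(2)
proof (induction k)
  case (Suc k)
  then have IH: "(par ^^ k) v \<in> ball i" "dep ((par ^^ k) v) = dep v - k" by auto
  then have "0 < dep ((par ^^ k) v)" using Suc.prems by simp
  from par_props[OF IH(1) this] show ?case using IH(2) by simp
qed (use assms in simp)

lemma anc_props:
  assumes "v \<in> ball i" "h \<le> dep v"
  shows "anc v h \<in> ball i" "dep (anc v h) = h"
  using funpow_par[OF assms(1), of "dep v - h"] assms(2) by (auto simp: anc_def)

lemma anc_self [simp]: "anc v (dep v) = v"
  by (simp add: anc_def)

lemma anc_adj:
  assumes "v \<in> ball i" "h < dep v"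
  shows "adj (anc v h) (anc v (Suc h))"
proof -
  have "dep v - h = Suc (dep v - Suc h)" using assms(2) by simp
  then have "anc v h = par (anc v (Suc h))" by (simp add: anc_def)
  then show ?thesis using par_props(1)[of "anc v (Suc h)" i] anc_props[OF assms(1), of "Suc h"] assms(2) by simp
qed

lemma anc_anc:
  assumes "v \<in> ball i" "h' \<le> h" "h \<le> dep v"
  shows "anc (anc v h) h' = anc v h'"
proof -
  have "anc (anc v h) h' = (par ^^ (h - h')) ((par ^^ (dep v - h)) v)"
    using anc_props(2)[OF assms(1,3)] by (simp add: anc_def)
  also have "\<dots> = (par ^^ ((h - h') + (dep v - h))) v" by (simp add: funpow_add)
  also have "(h - h') + (dep v - h) = dep v - h'" using assms by simp
  finally show ?thesis by (simp add: anc_def)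
qed

lemma anc_0: "v \<in> ball i \<Longrightarrow> anc v 0 = r"
proof -
  assume v: "v \<in> ball i"
  have "anc v 0 \<in> ball i" "dep (anc v 0) = 0" using anc_props[OF v, of 0] by auto
  then have "anc v 0 \<in> ball 0" using in_ball_dep by metis
  then show ?thesis by simp
qed

lemma chain_props:
  assumes v: "v \<in> ball i" and h: "h \<le> dep v"
  shows "pth (chain v h)" "hd (chain v h) = anc v h" "last (chain v h) = v" "length (chain v h) = dep v - h + 1"
    "set (chain v h) = anc v ` {h..dep v}"
proof -
  have ne: "[h..<Suc (dep v)] \<noteq> []" using h by simp
  have inj: "inj_on (anc v) {h..dep v}"
    by (rule inj_on_inverseI[of _ dep]) (use anc_props(2)[OF v] in auto)
  show "set (chain v h) = anc v ` {h..dep v}" by (simp add: chain_def atLeastLessThanSuc_atLeastAtMost del: upt_Suc)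
  have "distinct (chain v h)"
    using inj by (simp add: chain_def distinct_map atLeastLessThanSuc_atLeastAtMost del: upt_Suc)
  moreover have "successively adj (chain v h)"
    unfolding successively_conv_nth
    using anc_adj[OF v] by (auto simp: chain_def simp del: upt_Suc)
  ultimately show "pth (chain v h)" using ne by (auto simp: pth_def chain_def simp del: upt_Suc)
  show "hd (chain v h) = anc v h" using ne h by (simp add: chain_def hd_map del: upt_Suc)
  show "last (chain v h) = v" using h by (simp add: chain_def)
  show "length (chain v h) = dep v - h + 1" using h by (simp add: chain_def del: upt_Suc)
qed

end

section \<open>A window of levels and its groups of light vertices\<close>

locale bfs_window = bfs adj V r for adj :: "'a \<Rightarrow> 'a \<Rightarrow> bool" and V r +
  fixes t1 t2 s :: nat
  assumes t12: "t1 < t2"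
begin

definition Wd :: "'a set" where
  "Wd = {v \<in> ball t2. t1 < dep v}"

text \<open>\<open>sub v\<close> are the descendants of \<open>v\<close> in the window. A light vertex \<open>u\<close> belongs to the group of its topmost light
  ancestor \<open>rt u\<close>, at depth \<open>gh u\<close>.\<close>

definition sub :: "'a \<Rightarrow> 'a set" where
  "sub v = {u \<in> Wd. dep v \<le> dep u \<and> anc u (dep v) = v}"

definition light :: "'a \<Rightarrow> bool" where
  "light v \<longleftrightarrow> v \<in> Wd \<and> card (sub v) \<le> s"

definition gh :: "'a \<Rightarrow> nat" where
  "gh u = (LEAST h. h \<le> dep u \<and> light (anc u h))"

definition rt :: "'a \<Rightarrow> 'a" where
  "rt u = anc u (gh u)"

definition grp :: "'a \<Rightarrow> 'a set" where
  "grp x = {u. light u \<and> rt u = x}"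

definition roots :: "'a set" where
  "roots = rt ` {u. light u}"

lemma Wd_ball: "v \<in> Wd \<Longrightarrow> v \<in> ball t2"
  by (simp add: Wd_def)

lemma fin_Wd: "finite Wd"
  using fin_ball by (simp add: Wd_def)

lemma light_ball: "light v \<Longrightarrow> v \<in> ball t2"
  by (simp add: light_def Wd_def)

lemma light_dep: "light v \<Longrightarrow> t1 < dep v \<and> dep v \<le> t2"
  using dep_le by (auto simp: light_def Wd_def)

lemma fin_light: "finite {u. light u}"
  by (rule finite_subset[OF _ fin_Wd]) (auto simp: light_def)

lemma sub_mono:
  assumes u: "u \<in> ball t2" "h \<le> h'" "h' \<le> dep u"
  shows "sub (anc u h') \<subseteq> sub (anc u h)"
proof
  fix w assume w: "w \<in> sub (anc u h')"
  have d: "dep (anc u h') = h'" "dep (anc u h) = h" using anc_props(2)[OF u(1)] u by auto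
  have w': "w \<in> Wd" "h' \<le> dep w" "anc w h' = anc u h'" using w d by (auto simp: sub_def)
  have "anc w h = anc (anc w h') h" using anc_anc[OF Wd_ball[OF w'(1)] u(2) w'(2)] by simp
  also have "\<dots> = anc u h" using anc_anc[OF u(1,2,3)] w'(3) by simp
  finally show "w \<in> sub (anc u h)" using w' d u by (auto simp: sub_def)
qed

lemma light_down:
  assumes u: "u \<in> ball t2" "h \<le> h'" "h' \<le> dep u" and l: "light (anc u h)"
  shows "light (anc u h')"
proof -
  have d: "dep (anc u h') = h'" "dep (anc u h) = h" using anc_props(2)[OF u(1)] u by auto
  have "anc u h' \<in> ball t2" using anc_props(1)[OF u(1,3)] .
  moreover have "t1 < h'" using light_dep[OF l] d u by simp
  moreover have "card (sub (anc u h')) \<le> card (sub (anc u h))"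
    using sub_mono[OF u] fin_Wd by (intro card_mono) (auto simp: sub_def)
  ultimately show ?thesis using l d by (auto simp: light_def Wd_def)
qed

lemma gh_props:
  assumes "light u"
  shows "gh u \<le> dep u" "light (rt u)" "h < gh u \<Longrightarrow> \<not> light (anc u h)"
proof -
  have "dep u \<le> dep u \<and> light (anc u (dep u))" using assms by simp
  then have "gh u \<le> dep u \<and> light (anc u (gh u))" unfolding gh_def by (rule LeastI)
  then show "gh u \<le> dep u" "light (rt u)" by (auto simp: rt_def)
  show "\<not> light (anc u h)" if h: "h < gh u"
  proof
    assume "light (anc u h)"
    moreover have "h \<le> dep u" using h \<open>gh u \<le> dep u \<and> _\<close> by simp
    ultimately have "gh u \<le> h" unfolding gh_def by (intro Least_le) simp
    then show False using h by simp
  qed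
qed

lemma dep_rt: "light u \<Longrightarrow> dep (rt u) = gh u"
  using anc_props(2)[OF light_ball gh_props(1)] by (simp add: rt_def)

text \<open>Light vertices form full subtrees: an ancestor of a light vertex is light iff it lies in the same group.\<close>

lemma rt_anc:
  assumes l: "light u" and h: "h \<le> dep u" "light (anc u h)"
  shows "rt (anc u h) = rt u"
proof -
  have ub: "u \<in> ball t2" by (rule light_ball[OF l])
  have d: "dep (anc u h) = h" using anc_props(2)[OF ub h(1)] .
  have le: "gh u \<le> h" using gh_props(3)[OF l, of h] h(2) by force
  have e: "anc (anc u h) g = anc u g" if "g \<le> h" for g using anc_anc[OF ub that h(1)] .
  have "gh (anc u h) = gh u"
  proof (rule antisym)
    have "light (anc (anc u h) (gh u))" using e[OF le] gh_props(2)[OF l] by (simp add: rt_def)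
    then show "gh (anc u h) \<le> gh u" unfolding gh_def[of "anc u h"] using le d by (intro Least_le) simp
    have "gh (anc u h) \<le> h" using gh_props(1)[OF h(2)] d by simp
    then have "light (anc u (gh (anc u h)))" using gh_props(2)[OF h(2)] e by (simp add: rt_def)
    then show "gh u \<le> gh (anc u h)" using gh_props(3)[OF l, of "gh (anc u h)"] by force
  qed
  then show ?thesis using e[OF le] by (simp add: rt_def)
qed

lemma rt_rt: "light u \<Longrightarrow> rt (rt u) = rt u"
  using rt_anc[of u "gh u"] gh_props by (simp add: rt_def)

lemma rootsD:
  assumes "x \<in> roots"
  shows "light x" "rt x = x" "x \<in> grp x"
proof -
  obtain u where u: "light u" "x = rt u" using assms by (auto simp: roots_def)
  show "light x" using gh_props(2) u by simp
  show "rt x = x" using rt_rt u by simp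
  then show "x \<in> grp x" using \<open>light x\<close> by (simp add: grp_def)
qed

lemma fin_roots: "finite roots"
  using fin_light by (simp add: roots_def)

lemma grp_light: "u \<in> grp x \<Longrightarrow> light u"
  by (simp add: grp_def)

lemma grp_disj: "x \<noteq> y \<Longrightarrow> grp x \<inter> grp y = {}"
  by (auto simp: grp_def)

lemma fin_grp: "finite (grp x)"
  by (rule finite_subset[OF _ fin_light]) (auto simp: grp_def)

lemma grp_anc:
  assumes "u \<in> grp x" "h \<le> dep x"
  shows "dep x \<le> dep u" "anc u h = anc x h" "anc u (dep x) = x"
proof -
  have l: "light u" and x: "x = rt u" using assms by (auto simp: grp_def)
  have d: "dep x = gh u" using dep_rt[OF l] x by simp
  show "dep x \<le> dep u" using gh_props(1)[OF l] d by simp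
  show e: "anc u (dep x) = x" using x d by (simp add: rt_def)
  show "anc u h = anc x h" using anc_anc[OF light_ball[OF l] assms(2) \<open>dep x \<le> dep u\<close>] e by simp
qed

lemma grp_card: "x \<in> roots \<Longrightarrow> card (grp x) \<le> s"
proof -
  assume x: "x \<in> roots"
  have "grp x \<subseteq> sub x"
    using grp_anc(1,3)[of _ x 0] grp_light by (auto simp: sub_def light_def)
  then have "card (grp x) \<le> card (sub x)" using fin_Wd by (intro card_mono) (auto simp: sub_def)
  then show ?thesis using rootsD(1)[OF x] by (simp add: light_def)
qed

lemma chain_grp:
  assumes "u \<in> grp x"
  shows "set (chain u (dep x)) \<subseteq> grp x"
proof
  have l: "light u" and x: "x = rt u" using assms by (auto simp: grp_def)
  have ub: "u \<in> ball t2" by (rule light_ball[OF l])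
  fix y assume "y \<in> set (chain u (dep x))"
  then obtain h where h: "dep x \<le> h" "h \<le> dep u" "y = anc u h"
    using chain_props(5)[OF ub, of "dep x"] grp_anc(1)[OF assms, of 0] by auto
  have "light (anc u (dep x))" using gh_props(2)[OF l] x dep_rt[OF l] by (simp add: rt_def)
  then have "light y" using light_down[OF ub h(1,2)] h(3) by simp
  then show "y \<in> grp x" using rt_anc[OF l h(2)] h(3) x by (simp add: grp_def)
qed

text \<open>A tree path towards the root thus avoids all groups but its own. This keeps tree paths
  disjoint from the stretch through other groups in \<open>cycle_from_split\<close>.\<close>

lemma chain_light_grp:
  assumes u: "u \<in> grp x" and h: "h \<le> dep u" and y: "y \<in> set (chain u h)" "light y"
  shows "y \<in> grp x"
proof -
  have l: "light u" and x: "x = rt u" using u by (auto simp: grp_def)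
  obtain g where "g \<le> dep u" "y = anc u g"
    using y(1) chain_props(5)[OF light_ball[OF l] h] by auto
  then show ?thesis using rt_anc[OF l] y(2) x by (simp add: grp_def)
qed

lemma grp_path:
  assumes "u \<in> grp x" "v \<in> grp x"
  shows "\<exists>p. pth p \<and> set p \<subseteq> grp x \<and> hd p = u \<and> last p = v \<and> length p \<le> 2 * (t2 - t1)"
proof -
  have lu: "light u" "light v" using assms grp_light by auto
  have b: "u \<in> ball t2" "v \<in> ball t2" using lu light_ball by auto
  have g: "dep x \<le> dep u" "anc u (dep x) = x" "dep x \<le> dep v" "anc v (dep x) = x"
    using grp_anc[OF assms(1), of 0] grp_anc[OF assms(2), of 0] by auto
  have lx: "t1 < dep x"
    using light_dep gh_props(2)[OF lu(1)] assms(1) by (auto simp: grp_def)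
  note cu = chain_props[OF b(1) g(1)] and cv = chain_props[OF b(2) g(3)]
  obtain c0 cs where cs: "chain v (dep x) = c0 # cs" using pth_ne[OF cv(1)] by (cases "chain v (dep x)") auto
  have c0: "c0 = x" using cv(2) cs g by simp
  let ?w = "rev (chain u (dep x)) @ cs"
  have "successively adj ?w"
  proof -
    have "successively adj (rev (chain u (dep x)))" using cu(1) pth_rev by (auto simp: pth_def)
    moreover have "successively adj cs" "cs \<noteq> [] \<Longrightarrow> adj c0 (hd cs)" using cv(1) cs by (auto simp: pth_def successively_Cons)
    moreover have "last (rev (chain u (dep x))) = x" using cu(2) g pth_ne[OF cu(1)] by (simp add: last_rev)
    ultimately show ?thesis using c0 by (auto simp: successively_append_iff)
  qed
  moreover have "?w \<noteq> []" using pth_ne[OF cu(1)] by simp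
  ultimately obtain p where p: "pth p" "hd p = hd ?w" "last p = last ?w" "set p \<subseteq> set ?w" "length p \<le> length ?w"
    using walk_to_pth by blast
  have "hd ?w = u" using cu(3) pth_ne[OF cu(1)] by (simp add: hd_rev)
  moreover have "last ?w = v"
  proof (cases "cs = []")
    case True
    then have "v = x" using cv(3) cs c0 by simp
    then show ?thesis using True cu(2) g pth_ne[OF cu(1)] by (simp add: last_rev)
  next
    case False
    then show ?thesis using cv(3) cs by simp
  qed
  moreover have "set ?w \<subseteq> grp x"
    using chain_grp[OF assms(1)] chain_grp[OF assms(2)] cs by auto
  moreover have "length ?w \<le> 2 * (t2 - t1)"
  proof -
    have "length ?w = dep u - dep x + 1 + (dep v - dep x)" using cu(4) cv(4) cs by simp
    moreover have "dep u \<le> t2" "dep v \<le> t2" using lu light_dep by auto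
    ultimately show ?thesis using lx g by linarith
  qed
  ultimately show ?thesis using p by (intro exI[of _ p]) auto
qed

text \<open>On one level the sets \<open>sub v\<close> are disjoint, and each heavy one has more
  than \<open>s\<close> elements; the window has \<open>t2 - t1\<close> levels.\<close>

lemma heavy_count: "s * card {v \<in> Wd. \<not> light v} \<le> (t2 - t1) * card V"
proof -
  let ?H = "{v \<in> Wd. \<not> light v}"
  have lvl: "s * card {v \<in> ?H. dep v = h} \<le> card V" for h
  proof -
    let ?Hh = "{v \<in> ?H. dep v = h}"
    have fin: "finite ?Hh" using fin_Wd by simp
    have "s * card ?Hh = (\<Sum>v\<in>?Hh. s)" by simp
    also have "\<dots> \<le> (\<Sum>v\<in>?Hh. card (sub v))" by (rule sum_mono) (auto simp: light_def)
    also have "\<dots> = card (\<Union>v\<in>?Hh. sub v)"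
      using fin fin_Wd by (intro card_UN_disjoint[symmetric]) (auto simp: sub_def)
    also have "\<dots> \<le> card V" using finV Wd_ball ball_V by (intro card_mono) (auto simp: sub_def)
    finally show ?thesis .
  qed
  have "?H \<subseteq> (\<Union>h\<in>{t1<..t2}. {v \<in> ?H. dep v = h})" using dep_le by (auto simp: Wd_def)
  then have "card ?H \<le> card (\<Union>h\<in>{t1<..t2}. {v \<in> ?H. dep v = h})" using fin_Wd by (intro card_mono) auto
  also have "\<dots> \<le> (\<Sum>h\<in>{t1<..t2}. card {v \<in> ?H. dep v = h})" by (rule card_UN_le) simp
  finally have "s * card ?H \<le> s * (\<Sum>h\<in>{t1<..t2}. card {v \<in> ?H. dep v = h})" by (rule mult_le_mono2)
  also have "\<dots> = (\<Sum>h\<in>{t1<..t2}. s * card {v \<in> ?H. dep v = h})" by (rule sum_distrib_left)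
  also have "\<dots> \<le> (\<Sum>h\<in>{t1<..t2}. card V)" by (rule sum_mono) (rule lvl)
  finally show ?thesis by simp
qed

definition radj :: "'a \<Rightarrow> 'a \<Rightarrow> bool" where
  "radj x y \<longleftrightarrow> x \<noteq> y \<and> (\<exists>u\<in>grp x. \<exists>v\<in>grp y. adj u v)"

sublocale R: sgraph radj
  using adj_sym by unfold_locales (unfold radj_def, blast+)

text \<open>Let \<open>U\<close> be the union of the finished groups. Edges change the depth by at
  most one, so a neighbour of \<open>U\<close> is in one of at most \<open>M\<close> groups on the
  stack, or heavy, or on one of the two levels bounding the window.\<close>

lemma long_group_path:
  fixes \<alpha> :: real
  assumes ex: "\<And>U. U \<subseteq> V \<Longrightarrow> 2 * card U \<le> card V \<Longrightarrow> \<alpha> * card U \<le> card (nb V U)" and \<alpha>: "0 < \<alpha>"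
    and \<theta>: "\<theta> \<le> card {u. light u}" "2 * \<theta> \<le> card V" "s \<le> \<theta>"
    and gt: "\<alpha> * real (\<theta> - s) > s * M + card {v \<in> Wd. \<not> light v} + card {v \<in> ball (Suc t2). dep v = t1 \<or> dep v = Suc t2}"
  shows "\<exists>p. R.pth p \<and> set p \<subseteq> roots \<and> M \<le> length p"
proof (rule ccontr)
  assume "\<not> ?thesis"
  then have short: "length p < M" if "R.pth p" "set p \<subseteq> roots" for p using that not_le by blast
  have dsum: "(\<Sum>x\<in>X. card (grp x)) = card (\<Union>x\<in>X. grp x)" if "X \<subseteq> roots" for X
    using that fin_roots finite_subset grp_disj fin_grp by (intro card_UN_disjoint[symmetric]) auto
  have "{u. light u} \<subseteq> (\<Union>x\<in>roots. grp x)" by (auto simp: roots_def grp_def)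
  then have "card {u. light u} \<le> (\<Sum>x\<in>roots. card (grp x))"
    unfolding dsum[OF order_refl] using fin_roots fin_grp by (intro card_mono) auto
  then have \<theta>r: "\<theta> \<le> (\<Sum>x\<in>roots. card (grp x))" using \<theta>(1) by linarith
  from R.dfs_split[OF fin_roots grp_card \<theta>r short]
  obtain X P where XP: "X \<subseteq> roots" "P \<subseteq> roots" "card P \<le> M" "R.nb roots X \<subseteq> P"
    "(\<Sum>x\<in>X. card (grp x)) \<le> \<theta>" "\<theta> \<le> (\<Sum>x\<in>X. card (grp x)) + s" by blast
  define U where "U = (\<Union>x\<in>X. grp x)"
  have cU: "card U \<le> \<theta>" "\<theta> \<le> card U + s" using XP dsum[OF XP(1)] by (simp_all add: U_def)
  have lU: "light u" if "u \<in> U" for u using that by (auto simp: U_def grp_def)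
  have UV: "U \<subseteq> V" using lU light_ball ball_V by blast
  let ?G = "\<Union>x\<in>P. grp x" and ?H = "{v \<in> Wd. \<not> light v}" and ?L = "{v \<in> ball (Suc t2). dep v = t1 \<or> dep v = Suc t2}"
  have finP: "finite P" using XP(2) fin_roots by (rule finite_subset)
  have "nb V U \<subseteq> ?G \<union> ?H \<union> ?L"
  proof
    fix v assume v: "v \<in> nb V U"
    then obtain u where u: "u \<in> U" "adj u v" and vV: "v \<in> V" "v \<notin> U" by (auto simp: nb_def)
    have ub: "u \<in> ball t2" and du: "t1 < dep u" "dep u \<le> t2" using lU[OF u(1)] light_ball light_dep by auto
    have vb: "v \<in> ball (Suc t2)" by (rule ball_step[OF ub u(2) vV(1)])
    have "dep u \<le> Suc (dep v)" using dep_step[OF vb adj_sym[OF u(2)]] ub ball_V by blast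
    then have d1: "t1 \<le> dep v" using du by simp
    have d2: "dep v \<le> Suc t2" by (rule dep_le[OF vb])
    show "v \<in> ?G \<union> ?H \<union> ?L"
    proof (cases "dep v = t1 \<or> dep v = Suc t2 \<or> \<not> light v")
      case True
      have "v \<in> ball t2" if "dep v \<le> t2" using ball_iff[OF vb] that by blast
      then show ?thesis using True vb d1 d2 by (auto simp: Wd_def le_Suc_eq)
    next
      case False
      then have lv: "light v" by simp
      have rv: "rt v \<in> roots" "v \<in> grp (rt v)" using lv by (auto simp: roots_def grp_def)
      obtain x where x: "x \<in> X" "u \<in> grp x" using u(1) by (auto simp: U_def)
      have "rt v \<notin> X" using vV(2) rv(2) by (auto simp: U_def)
      moreover from this have "radj x (rt v)" using x rv u(2) unfolding radj_def by blast
      ultimately have "rt v \<in> R.nb roots X" using rv x by (auto simp: R.nb_def)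
      then show ?thesis using XP(4) rv by blast
    qed
  qed
  moreover have "finite ?G" "finite ?H" using finP fin_grp fin_Wd by auto
  moreover have "finite ?L" by (rule finite_subset[OF _ fin_ball[of "Suc t2"]]) blast
  ultimately have "card (nb V U) \<le> card (?G \<union> ?H \<union> ?L)" by (intro card_mono) blast+
  also have "\<dots> \<le> card ?G + card ?H + card ?L"
    using card_Un_le[of "?G \<union> ?H" ?L] card_Un_le[of ?G ?H] by linarith
  also have "card ?G \<le> (\<Sum>x\<in>P. card (grp x))" by (rule card_UN_le[OF finP])
  also have "\<dots> \<le> (\<Sum>x\<in>P. s)" using XP(2) grp_card by (intro sum_mono) auto
  also have "\<dots> \<le> s * M" using XP(3) by simp
  finally have "real (card (nb V U)) \<le> s * M + card ?H + card ?L" by linarith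
  moreover have "\<alpha> * card U \<le> card (nb V U)" by (rule ex[OF UV]) (use cU \<theta> in linarith)
  moreover have "\<alpha> * real (\<theta> - s) \<le> \<alpha> * card U" using \<alpha> cU by (intro mult_left_mono) linarith+
  ultimately show False using gt by linarith
qed

text \<open>The condition \<open>2 * Suc i \<le> length p\<close> leaves half of the path behind the
  split, and every group there contributes at least one vertex, so a stretch long enough for
  \<open>l\<close> exists.\<close>

lemma cycle_from_split:
  assumes p: "R.pth p" "set p \<subseteq> roots"
    and h: "\<And>x. x \<in> set p \<Longrightarrow> h < dep x" "\<And>x. x \<in> set p \<Longrightarrow> anc x h = z"
    and i: "2 * Suc i \<le> length p" "anc (p ! i) (Suc h) \<noteq> anc (p ! Suc i) (Suc h)"
    and l: "2 * t1 + 3 \<le> l" "2 * (l + 2 * (t2 - t1) + 5) \<le> length p"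
  shows "\<exists>c. cyc c \<and> set c \<subseteq> V \<and> l \<le> length c \<and> length c \<le> l + 7 * (t2 - t1)"
proof -
  define M where "M = length p"
  define w where "w = t2 - t1"
  have w1: "1 \<le> w" using t12 by (simp add: w_def)
  have pm: "p ! k \<in> set p" if "k < M" for k using that by (simp add: M_def)
  have pr: "p ! k \<in> roots" if "k < M" for k using pm[OF that] p(2) by blast
  have dist: "k = k'" if "k < M" "k' < M" "p ! k = p ! k'" for k k'
    using R.pth_distinct[OF p(1)] that by (simp add: M_def nth_eq_iff_index_eq)
  have "\<exists>u v. Suc k < M \<longrightarrow> u \<in> grp (p ! k) \<and> v \<in> grp (p ! Suc k) \<and> adj u v" for k
  proof (cases "Suc k < M")
    case True
    then have "radj (p ! k) (p ! Suc k)" using p(1) by (simp add: R.pth_def successively_conv_nth M_def)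
    then show ?thesis by (auto simp: radj_def)
  qed simp
  then obtain X Y where XY: "\<And>k. Suc k < M \<Longrightarrow> X k \<in> grp (p ! k) \<and> Y k \<in> grp (p ! Suc k) \<and> adj (X k) (Y k)" by metis
  have "\<exists>q. 0 < k \<and> Suc k < M \<longrightarrow> pth q \<and> set q \<subseteq> grp (p ! k) \<and> hd q = Y (k - 1) \<and> last q = X k \<and> length q \<le> 2 * w" for k
  proof (cases "0 < k \<and> Suc k < M")
    case True
    then have "Y (k - 1) \<in> grp (p ! k)" "X k \<in> grp (p ! k)" using XY[of "k - 1"] XY[of k] by auto
    from grp_path[OF this] show ?thesis by (auto simp: w_def)
  qed blast
  then obtain sg where sg: "\<And>k. 0 < k \<Longrightarrow> Suc k < M \<Longrightarrow>
      pth (sg k) \<and> set (sg k) \<subseteq> grp (p ! k) \<and> hd (sg k) = Y (k - 1) \<and> last (sg k) = X k \<and> length (sg k) \<le> 2 * w" by metis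
  have lg: "light u" "u \<in> ball t2" "t1 < dep u" "dep u \<le> t2" if "u \<in> grp x" for u x
    using that grp_light light_ball light_dep by blast+
  have Xd: "h < dep u" "anc u h = z" "anc u (Suc h) = anc (p ! k) (Suc h)" if "u \<in> grp (p ! k)" "k < M" for u k
    using grp_anc[OF that(1), of h] grp_anc[OF that(1), of "Suc h"] h[OF pm[OF that(2)]] by auto
  \<comment> \<open>\<open>sg k\<close> crosses group \<open>k\<close> from its entry
    \<open>Y (k - 1)\<close> to its exit \<open>X k\<close>. \<open>L\<close> counts the vertices of
    the stretch strictly between groups \<open>i\<close> and \<open>j\<close>, and \<open>pl\<close>
    puts the tree path from \<open>z\<close> in front of it.\<close>
  define L where "L i j = (\<Sum>k\<in>{Suc i..<j}. length (sg k))" for i j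
  define pl where "pl i j = chain (X i) h @ concat (map sg [Suc i..<j])" for i j
  have pl: "pth (pl i j) \<and> hd (pl i j) = z \<and> last (pl i j) = X (j - 1) \<and>
      set (pl i j) \<subseteq> set (chain (X i) h) \<union> (\<Union>k\<in>{Suc i..<j}. grp (p ! k)) \<and> length (pl i j) = dep (X i) - h + 1 + L i j"
    if ij: "Suc i \<le> j" "j < M" for i j
    using ij
  proof (induction j rule: nat_induct_at_least)
    case base
    have iM: "i < M" "X i \<in> grp (p ! i)" using base XY[of i] by auto
    note ch = chain_props[OF lg(2)[OF iM(2)] less_imp_le[OF Xd(1)[OF iM(2,1)]]]
    show ?case using ch Xd(2)[OF iM(2,1)] by (simp add: pl_def L_def)
  next
    case (Suc j)
    have IH: "pth (pl i j)" "hd (pl i j) = z" "last (pl i j) = X (j - 1)"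
      "set (pl i j) \<subseteq> set (chain (X i) h) \<union> (\<Union>k\<in>{Suc i..<j}. grp (p ! k))" "length (pl i j) = dep (X i) - h + 1 + L i j"
      using Suc.IH Suc.prems by auto
    have iM: "i < M" "X i \<in> grp (p ! i)" using Suc XY[of i] by auto
    have j: "0 < j" "Suc j < M" "Suc (j - 1) = j" using Suc by auto
    note s = sg[OF j(1,2)]
    have e: "pl i (Suc j) = pl i j @ sg j" using Suc.hyps by (simp add: pl_def)
    have sne: "sg j \<noteq> []" "pl i j \<noteq> []" using s IH(1) pth_ne by auto
    have "set (pl i j) \<inter> grp (p ! j) = {}"
    proof -
      have "p ! k \<noteq> p ! j" if "k \<in> {Suc i..<j}" for k using dist[of k j] that j by auto
      then have "(\<Union>k\<in>{Suc i..<j}. grp (p ! k)) \<inter> grp (p ! j) = {}" using grp_disj by blast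
      moreover have "set (chain (X i) h) \<inter> grp (p ! j) = {}"
      proof -
        have "p ! i \<noteq> p ! j" using dist[of i j] Suc.hyps j by auto
        moreover have "y \<in> grp (p ! i)" if "y \<in> set (chain (X i) h)" "y \<in> grp (p ! j)" for y
          using chain_light_grp[OF iM(2) less_imp_le[OF Xd(1)[OF iM(2,1)]] that(1) grp_light[OF that(2)]] .
        ultimately show ?thesis using grp_disj[of "p ! i" "p ! j"] by blast
      qed
      ultimately show ?thesis using IH(4) by blast
    qed
    then have "set (pl i j) \<inter> set (sg j) = {}" using s by blast
    moreover have "adj (last (pl i j)) (hd (sg j))" using IH(3) s XY[of "j - 1"] j by simp
    ultimately have "pth (pl i (Suc j))" unfolding e using IH(1) s sne by (subst pth_append) auto
    moreover have "set (sg j) \<subseteq> (\<Union>k\<in>{Suc i..<Suc j}. grp (p ! k))" using s Suc.hyps by fastforce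
    then have "set (pl i (Suc j)) \<subseteq> set (chain (X i) h) \<union> (\<Union>k\<in>{Suc i..<Suc j}. grp (p ! k))"
      unfolding e using IH(4) by fastforce
    moreover have "length (pl i (Suc j)) = dep (X i) - h + 1 + L i (Suc j)"
      unfolding e using IH(5) Suc.hyps by (simp add: L_def)
    ultimately show ?case using IH(2) s sne e by simp
  qed
  have cyc: "\<exists>c. cyc c \<and> set c \<subseteq> V \<and> int (length c) = int (dep (X i)) + int (dep (Y (j - 1))) + 1 + int (L i j) - 2 * int h"
    if ij: "i < j" "j < M" and lab: "anc (p ! i) (Suc h) \<noteq> anc (p ! j) (Suc h)"
      and big: "3 \<le> dep (X i) + dep (Y (j - 1)) + 1 + L i j - 2 * h" for i j
  proof -
    have x: "X i \<in> grp (p ! i)" "i < M" using XY[of i] ij by auto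
    have y: "Y (j - 1) \<in> grp (p ! j)" "adj (X (j - 1)) (Y (j - 1))" using XY[of "j - 1"] ij by auto
    let ?y = "Y (j - 1)"
    have P: "pth (pl i j)" "hd (pl i j) = z" "last (pl i j) = X (j - 1)"
      "set (pl i j) \<subseteq> set (chain (X i) h) \<union> (\<Union>k\<in>{Suc i..<j}. grp (p ! k))" "length (pl i j) = dep (X i) - h + 1 + L i j"
      using pl[of i j] ij by auto
    have yb: "?y \<in> ball t2" and hy: "Suc h \<le> dep ?y" using lg(2)[OF y(1)] Xd(1)[OF y(1) ij(2)] by auto
    have xb: "X i \<in> ball t2" and hx: "h < dep (X i)" using lg(2)[OF x(1)] Xd(1)[OF x] by auto
    note cy = chain_props[OF yb hy]
    have cne: "chain ?y (Suc h) \<noteq> []" using pth_ne[OF cy(1)] .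
    \<comment> \<open>A common vertex would give both sides the same ancestor at depth
      \<open>Suc h\<close>, against \<open>lab\<close>.\<close>
    have d1: "set (chain (X i) h) \<inter> set (chain ?y (Suc h)) = {}"
    proof (rule ccontr)
      assume "\<not> ?thesis"
      then obtain v where v: "v \<in> set (chain (X i) h)" "v \<in> set (chain ?y (Suc h))" by blast
      obtain g where g: "g \<le> dep (X i)" "v = anc (X i) g" using v(1) chain_props(5)[OF xb less_imp_le[OF hx]] by auto
      obtain g' where g': "Suc h \<le> g'" "g' \<le> dep ?y" "v = anc ?y g'" using v(2) cy(5) by auto
      have "g = g'" using anc_props(2)[OF xb g(1)] anc_props(2)[OF yb g'(2)] g(2) g'(3) by simp
      then have "anc v (Suc h) = anc (X i) (Suc h)" "anc v (Suc h) = anc ?y (Suc h)"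
        using anc_anc[OF xb, of "Suc h" g] anc_anc[OF yb, of "Suc h" g'] g g' by auto
      then show False using lab Xd(3)[OF x] Xd(3)[OF y(1) ij(2)] by simp
    qed
    have d2: "grp (p ! k) \<inter> set (chain ?y (Suc h)) = {}" if k: "k \<in> {Suc i..<j}" for k
    proof -
      have "p ! k \<noteq> p ! j" using dist[of k j] k ij by auto
      moreover have "v \<in> grp (p ! j)" if "v \<in> grp (p ! k)" "v \<in> set (chain ?y (Suc h))" for v
        using chain_light_grp[OF y(1) hy that(2) grp_light[OF that(1)]] .
      ultimately show ?thesis using grp_disj[of "p ! k" "p ! j"] by blast
    qed
    let ?c = "pl i j @ rev (chain ?y (Suc h))"
    have "set (pl i j) \<inter> set (chain ?y (Suc h)) = {}" using P(4) d1 d2 by blast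
    then have "pth ?c"
      using P(1,3) cy(1,3) y(2) cne pth_ne[OF P(1)] by (subst pth_append) (auto simp: hd_rev)
    moreover have "last ?c = anc ?y (Suc h)" "hd ?c = z" using cy(2) cne P(2) pth_ne[OF P(1)] by (simp_all add: last_rev)
    moreover have "adj z (anc ?y (Suc h))" using anc_adj[OF yb, of h] hy Xd(2)[OF y(1) ij(2)] by simp
    moreover have len: "length ?c = dep (X i) - h + 1 + L i j + (dep ?y - h)"
      unfolding length_append length_rev P(5) cy(4) using hy by linarith
    moreover have "3 \<le> length ?c" unfolding len using big hx hy by linarith
    ultimately have "cyc ?c" using adj_sym by (simp add: cyc_def)
    moreover have "set ?c \<subseteq> V"
    proof -
      have "set (chain (X i) h) \<subseteq> ball t2" "set (chain ?y (Suc h)) \<subseteq> ball t2"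
        using chain_props(5)[OF xb less_imp_le[OF hx]] cy(5) anc_props(1)[OF xb] anc_props(1)[OF yb] by auto
      moreover have "grp (p ! k) \<subseteq> ball t2" for k using lg(2) by blast
      ultimately have "set (pl i j) \<subseteq> ball t2" "set (chain ?y (Suc h)) \<subseteq> ball t2"
        using P(4) by (meson UN_least Un_least subset_trans)+
      then show ?thesis using ball_V[of t2] by (simp only: set_append set_rev) blast
    qed
    moreover have "int (length ?c) = int (dep (X i)) + int (dep ?y) + 1 + int (L i j) - 2 * int h"
      unfolding len using hx hy by simp
    ultimately show ?thesis by blast
  qed
  \<comment> \<open>Both tree paths end at depth at least \<open>t1 + 1\<close>, so
    \<open>\<tau>\<close> vertices in the stretch make the cycle at least \<open>l\<close>
    long.\<close>
  define \<tau> where "\<tau> = l + 2 * h - (2 * t1 + 3)"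
  have \<tau>: "\<tau> + 2 * t1 + 3 = l + 2 * h" using l(1) by (simp add: \<tau>_def)
  have M2: "2 * (l + 2 * w + 5) \<le> M" using l(2) by (simp add: w_def M_def)
  have iM: "2 * Suc i \<le> M" using i(1) by (simp add: M_def)
  have hT: "h \<le> t2"
  proof -
    have "p ! 0 \<in> set p" using M2 by (intro pm) simp
    then have "h < dep (p ! 0)" "light (p ! 0)" using h(1) p(2) rootsD(1) by auto
    then show ?thesis using light_dep[of "p ! 0"] by simp
  qed
  have \<tau>le: "\<tau> \<le> l + 2 * w" using \<tau> hT t12 by (simp add: w_def)
  have ex: "Suc (Suc i) \<le> M - 1 \<and> \<tau> \<le> L (Suc i) (M - 1)"
  proof -
    have "(\<Sum>k\<in>{Suc (Suc i)..<M - 1}. 1) \<le> L (Suc i) (M - 1)"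
      unfolding L_def
    proof (rule sum_mono)
      fix k assume "k \<in> {Suc (Suc i)..<M - 1}"
      then have "0 < k" "Suc k < M" by auto
      then have "sg k \<noteq> []" using sg[of k] pth_ne[of "sg k"] by blast
      then show "1 \<le> length (sg k)" by (simp add: Suc_le_eq)
    qed
    then have "M - 1 - Suc (Suc i) \<le> L (Suc i) (M - 1)" by simp
    moreover have "Suc (Suc i) \<le> M - 1 \<and> (\<forall>y\<ge>M - 1 - Suc (Suc i). \<tau> \<le> y)" using \<tau>le M2 iM by auto
    ultimately show ?thesis by blast
  qed
  define j where "j = (LEAST j. Suc (Suc i) \<le> j \<and> \<tau> \<le> L (Suc i) j)"
  have j: "Suc (Suc i) \<le> j" "\<tau> \<le> L (Suc i) j"
    using LeastI[of "\<lambda>j. Suc (Suc i) \<le> j \<and> \<tau> \<le> L (Suc i) j", OF ex] by (simp_all add: j_def)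
  have jM: "j \<le> M - 1" unfolding j_def using ex by (rule Least_le)
  have jM': "j < M" using jM M2 by simp
  have Lj: "L (Suc i) j \<le> \<tau> + 2 * w"
  proof (cases "j = Suc (Suc i)")
    case True
    then show ?thesis by (simp add: L_def)
  next
    case False
    then obtain j' where j': "j = Suc j'" "Suc (Suc i) \<le> j'" using j(1) by (cases j) auto
    have "\<not> \<tau> \<le> L (Suc i) j'" using not_less_Least[of j' "\<lambda>j. Suc (Suc i) \<le> j \<and> \<tau> \<le> L (Suc i) j"] j' j_def by auto
    moreover have "L (Suc i) j = L (Suc i) j' + length (sg j')" using j' by (simp add: L_def)
    moreover have "length (sg j') \<le> 2 * w" using sg[of j'] j' jM' by auto
    ultimately show ?thesis by linarith
  qed
  have Li: "L i j = length (sg (Suc i)) + L (Suc i) j" using j(1) unfolding L_def by (intro sum.atLeast_Suc_lessThan) simp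
  have sgi: "length (sg (Suc i)) \<le> 2 * w" using sg[of "Suc i"] j jM' by auto
  \<comment> \<open>Not both sides of the split can agree with \<open>j\<close>. Starting at
    \<open>i\<close> instead of \<open>Suc i\<close> adds one group, at most \<open>2 * w\<close>
    vertices, to the overshoot of at most \<open>2 * w\<close> from the minimality of
    \<open>j\<close>.\<close>
  obtain i' where i': "i' < j" "anc (p ! i') (Suc h) \<noteq> anc (p ! j) (Suc h)" "\<tau> \<le> L i' j" "L i' j \<le> \<tau> + 4 * w"
  proof (cases "anc (p ! i) (Suc h) = anc (p ! j) (Suc h)")
    case True
    then show ?thesis using that[of "Suc i"] i(2) j Lj by simp
  next
    case False
    then show ?thesis using that[of i] j Lj Li sgi by simp
  qed
  have "X i' \<in> grp (p ! i')" "Y (j - 1) \<in> grp (p ! j)" using XY[of i'] XY[of "j - 1"] i'(1) jM' by auto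
  then have d: "t1 < dep (X i')" "dep (X i') \<le> t2" "t1 < dep (Y (j - 1))" "dep (Y (j - 1)) \<le> t2" using lg by blast+
  have "3 \<le> dep (X i') + dep (Y (j - 1)) + 1 + L i' j - 2 * h" using d i'(3) \<tau> l(1) by linarith
  from cyc[OF i'(1) jM' i'(2) this] obtain c where c: "cyc c" "set c \<subseteq> V"
    "int (length c) = int (dep (X i')) + int (dep (Y (j - 1))) + 1 + int (L i' j) - 2 * int h" by blast
  have "l \<le> length c" using c(3) d i'(3) \<tau> by linarith
  moreover have "length c \<le> l + 7 * w" using c(3) d i'(4) \<tau> t12 unfolding w_def by linarith
  ultimately show ?thesis using c(1,2) unfolding w_def by blast
qed

lemma group_cycles:
  assumes p: "R.pth p" "set p \<subseteq> roots"
    and l: "2 * t1 + 3 \<le> l" "2 * (l + 2 * (t2 - t1) + 5) \<le> length p"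
  shows "\<exists>c. cyc c \<and> set c \<subseteq> V \<and> l \<le> length c \<and> length c \<le> l + 7 * (t2 - t1)"
proof -
  let ?M = "length p"
  have "10 \<le> 2 * (l + 2 * (t2 - t1) + 5)" by simp
  then have M2: "2 \<le> ?M" using l(2) by linarith
  have dist: "distinct p" by (rule R.pth_distinct[OF p(1)])
  define Q where "Q h \<longleftrightarrow> (\<forall>x\<in>set p. h \<le> dep x) \<and> (\<exists>z. \<forall>x\<in>set p. anc x h = z)" for h
  have pb: "x \<in> ball t2" "light x" "rt x = x" if "x \<in> set p" for x using that p(2) rootsD light_ball by blast+
  have lt: "0 < ?M" "1 < ?M" using M2 by linarith+
  have p0: "p ! 0 \<in> set p" "p ! 1 \<in> set p" using lt by (simp_all del: One_nat_def)
  have p01: "p ! 0 \<noteq> p ! 1" using nth_eq_iff_index_eq[OF dist lt] by simp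
  have "Q 0" unfolding Q_def using anc_0 pb(1) by blast
  moreover have "\<forall>h. Q h \<longrightarrow> h < Suc t2"
    using p0(1) light_dep[OF pb(2)[OF p0(1)]] by (fastforce simp: Q_def)
  ultimately obtain h where h: "Q h" and mx: "\<And>h'. Q h' \<Longrightarrow> h' \<le> h"
    using ex_has_greatest_nat[of Q 0 "\<lambda>h. h" "Suc t2"] by blast
  obtain z where z: "\<And>x. x \<in> set p \<Longrightarrow> anc x h = z" and hle: "\<And>x. x \<in> set p \<Longrightarrow> h \<le> dep x" using h by (auto simp: Q_def)
  \<comment> \<open>A root on the path at depth \<open>h\<close> would be \<open>z\<close>, hence a
    light ancestor of every other root on the path and in the same group.\<close>
  have hl: "h < dep x" if x: "x \<in> set p" for x
  proof (rule ccontr)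
    assume "\<not> ?thesis"
    then have "h = dep x" using hle[OF x] by simp
    then have zx: "z = x" using z[OF x] by simp
    obtain y where y: "y \<in> set p" "y \<noteq> x" using p0 p01 by metis
    have "anc y h = x" using z[OF y(1)] zx by simp
    then have "rt x = rt y" using rt_anc[OF pb(2)[OF y(1)] hle[OF y(1)]] pb(2)[OF x] by simp
    then show False using pb(3) x y by simp
  qed
  have "\<exists>i. Suc i < ?M \<and> anc (p ! i) (Suc h) \<noteq> anc (p ! Suc i) (Suc h)"
  proof (rule ccontr)
    assume n: "\<not> ?thesis"
    have "i < ?M \<Longrightarrow> anc (p ! i) (Suc h) = anc (p ! 0) (Suc h)" for i
    proof (induction i)
      case (Suc i)
      then show ?case using n by auto
    qed simp
    then have "\<forall>x\<in>set p. anc x (Suc h) = anc (p ! 0) (Suc h)" by (metis in_set_conv_nth)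
    then have "Q (Suc h)" unfolding Q_def using hl by (auto simp: Suc_le_eq)
    then show False using mx[of "Suc h"] by simp
  qed
  then obtain i where i: "Suc i < ?M" "anc (p ! i) (Suc h) \<noteq> anc (p ! Suc i) (Suc h)" by blast
  show ?thesis
  proof (cases "2 * Suc i \<le> ?M")
    case True
    then show ?thesis using cycle_from_split[OF p hl z True i(2) l] by blast
  next
    case False
    \<comment> \<open>On the reversed path the split lies in the first half.\<close>
    let ?i = "?M - 2 - i"
    have e: "rev p ! ?i = p ! Suc i" "rev p ! Suc ?i = p ! i"
      using i(1) by (auto simp: rev_nth intro!: arg_cong[of _ _ "(!) p"])
    have "2 * Suc ?i \<le> length (rev p)" using False i(1) by simp
    moreover have "R.pth (rev p)" "set (rev p) \<subseteq> roots" using p by simp_all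
    ultimately show ?thesis
      using cycle_from_split[of "rev p" h z ?i l] hl z e i(2) l by simp
  qed
qed

end

section \<open>Choosing the window\<close>

context bfs
begin

definition lay :: "nat \<Rightarrow> 'a set" where
  "lay j = {v \<in> ball j. dep v = j}"

lemma fin_lay: "finite (lay j)"
  unfolding lay_def by (rule finite_subset[OF _ fin_ball[of j]]) blast

lemma thin_layer:
  assumes K: "0 < K"
  shows "\<exists>j\<in>{x..<x + K}. K * card (lay j) \<le> card (ball (x + K - 1))"
proof (rule ccontr)
  assume "\<not> ?thesis"
  then have gt: "\<And>j. j \<in> {x..<x + K} \<Longrightarrow> card (ball (x + K - 1)) < K * card (lay j)" by force
  have "K * card (ball (x + K - 1)) = (\<Sum>j\<in>{x..<x + K}. card (ball (x + K - 1)))" by simp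
  also have "\<dots> < (\<Sum>j\<in>{x..<x + K}. K * card (lay j))" using gt K by (intro sum_strict_mono) auto
  also have "\<dots> = K * (\<Sum>j\<in>{x..<x + K}. card (lay j))" by (rule sum_distrib_left[symmetric])
  also have "(\<Sum>j\<in>{x..<x + K}. card (lay j)) = card (\<Union>j\<in>{x..<x + K}. lay j)"
    using fin_lay by (intro card_UN_disjoint[symmetric]) (auto simp: lay_def)
  also have "\<dots> \<le> card (ball (x + K - 1))"
  proof (intro card_mono fin_ball)
    have "lay j \<subseteq> ball (x + K - 1)" if "j < x + K" for j
    proof -
      have "ball j \<subseteq> ball (x + K - 1)" using that by (intro ball_mono) simp
      then show ?thesis by (auto simp: lay_def)
    qed
    then show "(\<Union>j\<in>{x..<x + K}. lay j) \<subseteq> ball (x + K - 1)" by fastforce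
  qed
  finally show False by simp
qed

lemma ball_growth:
  fixes \<alpha> :: real
  assumes ex: "\<And>U. U \<subseteq> V \<Longrightarrow> 2 * card U \<le> card V \<Longrightarrow> \<alpha> * card U \<le> card (nb V U)" and \<alpha>: "0 < \<alpha>"
  shows "2 * card (ball (i + j)) \<le> card V \<Longrightarrow> (1 + \<alpha>) ^ j * card (ball i) \<le> card (ball (i + j))"
proof (induction j)
  case (Suc j)
  have "card (ball (i + j)) \<le> card (ball (i + Suc j))" by (intro card_mono fin_ball ball_mono) simp
  then have le: "2 * card (ball (i + j)) \<le> card V" using Suc.prems by linarith
  have "card (ball (Suc (i + j))) = card (ball (i + j)) + card (nb V (ball (i + j)))"
    using fin_ball finite_nb[OF finV] nb_disjoint[of V "ball (i + j)"] by (simp add: card_Un_disjoint Int_commute)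
  moreover have "\<alpha> * card (ball (i + j)) \<le> card (nb V (ball (i + j)))" by (rule ex[OF ball_V le])
  ultimately have "(1 + \<alpha>) * card (ball (i + j)) \<le> card (ball (i + Suc j))" by (simp add: algebra_simps)
  moreover have "(1 + \<alpha>) * ((1 + \<alpha>) ^ j * card (ball i)) \<le> (1 + \<alpha>) * card (ball (i + j))"
    using Suc.IH[OF le] \<alpha> by (intro mult_left_mono) auto
  ultimately show ?case by (simp add: mult.assoc)
qed simp

text \<open>Bernoulli's inequality turns growth by \<open>1 + \<alpha>\<close> per level into
  doubling every \<open>a\<close> levels.\<close>

lemma ball_double:
  fixes \<alpha> :: real
  assumes ex: "\<And>U. U \<subseteq> V \<Longrightarrow> 2 * card U \<le> card V \<Longrightarrow> \<alpha> * card U \<le> card (nb V U)" and \<alpha>: "0 < \<alpha>"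
    and a: "1 \<le> real a * \<alpha>" and le: "2 * card (ball (i + a * k)) \<le> card V"
  shows "2 ^ k * card (ball i) \<le> card (ball (i + a * k))"
proof -
  have "2 \<le> 1 + real a * \<alpha>" using a by simp
  also have "\<dots> \<le> (1 + \<alpha>) ^ a" using \<alpha> by (intro Bernoulli_inequality) simp
  finally have "2 ^ k \<le> ((1 + \<alpha>) ^ a) ^ k" by (intro power_mono) auto
  then have "2 ^ k * real (card (ball i)) \<le> (1 + \<alpha>) ^ (a * k) * card (ball i)"
    by (intro mult_right_mono) (auto simp: power_mult)
  also have "\<dots> \<le> card (ball (i + a * k))" by (rule ball_growth[OF ex \<alpha> le])
  finally have "real (2 ^ k * card (ball i)) \<le> real (card (ball (i + a * k)))" by simp
  then show ?thesis by (simp only: of_nat_le_iff)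
qed

end

context sgraph
begin

text \<open>\<open>a\<close> stands for \<open>1 / \<alpha>\<close> up to a factor two. The window
  runs from below radius \<open>s0\<close>, where the ball passes a tenth of the vertices, to at
  least \<open>s1\<close>, where it passes half: it holds \<open>4 / 10\<close> of the vertices, and
  as balls double every \<open>a\<close> levels it has only \<open>O(a)\<close> levels, which keeps
  the error \<open>O(1 / \<alpha>)\<close>.\<close>

theorem expander_cycles:
  fixes \<alpha> :: real
  assumes finV: "finite V" and \<alpha>: "0 < \<alpha>" "\<alpha> \<le> 1" and a: "1 \<le> real a * \<alpha>" "real a * \<alpha> \<le> 2"
    and ex: "\<And>U. U \<subseteq> V \<Longrightarrow> 2 * card U \<le> card V \<Longrightarrow> \<alpha> * card U \<le> card (nb V U)"
    and k: "card V \<le> 2 ^ k" and big: "200000000 * a ^ 4 \<le> card V"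
    and l: "2 * (a * k) + 3 \<le> l" "2000000 * (a ^ 3 * l) \<le> card V"
  shows "\<exists>c. cyc c \<and> set c \<subseteq> V \<and> l \<le> length c \<and> length c \<le> l + 301 * a"
proof -
  let ?n = "card V"
  have a1: "1 \<le> a" using a(1) by (cases a) auto
  have apow: "a \<le> a ^ 4" "a ^ 3 \<le> a ^ 4" "a * a \<le> a ^ 4" "1 \<le> a ^ 4"
    using power_increasing[of 1 4 a] power_increasing[of 3 4 a] power_increasing[of 2 4 a] power_increasing[of 0 4 a] a1
    by (simp_all add: power2_eq_square)
  have n7: "10000000 \<le> ?n" using big apow(4) by linarith
  have "V \<noteq> {}" using n7 by auto
  then obtain r where "r \<in> V" by blast
  then interpret bfs adj V r using finV by unfold_locales
  define K where "K = 20 * a"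
  have K0: "0 < K" using a1 by (simp add: K_def)
  have ak: "?n < 2 * card (ball (a * k))"
  proof (rule ccontr)
    assume c: "\<not> ?thesis"
    then have "2 * card (ball (0 + a * k)) \<le> ?n" by simp
    from ball_double[OF ex \<alpha>(1) a(1) this] have "2 ^ k \<le> card (ball (a * k))" by simp
    then show False using c k n7 by arith
  qed
  define s1 where "s1 = (LEAST i. ?n < 2 * card (ball i))"
  have s1: "?n < 2 * card (ball s1)" unfolding s1_def using ak by (rule LeastI)
  have s1k: "s1 \<le> a * k" unfolding s1_def using ak by (rule Least_le)
  define s0 where "s0 = (LEAST i. ?n < 10 * card (ball i))"
  have s1': "?n < 10 * card (ball s1)" using s1 by linarith
  have s0: "?n < 10 * card (ball s0)" unfolding s0_def using s1' by (rule LeastI)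
  have s01: "s0 \<le> s1" unfolding s0_def using s1' by (rule Least_le)
  have below: "10 * card (ball i) \<le> ?n" if "i < s0" for i
    using not_less_Least[of i "\<lambda>i. ?n < 10 * card (ball i)"] that by (simp add: s0_def)
  have s0pos: "1 \<le> s0" using s0 n7 by (cases s0) auto
  have s1s0: "s1 \<le> s0 + a * 3"
  proof -
    have "?n < 2 * card (ball (s0 + a * 3))"
    proof (rule ccontr)
      assume "\<not> ?thesis"
      then have le: "2 * card (ball (s0 + a * 3)) \<le> ?n" by simp
      from ball_double[OF ex \<alpha>(1) a(1) le] have "8 * card (ball s0) \<le> card (ball (s0 + a * 3))" by simp
      then show False using le s0 by linarith
    qed
    then show ?thesis unfolding s1_def by (rule Least_le)
  qed
  \<comment> \<open>If \<open>s0 \<le> K\<close>, level 0 with its single vertex serves. Otherwise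
    \<open>K\<close> levels inside a ball of at most \<open>?n / 10\<close> vertices include one of
    at most \<open>?n / (200 * a)\<close>.\<close>
  have "\<exists>t1. t1 < s0 \<and> s0 \<le> t1 + K \<and> 200 * a * card (lay t1) \<le> ?n"
  proof (cases "s0 \<le> K")
    case True
    have "lay 0 \<subseteq> {r}" by (auto simp: lay_def)
    then have "card (lay 0) \<le> card {r}" by (intro card_mono) auto
    then have "card (lay 0) \<le> 1" by simp
    then have "200 * a * card (lay 0) \<le> 200 * a * 1" by (rule mult_le_mono2)
    also have "\<dots> \<le> ?n" using big apow(1) by linarith
    finally show ?thesis using True s0pos by (intro exI[of _ 0]) simp
  next
    case False
    obtain j where j: "j \<in> {s0 - K..<s0 - K + K}" "K * card (lay j) \<le> card (ball (s0 - K + K - 1))"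
      using thin_layer[OF K0, of "s0 - K"] by blast
    have "10 * card (ball (s0 - 1)) \<le> ?n" using below[of "s0 - 1"] s0pos by simp
    moreover have "s0 - K + K - 1 = s0 - 1" using False by simp
    ultimately have "10 * (K * card (lay j)) \<le> ?n" using j(2) by simp
    then show ?thesis using j(1) False by (intro exI[of _ j]) (auto simp: K_def mult.assoc)
  qed
  then obtain t1 where t1: "t1 < s0" "s0 \<le> t1 + K" "200 * a * card (lay t1) \<le> ?n" by blast
  obtain j where j: "j \<in> {Suc s1..<Suc s1 + K}" "K * card (lay j) \<le> card (ball (Suc s1 + K - 1))"
    using thin_layer[OF K0, of "Suc s1"] by blast
  define t2 where "t2 = j - 1"
  have t2: "s1 \<le> t2" "t2 < s1 + K" "Suc t2 = j" using j(1) by (auto simp: t2_def)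
  have lay2: "20 * a * card (lay (Suc t2)) \<le> ?n"
  proof -
    have "card (ball (Suc s1 + K - 1)) \<le> ?n" by (intro card_mono finV ball_V)
    then show ?thesis using j(2) t2(3) by (simp add: K_def)
  qed
  have t12: "t1 < t2" using t1 t2 s01 by linarith
  define w where "w = t2 - t1"
  have w: "w \<le> 43 * a" "1 \<le> w" using t1 t2 s1s0 t12 by (auto simp: w_def K_def)
  \<comment> \<open>By \<open>heavy_count\<close> this leaves at most \<open>?n / (100 * a)\<close>
    heavy vertices; \<open>M\<close> is chosen below so that the groups on a stack have no more
    vertices than that.\<close>
  define s where "s = 100 * w * a"
  have s_le: "s \<le> 4300 * (a * a)" using mult_le_mono1[OF w(1), of "100 * a"] by (simp add: s_def mult.commute mult.left_commute)
  have s_pos: "0 < s" using w a1 by (simp add: s_def)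
  interpret bfs_window adj V r t1 t2 s using t12 by unfold_locales
  define M where "M = ?n div (100 * a * s)"
  have sM: "100 * a * (s * M) \<le> ?n" 
  proof -
    have "(100 * a * s) * M \<le> ?n" unfolding M_def by (rule times_div_less_eq_dividend)
    then show ?thesis by (simp only: mult.assoc)
  qed
  have hv: "100 * a * card {v \<in> Wd. \<not> light v} \<le> ?n"
  proof -
    have "w * (100 * a * card {v \<in> Wd. \<not> light v}) \<le> w * ?n"
      using heavy_count by (simp add: s_def w_def mult.commute mult.left_commute)
    then show ?thesis using w(2) by simp
  qed
  have sn: "1000 * s \<le> ?n" using s_le apow(3) big by linarith
  have cW: "10 * card Wd \<ge> 4 * ?n"
  proof -
    have "ball s1 - ball t1 \<subseteq> Wd" using ball_mono[OF t2(1)] ball_iff by (fastforce simp: Wd_def)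
    then have "card (ball s1 - ball t1) \<le> card Wd" by (intro card_mono fin_Wd)
    moreover have "card (ball s1) - card (ball t1) \<le> card (ball s1 - ball t1)" by (rule diff_card_le_card_Diff[OF fin_ball])
    ultimately show ?thesis using s1 below[OF t1(1)] by linarith
  qed
  have "card Wd = card {u. light u} + card {v \<in> Wd. \<not> light v}"
  proof -
    have "Wd = {u. light u} \<union> {v \<in> Wd. \<not> light v}" by (auto simp: light_def)
    then show ?thesis using fin_light fin_Wd card_Un_disjoint[of "{u. light u}" "{v \<in> Wd. \<not> light v}"] by auto
  qed
  moreover have "100 * card {v \<in> Wd. \<not> light v} \<le> ?n"
    using order_trans[OF mult_le_mono1[OF a1, of "100 * card {v \<in> Wd. \<not> light v}"]] hv by (simp add: mult.assoc mult.left_commute)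
  ultimately have lg: "100 * card {u. light u} \<ge> 39 * ?n" using cW by linarith
  \<comment> \<open>At most half of the vertices, so that expansion applies, and less than the
    \<open>39 / 100\<close> that are light.\<close>
  define \<theta> where "\<theta> = 3 * ?n div 10"
  have \<theta>: "10 * \<theta> \<le> 3 * ?n" "3 * ?n < 10 * \<theta> + 10" unfolding \<theta>_def by linarith+
  have lays: "card {v \<in> ball (Suc t2). dep v = t1 \<or> dep v = Suc t2} \<le> card (lay t1) + card (lay (Suc t2))"
  proof -
    have "{v \<in> ball (Suc t2). dep v = t1 \<or> dep v = Suc t2} \<subseteq> lay t1 \<union> lay (Suc t2)"
      using in_ball_dep by (fastforce simp: lay_def)
    then have "card {v \<in> ball (Suc t2). dep v = t1 \<or> dep v = Suc t2} \<le> card (lay t1 \<union> lay (Suc t2))"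
      by (intro card_mono) (auto simp: fin_lay)
    then show ?thesis using card_Un_le[of "lay t1" "lay (Suc t2)"] by linarith
  qed
  have "\<exists>p. R.pth p \<and> set p \<subseteq> roots \<and> M \<le> length p"
  proof (rule long_group_path[OF ex \<alpha>(1)])
    show "\<theta> \<le> card {u. light u}" "2 * \<theta> \<le> card V" "s \<le> \<theta>" using \<theta> lg sn n7 by linarith+
    let ?S = "s * M + card {v \<in> Wd. \<not> light v} + card {v \<in> ball (Suc t2). dep v = t1 \<or> dep v = Suc t2}"
    \<comment> \<open>In units of \<open>?n / (200 * a)\<close>, the stack, the heavy vertices and
      the two levels cost at most 2, 2, 1 and 10, while expansion yields at least 40.\<close>
    have "200 * a * ?S \<le> 200 * a * (s * M + card {v \<in> Wd. \<not> light v} + (card (lay t1) + card (lay (Suc t2))))"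
      using lays by (intro mult_le_mono2) linarith
    also have "\<dots> = 2 * (100 * a * (s * M)) + 2 * (100 * a * card {v \<in> Wd. \<not> light v}) + 200 * a * card (lay t1) + 10 * (20 * a * card (lay (Suc t2)))"
      by (simp add: algebra_simps)
    also have "\<dots> \<le> 15 * ?n" using sM hv t1(3) lay2 by linarith
    finally have S: "real (200 * a * ?S) \<le> real (15 * ?n)" by (simp only: of_nat_le_iff)
    have "real a * (\<alpha> * real (\<theta> - s)) = (real a * \<alpha>) * real (\<theta> - s)" by simp
    moreover have "1 * real (\<theta> - s) \<le> (real a * \<alpha>) * real (\<theta> - s)" using a(1) by (intro mult_right_mono) auto
    ultimately have 1: "real (\<theta> - s) \<le> real a * (\<alpha> * real (\<theta> - s))" by simp
    have "real (\<theta> - s) \<ge> 2 / 10 * ?n" using \<theta> sn n7 by linarith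
    then have "15 / 200 * real ?n < real a * (\<alpha> * real (\<theta> - s))" using 1 n7 by linarith
    moreover have "real a * real ?S \<le> 15 / 200 * real ?n" using S by simp
    ultimately have "real a * real ?S < real a * (\<alpha> * real (\<theta> - s))" by linarith
    then show "real ?S < \<alpha> * real (\<theta> - s)" using a1 by (simp add: mult_less_cancel_left_pos)
  qed
  then obtain p where p: "R.pth p" "set p \<subseteq> roots" "M \<le> length p" by blast
  have "2 * (l + 2 * (t2 - t1) + 5) \<le> length p"
  proof -
    let ?x = "2 * (l + 2 * w + 5)"
    have "?x \<le> 2 * l + 182 * a" using w(1) a1 by simp
    then have "100 * a * s * ?x \<le> 100 * a * s * (2 * l + 182 * a)" by (rule mult_le_mono2)
    also have "\<dots> \<le> 100 * a * (4300 * (a * a)) * (2 * l + 182 * a)"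
      using s_le by (intro mult_le_mono1 mult_le_mono2)
    also have "\<dots> = 860000 * (a ^ 3 * l) + 78260000 * a ^ 4" by (simp add: algebra_simps power_numeral_reduce)
    also have "\<dots> \<le> ?n" using l(2) big by linarith
    finally have "?x \<le> M" unfolding M_def using a1 s_pos by (simp add: less_eq_div_iff_mult_less_eq mult.commute)
    then show ?thesis using p(3) unfolding w_def by linarith
  qed
  then obtain c where "cyc c" "set c \<subseteq> V" "l \<le> length c" "length c \<le> l + 7 * (t2 - t1)"
    using group_cycles[OF p(1,2) _, of l] l(1) s1k s01 t1(1) by fastforce
  then show ?thesis using w(1) unfolding w_def by (intro exI[of _ c]) simp
qed

end

section \<open>The three ranges of \<open>\<alpha>\<close>\<close>

lemma cycle_of_cyc:
  assumes sg: "simple_graph V E"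
    and c: "\<exists>c. sgraph.cyc (\<lambda>u v. {u, v} \<in> E) c \<and> set c \<subseteq> V \<and> nat l \<le> length c \<and> length c \<le> nat l + B"
    and l: "0 \<le> l" and B: "real B \<le> A"
  shows "\<exists>p. is_cycle V E p \<and> real_of_int l \<le> real (cycle_length p) \<and> real (cycle_length p) \<le> real_of_int l + A"
proof -
  obtain c where c: "sgraph.cyc (\<lambda>u v. {u, v} \<in> E) c" "nat l \<le> length c" "length c \<le> nat l + B" using c by blast
  have "real (nat l) \<le> real (length c)" "real (length c) \<le> real (nat l + B)"
    using c(2,3) by (simp_all only: of_nat_le_iff)
  then have "real_of_int l \<le> real (length c)" "real (length c) \<le> real_of_int l + A" using B l by linarith+
  then show ?thesis using is_cycle_of_cyc[OF sg c(1)] by (intro exI[of _ c] conjI) simp_all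
qed

lemma expander_half:
  assumes "expander \<alpha> V E" "U \<subseteq> V" "2 * card U \<le> card V"
  shows "\<alpha> * real (card U) \<le> real (card (sgraph.nb (\<lambda>u v. {u, v} \<in> E) V U))"
proof (rule expanderD[OF assms(1,2)])
  have "real (card U) \<le> real (card V) / 2" using assms(3) by linarith
  also have "\<dots> \<le> of_int \<lceil>real (card V) / 2\<rceil>" by (rule le_of_int_ceiling)
  finally show "int (card U) \<le> \<lceil>real (card V) / 2\<rceil>" by linarith
qed

lemma log2_ge_1: "2 \<le> n \<Longrightarrow> 1 \<le> log 2 (real n)"
  using one_le_log_cancel_iff[of 2 "real n"] by simp

text \<open>The ceiling matters: a set of \<open>k\<close> vertices, half of the order rounded up,
  must have \<open>k\<close> neighbours, so the order is even. If \<open>w\<close> had fewer than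
  \<open>k\<close> neighbours, some \<open>k\<close> non-neighbours of \<open>w\<close> would have
  all their neighbours outside themselves and \<open>w\<close>, among fewer than \<open>k\<close>
  vertices.\<close>

lemma cycles_one_expander:
  assumes e: "expander 1 V E" and n: "2 \<le> card V"
    and l: "4 * log 2 (card V) \<le> real_of_int l" "real_of_int l \<le> card V"
  shows "\<exists>p. is_cycle V E p \<and> real_of_int l \<le> real (cycle_length p) \<and> real (cycle_length p) \<le> real_of_int l + 1"
proof -
  have sg: "simple_graph V E" using e by (simp add: expander_def)
  interpret sgraph "\<lambda>u v. {u, v} \<in> E" by (rule sgraph_of_simple_graph[OF sg])
  have fin: "finite V" using sg by (simp add: simple_graph_def)
  define k where "k = (card V + 1) div 2"
  have kV: "card V \<le> 2 * k" unfolding k_def by linarith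
  have nbk: "k \<le> card (nb V U)" if "U \<subseteq> V" "card U = k" for U
  proof -
    have "real (card U) \<le> real (card V) / 2 + 1 / 2" using that(2) unfolding k_def by linarith
    moreover have "2 * k < card V + 2" unfolding k_def by linarith
    moreover have "real_of_int \<lceil>real (card V) / 2\<rceil> \<ge> real (card V) / 2" by (rule le_of_int_ceiling)
    ultimately have "int (card U) \<le> \<lceil>real (card V) / 2\<rceil>" using that(2) unfolding k_def by linarith
    from expanderD[OF e that(1) this] that(2) show ?thesis by simp
  qed
  have even: "2 * k \<le> card V"
  proof -
    have "k \<le> card V" unfolding k_def using n by linarith
    then obtain U where U: "U \<subseteq> V" "card U = k" using obtain_subset_with_card_n by metis
    have "card (nb V U) \<le> card (V - U)" using fin by (intro card_mono) (auto simp: nb_def)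
    also have "\<dots> = card V - k" using card_Diff_subset[OF finite_subset[OF U(1) fin] U(1)] U(2) by simp
    finally show ?thesis using nbk[OF U] unfolding k_def by linarith
  qed
  have deg: "card V \<le> 2 * card {u \<in> V. {w, u} \<in> E}" if w: "w \<in> V" for w
  proof (rule ccontr)
    assume c: "\<not> ?thesis"
    let ?D = "{u \<in> V. {w, u} \<in> E}" and ?Z = "{u \<in> V. {w, u} \<notin> E} - {w}"
    have "V = insert w (?D \<union> ?Z)" using w by auto
    then have "card V \<le> Suc (card (?D \<union> ?Z))" using card_insert_le_m1[of "Suc (card (?D \<union> ?Z))" "?D \<union> ?Z" w] by simp
    also have "\<dots> \<le> Suc (card ?D + card ?Z)" using card_Un_le by simp
    finally have "k \<le> card ?Z" using c even kV by linarith
    then obtain U where U: "U \<subseteq> ?Z" "card U = k" by (rule obtain_subset_with_card_n)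
    have UV: "U \<subseteq> V - {w}" using U by auto
    have "nb V U \<subseteq> (V - {w}) - U" using U(1) by (auto simp: nb_def insert_commute)
    then have "card (nb V U) \<le> card ((V - {w}) - U)" using fin by (intro card_mono) auto
    also have "\<dots> = card V - 1 - k" using card_Diff_subset[OF finite_subset[OF UV] UV] fin w U(2) by simp
    finally show False using nbk[OF _ U(2)] UV n unfolding k_def by fastforce
  qed
  have "4 \<le> real_of_int l" using l(1) log2_ge_1[OF n] by linarith
  then have "4 \<le> nat l" "nat l \<le> card V" "0 \<le> l" using l(2) by linarith+
  then show ?thesis using dirac_cycles[OF fin deg, of "nat l"] by (intro cycle_of_cyc[OF sg, of l 1]) auto
qed

lemma cycles_near_one_expander:
  assumes e: "expander \<alpha> V E" and \<alpha>: "1 - 1 / 10 ^ 9 \<le> \<alpha>" "\<alpha> < 1" and n: "10 ^ 6 \<le> (1 - \<alpha>) * card V"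
    and l: "12 * log 2 (card V) \<le> real_of_int l" "real_of_int l \<le> (1 - 2 * 10 ^ 6 * (1 - \<alpha>)) * card V"
  shows "\<exists>p. is_cycle V E p \<and> real_of_int l \<le> real (cycle_length p) \<and> real (cycle_length p) \<le> real_of_int l + 2"
proof -
  have sg: "simple_graph V E" using e by (simp add: expander_def)
  interpret sgraph "\<lambda>u v. {u, v} \<in> E" by (rule sgraph_of_simple_graph[OF sg])
  have fin: "finite V" using sg by (simp add: simple_graph_def)
  have "(1 - \<alpha>) * real (card V) \<le> 1 * real (card V)" using \<alpha> by (intro mult_right_mono) auto
  moreover have "1000000 \<le> (1 - \<alpha>) * real (card V)" using n by simp
  ultimately have n2: "2 \<le> card V" by linarith
  have "additive (1 - \<alpha>) V"
    unfolding additive_def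
  proof (intro conjI allI impI fin, elim conjE)
    fix U assume U: "U \<subseteq> V" "2 * card U \<le> card V"
    have "(1 - \<alpha>) * card U \<le> (1 - \<alpha>) * card V" using U(2) \<alpha> by (intro mult_left_mono) auto
    then show "real (card U) - (1 - \<alpha>) * real (card V) \<le> card (nb V U)"
      using expander_half[OF e U] by (simp add: algebra_simps)
  qed
  then obtain h where h: "2 ^ h \<le> 16 * card V" and cy: "\<And>l. 2 * h + 2 \<le> l \<Longrightarrow>
      real l \<le> (1 - 2 * 10 ^ 6 * (1 - \<alpha>)) * real (card V) \<Longrightarrow> \<exists>c. cyc c \<and> set c \<subseteq> V \<and> l \<le> length c \<and> length c \<le> l + 2"
    using near_dirac_cycles[of "1 - \<alpha>" V] \<alpha> n by auto
  have "real (2 ^ h) \<le> real (16 * card V)" using h by (simp only: of_nat_le_iff)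
  then have "real h \<le> log 2 (16 * real (card V))" using le_log_of_power[of 2 h "16 * real (card V)"] by simp
  also have "\<dots> = 4 + log 2 (card V)" using n2 log_pow_cancel[of 2 4] by (simp add: log_mult)
  finally have "real (2 * h + 2) \<le> 12 * log 2 (card V)" using log2_ge_1[OF n2] by simp
  then have l0: "real (2 * h + 2) \<le> real_of_int l" using l(1) by linarith
  then have "2 * h + 2 \<le> nat l" "0 \<le> l" by linarith+
  then show ?thesis using cy[of "nat l"] l(2) by (intro cycle_of_cyc[OF sg, of l 2]) auto
qed

text \<open>With \<open>a \<le> 2 / \<alpha>\<close>, \<open>301 * a\<close> becomes
  \<open>602 / \<alpha>\<close> and \<open>2000000 * a ^ 3\<close> becomes
  \<open>16000000 / \<alpha> ^ 3\<close>; \<open>20 / \<alpha>\<close> covers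
  \<open>2 * (a * k) + 3\<close> for the rounded-up logarithm \<open>k\<close>.\<close>

lemma cycles_expander:
  assumes e: "expander \<alpha> V E" and \<alpha>: "0 < \<alpha>" "\<alpha> \<le> 1" and n: "200000000 * nat \<lceil>1 / \<alpha>\<rceil> ^ 4 \<le> card V"
    and l: "20 / \<alpha> * log 2 (card V) \<le> real_of_int l" "real_of_int l \<le> \<alpha> ^ 3 / 16000000 * card V"
  shows "\<exists>p. is_cycle V E p \<and> real_of_int l \<le> real (cycle_length p) \<and> real (cycle_length p) \<le> real_of_int l + 602 / \<alpha>"
proof -
  have sg: "simple_graph V E" using e by (simp add: expander_def)
  interpret sgraph "\<lambda>u v. {u, v} \<in> E" by (rule sgraph_of_simple_graph[OF sg])
  have fin: "finite V" using sg by (simp add: simple_graph_def)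
  define a where "a = nat \<lceil>1 / \<alpha>\<rceil>"
  have i1: "1 \<le> 1 / \<alpha>" using \<alpha> by simp
  have a: "1 / \<alpha> \<le> real a" "real a \<le> 1 / \<alpha> + 1" unfolding a_def using i1 by linarith+
  have a2: "real a \<le> 2 / \<alpha>" using a(2) i1 by (simp add: add_divide_distrib[symmetric] field_simps)
  have a\<alpha>: "1 \<le> real a * \<alpha>" "real a * \<alpha> \<le> 2" using a(1) a2 \<alpha>(1) by (simp_all add: field_simps)
  have a1: "1 \<le> a" using a(1) i1 by linarith
  have "1 \<le> a ^ 4" using a1 by simp
  then have n2: "2 \<le> card V" using n unfolding a_def[symmetric] by linarith
  define L where "L = log 2 (card V)"
  have L1: "1 \<le> L" unfolding L_def by (rule log2_ge_1[OF n2])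
  define k where "k = nat \<lceil>L\<rceil>"
  have k: "L \<le> real k" "real k \<le> L + 1" unfolding k_def using L1 by linarith+
  have "real (card V) = 2 powr L" using n2 by (simp add: L_def)
  also have "\<dots> \<le> 2 powr real k" using k(1) by simp
  also have "\<dots> = real (2 ^ k)" by (simp add: powr_realpow)
  finally have nk: "card V \<le> 2 ^ k" by (simp only: of_nat_le_iff)
  have "real a * real k \<le> 2 / \<alpha> * (2 * L)" using a2 k(2) L1 \<alpha>(1) by (intro mult_mono) simp_all
  moreover have "1 * 1 \<le> 1 / \<alpha> * L" using i1 L1 \<alpha>(1) by (intro mult_mono) simp_all
  ultimately have "real (2 * (a * k) + 3) \<le> 20 / \<alpha> * L" by simp
  then have "real (2 * (a * k) + 3) \<le> real_of_int l" using l(1) by (simp add: L_def)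
  then have l1: "2 * (a * k) + 3 \<le> nat l" "0 \<le> l" by linarith+
  have "real a ^ 3 \<le> (2 / \<alpha>) ^ 3" using a2 by (intro power_mono) auto
  also have "\<dots> = 8 / \<alpha> ^ 3" by (simp add: power_divide)
  finally have a3: "real a ^ 3 \<le> 8 / \<alpha> ^ 3" .
  have "real a ^ 3 * real_of_int l \<le> 8 / \<alpha> ^ 3 * (\<alpha> ^ 3 / 16000000 * card V)"
    using a3 l(2) l1(2) \<alpha> by (intro mult_mono) auto
  also have "\<dots> = card V / 2000000" using \<alpha> by simp
  finally have "real (2000000 * (a ^ 3 * nat l)) \<le> real (card V)" using l1(2) by simp
  then have l2: "2000000 * (a ^ 3 * nat l) \<le> card V" by (simp only: of_nat_le_iff)
  have "\<exists>c. cyc c \<and> set c \<subseteq> V \<and> nat l \<le> length c \<and> length c \<le> nat l + 301 * a"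
    by (rule expander_cycles[OF fin \<alpha> a\<alpha> expander_half[OF e] nk n[folded a_def] l1(1) l2])
  moreover have "real (301 * a) \<le> 602 / \<alpha>" using a2 by simp
  ultimately show ?thesis by (rule cycle_of_cyc[OF sg _ l1(2)])
qed

lemma two_powr_log_inverse:
  assumes "0 < \<alpha>"
  shows "2 powr (- (c * log 2 (1 / \<alpha>) / \<alpha>)) = \<alpha> powr (c / \<alpha>)"
proof -
  have "2 powr (- (c * log 2 (1 / \<alpha>) / \<alpha>)) = 2 powr (log 2 \<alpha> * (c / \<alpha>))"
    using assms by (simp add: log_divide mult.commute)
  also have "\<dots> = (2 powr log 2 \<alpha>) powr (c / \<alpha>)" by (simp add: powr_powr)
  also have "\<dots> = \<alpha> powr (c / \<alpha>)" using assms by simp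
  finally show ?thesis .
qed

text \<open>From \<open>ln \<alpha> \<le> \<alpha> - 1\<close> and \<open>1 + x \<le> exp x\<close>.
  It reduces the demanded bound on \<open>a2\<close> to a comparison of rational functions of
  \<open>\<alpha>\<close>.\<close>

lemma powr_le_inverse_linear:
  fixes \<alpha> :: real
  assumes "0 < \<alpha>" "\<alpha> \<le> 1" "0 \<le> c"
  shows "\<alpha> powr c \<le> 1 / (1 + c * (1 - \<alpha>))"
proof -
  have "1 - \<alpha> \<le> - ln \<alpha>" using ln_le_minus_one[OF assms(1)] by simp
  then have "1 + c * (1 - \<alpha>) \<le> 1 + - (c * ln \<alpha>)" using mult_left_mono[OF _ assms(3)] by fastforce
  also have "\<dots> \<le> exp (- (c * ln \<alpha>))" by (rule exp_ge_add_one_self)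
  finally have "inverse (exp (- (c * ln \<alpha>))) \<le> inverse (1 + c * (1 - \<alpha>))"
    using assms by (intro le_imp_inverse_le) (auto intro: add_pos_nonneg)
  then show ?thesis using assms by (simp add: powr_def exp_minus inverse_eq_divide)
qed

theorem theorem1:
  shows "\<exists>c::real. c > 0 \<and>
    (\<forall>\<alpha>::real. 0 < \<alpha> \<and> \<alpha> \<le> 1 \<longrightarrow>
      (\<exists>A a1 a2 :: real.
         0 < A \<and> A \<le> c / \<alpha> \<and>
         0 < a1 \<and> a1 \<le> c / \<alpha> \<and>
         0 < a2 \<and> a2 \<ge> 2 powr (- (c * log 2 (1 / \<alpha>) / \<alpha>)) \<and>
         (\<exists>N::nat. \<forall>n\<ge>N. \<forall>(V :: 'a set) E.
            card V = n \<and> expander \<alpha> V E \<longrightarrow>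
            (\<forall>l::int. a1 * log 2 (real n) \<le> real_of_int l \<and> real_of_int l \<le> a2 * real n \<longrightarrow>
               (\<exists>p. is_cycle V E p \<and>
                    real_of_int l \<le> real (cycle_length p) \<and>
                    real (cycle_length p) \<le> real_of_int l + A)))))"
proof (rule exI[of _ "10 ^ 17"], intro conjI allI impI, goal_cases)
  case 1
  show ?case by simp
next
  case (2 \<alpha>)
  \<comment> \<open>large enough for \<open>\<alpha> powr (c - 3) \<le> 1 / 16000000\<close> as soon as \<open>\<alpha> < 1 - 1 / 10 ^ 9\<close>\<close>
  let ?c = "10 ^ 17 :: real"
  have \<alpha>: "0 < \<alpha>" "\<alpha> \<le> 1" using 2 by auto
  have c\<alpha>: "?c \<le> ?c / \<alpha>" using \<alpha> by (simp add: field_simps)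
  have pw: "2 powr (- (?c * log 2 (1 / \<alpha>) / \<alpha>)) \<le> \<alpha> powr ?c"
    unfolding two_powr_log_inverse[OF \<alpha>(1)] using c\<alpha> \<alpha> by (intro powr_mono') auto
  consider (one) "\<alpha> = 1" | (near) "1 - 1 / 10 ^ 9 \<le> \<alpha>" "\<alpha> < 1" | (far) "\<alpha> < 1 - 1 / 10 ^ 9" using \<alpha> by linarith
  then show ?case
  proof cases
    case one
    show ?thesis
      by (rule exI[of _ 1], rule exI[of _ 4], rule exI[of _ 1])
        (use one in \<open>auto intro!: exI[of _ 2] cycles_one_expander\<close>)
  next
    case near
    define \<epsilon> where "\<epsilon> = 1 - \<alpha>"
    have \<epsilon>: "0 < \<epsilon>" "\<epsilon> \<le> 1 / 10 ^ 9" using near by (simp_all add: \<epsilon>_def)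
    define a2 where "a2 = 1 - 2 * 10 ^ 6 * \<epsilon>"
    have "\<alpha> powr ?c \<le> 1 / (1 + ?c * \<epsilon>)" unfolding \<epsilon>_def using \<alpha> by (intro powr_le_inverse_linear) auto
    also have "\<dots> \<le> a2"
    proof -
      have "\<epsilon> * \<epsilon> \<le> \<epsilon> * (1 / 10 ^ 9)" using \<epsilon> by (intro mult_left_mono) auto
      \<comment> \<open>The gain \<open>?c * \<epsilon>\<close> outweighs
        \<open>2 * 10 ^ 6 * \<epsilon>\<close> and the quadratic term because
        \<open>\<epsilon> \<le> 1 / 10 ^ 9\<close>.\<close>
      then have "1 \<le> a2 * (1 + ?c * \<epsilon>)" using \<epsilon>(1) by (simp add: a2_def algebra_simps)
      then show ?thesis using \<epsilon>(1) by (simp add: pos_divide_le_eq add_pos_pos)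
    qed
    finally have a2c: "2 powr (- (?c * log 2 (1 / \<alpha>) / \<alpha>)) \<le> a2" using pw by linarith
    have a2pos: "0 < a2" using \<epsilon> by (simp add: a2_def)
    obtain N where N: "10 ^ 6 / \<epsilon> \<le> real N" using real_arch_simple by blast
    have big: "10 ^ 6 \<le> (1 - \<alpha>) * real n" if "N \<le> n" for n
    proof -
      have "10 ^ 6 / \<epsilon> \<le> real n" using N that by linarith
      then show ?thesis using \<epsilon>(1) by (simp add: pos_divide_le_eq \<epsilon>_def[symmetric] mult.commute)
    qed
    show ?thesis
    proof (rule exI[of _ 2], rule exI[of _ 12], rule exI[of _ a2], intro conjI exI[of _ N] allI impI, goal_cases)
      case (7 n V E l)
      then show ?case using cycles_near_one_expander[OF _ near, of V E l] big[of n] by (simp add: a2_def \<epsilon>_def)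
    qed (use c\<alpha> a2c a2pos in simp_all)
  next
    case far
    define a2 where "a2 = \<alpha> ^ 3 / 16000000"
    have "\<alpha> powr ?c = \<alpha> powr 3 * \<alpha> powr (?c - 3)" by (simp flip: powr_add)
    also have "\<alpha> powr 3 = \<alpha> ^ 3" using \<alpha>(1) by simp
    also have "\<alpha> ^ 3 * \<alpha> powr (?c - 3) \<le> \<alpha> ^ 3 * (1 / 16000000)"
    proof (rule mult_left_mono)
      have "\<alpha> powr (?c - 3) \<le> 1 / (1 + (?c - 3) * (1 - \<alpha>))" using \<alpha> by (intro powr_le_inverse_linear) auto
      also have "\<dots> \<le> 1 / 16000000" using far by (intro divide_left_mono) auto
      finally show "\<alpha> powr (?c - 3) \<le> 1 / 16000000" .
    qed (use \<alpha> in simp)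
    finally have "\<alpha> powr ?c \<le> a2" by (simp add: a2_def)
    then have a2c: "2 powr (- (?c * log 2 (1 / \<alpha>) / \<alpha>)) \<le> a2" using pw by linarith
    show ?thesis
    proof (rule exI[of _ "602 / \<alpha>"], rule exI[of _ "20 / \<alpha>"], rule exI[of _ a2],
        intro conjI exI[of _ "200000000 * nat \<lceil>1 / \<alpha>\<rceil> ^ 4"] allI impI, goal_cases)
      case (7 n V E l)
      then show ?case using cycles_expander[OF _ \<alpha>, of V E l] by (simp add: a2_def)
    qed (use \<alpha> a2c in \<open>simp_all add: a2_def divide_right_mono\<close>)
  qed
qed

end
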